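(* Let $G$ be an infinite compact abelian group with dual group $\varGamma$ and let $\varLambda\subset\varGamma$. If $\varLambda$ is a nicely placed Riesz set (i.e. $\varLambda$ is both nicely placed and a Riesz set), then $L^1_\varLambda(G)$ is a small subspace of $L^1(G)$.
   Context: $\varGamma$ is the (discrete) group of continuous homomorphisms $G \to \mathbb T$; $m$ is the normalized Haar measure on $G$; $L^1(G)=L^1(G,m)$ (complex-valued); $M(G)$ is the space of regular complex Borel measures on $G$. $\hat f(\gamma) = \int_G f\overline\gamma\,dm$ and $\hat\mu(\gamma) = \int_G \overline\gamma\,d\mu$. $L^1_\varLambda(G)$ (resp. $M_\varLambda(G)$) is the set of elements of $L^1(G)$ (resp. $M(G)$) whose Fourier(-Stieltjes) transform vanishes on $\varGamma\setminus\varLambda$. $\varLambda$ is a Riesz set if every $\mu\in M_\varLambda(G)$ is absolutely continuous with respect to $m$. $\varLambda$ is nicely placed if the closed unit ball of $L^1_\varLambda(G)$ is closed with respect to convergence in measure (with respect to $m$). For a Borel set $A\subset G$, $L^1(A)$ denotes the subspace of those $f\in L^1(G)$ that vanish almost everywhere outside $A$, and $P_A : L^1(G)\to L^1(A)$ is $P_A(f)=\chi_A f$. A subspace $X$ of $L^1(G)$ is small if there is no Borel set $A$ with $m(A)>0$ such that $P_A$ maps $X$ onto $L^1(A)$. *)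

theory Defs
  imports "HOL-Analysis.Analysis"
begin

text \<open>
  Compact abelian groups are written additively: a type of class
  \<open>topological_ab_group_add\<close> and \<open>t2_space\<close> whose \<open>UNIV\<close> is compact.  No metrizability or
  second countability is imposed, so regularity of Borel measures has to be stated explicitly.
\<close>

definition dual_group :: "('a::topological_ab_group_add \<Rightarrow> complex) set" where
  "dual_group = {\<gamma>. continuous_on UNIV \<gamma> \<and> (\<forall>x. norm (\<gamma> x) = 1) \<and>
     (\<forall>x y. \<gamma> (x + y) = \<gamma> x * \<gamma> y)}"

definition regular_on_borel :: "('a::topological_space set \<Rightarrow> ennreal) \<Rightarrow> bool" where
  "regular_on_borel \<nu> \<longleftrightarrow> (\<forall>E\<in>sets borel.
     \<nu> E = (INF U\<in>{U. open U \<and> E \<subseteq> U}. \<nu> U) \<and>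
     \<nu> E = (SUP K\<in>{K. compact K \<and> K \<in> sets borel \<and> K \<subseteq> E}. \<nu> K))"

definition normalized_haar :: "'a::topological_ab_group_add measure \<Rightarrow> bool" where
  "normalized_haar m \<longleftrightarrow> sets m = sets borel \<and> emeasure m UNIV = 1 \<and>
     (\<forall>x. \<forall>A\<in>sets borel. emeasure m ((\<lambda>y. x + y) ` A) = emeasure m A) \<and>
     regular_on_borel (emeasure m)"


text \<open>
  A complex Borel measure is a set function; its values outside \<open>sets borel\<close> are irrelevant.
\<close>

definition complex_borel_measure :: "('a::topological_space set \<Rightarrow> complex) \<Rightarrow> bool" where
  "complex_borel_measure \<mu> \<longleftrightarrow> (\<forall>A :: nat \<Rightarrow> 'a set.
     range A \<subseteq> sets borel \<and> disjoint_family A \<longrightarrow> (\<lambda>i. \<mu> (A i)) sums \<mu> (\<Union>i. A i))"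

definition total_variation :: "('a::topological_space set \<Rightarrow> complex) \<Rightarrow> 'a set \<Rightarrow> ennreal" where
  "total_variation \<mu> E =
     (SUP A\<in>{A :: nat \<Rightarrow> 'a set. range A \<subseteq> sets borel \<and> disjoint_family A \<and> (\<Union>i. A i) = E}.
        \<Sum>i. ennreal (norm (\<mu> (A i))))"

definition M_space :: "('a::topological_space set \<Rightarrow> complex) set" where
  "M_space = {\<mu>. complex_borel_measure \<mu> \<and> regular_on_borel (total_variation \<mu>)}"

text \<open>
  The positive part in the Jordan decomposition of a real measure \<open>\<nu>\<close>, namely
  \<open>A \<mapsto> sup {\<nu> B | B \<subseteq> A Borel}\<close>.  The truncation of negative values by \<open>ennreal\<close> is harmless
  since \<open>B = {}\<close> contributes 0.  The negative part of \<open>\<nu>\<close> is the positive part of \<open>- \<nu>\<close>.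
\<close>

definition pos_variation :: "('a::topological_space set \<Rightarrow> real) \<Rightarrow> 'a measure" where
  "pos_variation \<nu> =
     measure_of UNIV (sets borel) (\<lambda>A. SUP B\<in>{B \<in> sets borel. B \<subseteq> A}. ennreal (\<nu> B))"

definition real_measure_integral ::
    "('a::topological_space set \<Rightarrow> real) \<Rightarrow> ('a \<Rightarrow> complex) \<Rightarrow> complex" where
  "real_measure_integral \<nu> f =
     integral\<^sup>L (pos_variation \<nu>) f - integral\<^sup>L (pos_variation (\<lambda>A. - \<nu> A)) f"

definition complex_measure_integral ::
    "('a::topological_space set \<Rightarrow> complex) \<Rightarrow> ('a \<Rightarrow> complex) \<Rightarrow> complex" where
  "complex_measure_integral \<mu> f =
     real_measure_integral (\<lambda>A. Re (\<mu> A)) f + \<i> * real_measure_integral (\<lambda>A. Im (\<mu> A)) f"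

definition fourier_stieltjes ::
    "('a::topological_space set \<Rightarrow> complex) \<Rightarrow> ('a \<Rightarrow> complex) \<Rightarrow> complex" where
  "fourier_stieltjes \<mu> \<gamma> = complex_measure_integral \<mu> (\<lambda>x. cnj (\<gamma> x))"

definition M_spectrum ::
    "('a::topological_ab_group_add \<Rightarrow> complex) set \<Rightarrow> ('a set \<Rightarrow> complex) set" where
  "M_spectrum \<Lambda> = {\<mu> \<in> M_space. \<forall>\<gamma>\<in>dual_group - \<Lambda>. fourier_stieltjes \<mu> \<gamma> = 0}"

definition riesz_set ::
    "'a::topological_ab_group_add measure \<Rightarrow> ('a \<Rightarrow> complex) set \<Rightarrow> bool" where
  "riesz_set m \<Lambda> \<longleftrightarrow> (\<forall>\<mu>\<in>M_spectrum \<Lambda>. \<forall>A\<in>sets borel. emeasure m A = 0 \<longrightarrow> \<mu> A = 0)"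


text \<open>
  Elements of \<open>L\<^sup>1\<close> are represented by integrable functions, with equality almost everywhere
  in place of equality.  All sets of representatives below are saturated under it.
\<close>

definition L1_space :: "'a measure \<Rightarrow> ('a \<Rightarrow> complex) set" where
  "L1_space m = {f. integrable m f}"

definition L1_norm :: "'a measure \<Rightarrow> ('a \<Rightarrow> complex) \<Rightarrow> real" where
  "L1_norm m f = (\<integral>x. norm (f x) \<partial>m)"

definition fourier :: "'a measure \<Rightarrow> ('a \<Rightarrow> complex) \<Rightarrow> ('a \<Rightarrow> complex) \<Rightarrow> complex" where
  "fourier m f \<gamma> = (\<integral>x. f x * cnj (\<gamma> x) \<partial>m)"

definition L1_spectrum ::
    "'a::topological_ab_group_add measure \<Rightarrow> ('a \<Rightarrow> complex) set \<Rightarrow> ('a \<Rightarrow> complex) set" where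
  "L1_spectrum m \<Lambda> = {f \<in> L1_space m. \<forall>\<gamma>\<in>dual_group - \<Lambda>. fourier m f \<gamma> = 0}"

definition converges_in_measure ::
    "'a measure \<Rightarrow> (nat \<Rightarrow> 'a \<Rightarrow> complex) \<Rightarrow> ('a \<Rightarrow> complex) \<Rightarrow> bool" where
  "converges_in_measure m f g \<longleftrightarrow>
     (\<forall>\<epsilon>>0. (\<lambda>n. measure m {x \<in> space m. norm (f n x - g x) > \<epsilon>}) \<longlonglongrightarrow> 0)"

text \<open>
  Convergence in measure on a probability space is pseudometrizable, so closedness is sequential.
  The ambient space consists of all measurable functions.
\<close>

definition closed_in_measure :: "'a measure \<Rightarrow> ('a \<Rightarrow> complex) set \<Rightarrow> bool" where
  "closed_in_measure m C \<longleftrightarrow> (\<forall>f g. (\<forall>n. f n \<in> C) \<and> g \<in> borel_measurable m \<and>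
     converges_in_measure m f g \<longrightarrow> g \<in> C)"

definition nicely_placed ::
    "'a::topological_ab_group_add measure \<Rightarrow> ('a \<Rightarrow> complex) set \<Rightarrow> bool" where
  "nicely_placed m \<Lambda> \<longleftrightarrow> closed_in_measure m {f \<in> L1_spectrum m \<Lambda>. L1_norm m f \<le> 1}"

definition L1_on :: "'a measure \<Rightarrow> 'a set \<Rightarrow> ('a \<Rightarrow> complex) set" where
  "L1_on m A = {f \<in> L1_space m. AE x in m. x \<notin> A \<longrightarrow> f x = 0}"

definition restriction_op :: "'a set \<Rightarrow> ('a \<Rightarrow> complex) \<Rightarrow> 'a \<Rightarrow> complex" where
  "restriction_op A f = (\<lambda>x. indicator A x * f x)"

definition L1_subspace :: "'a measure \<Rightarrow> ('a \<Rightarrow> complex) set \<Rightarrow> bool" where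
  "L1_subspace m X \<longleftrightarrow> X \<subseteq> L1_space m \<and> (\<lambda>_. 0) \<in> X \<and>
     (\<forall>f\<in>X. \<forall>g\<in>X. (\<lambda>x. f x + g x) \<in> X) \<and> (\<forall>c. \<forall>f\<in>X. (\<lambda>x. c * f x) \<in> X) \<and>
     (\<forall>f\<in>X. \<forall>g\<in>L1_space m. (AE x in m. f x = g x) \<longrightarrow> g \<in> X)"

definition small_subspace :: "'a measure \<Rightarrow> ('a \<Rightarrow> complex) set \<Rightarrow> bool" where
  "small_subspace m X \<longleftrightarrow> L1_subspace m X \<and>
     \<not> (\<exists>A\<in>sets m. emeasure m A > 0 \<and>
          (\<forall>g\<in>L1_on m A. \<exists>f\<in>X. AE x in m. restriction_op A f x = g x))"

end

theory Submission
  imports Defs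
begin

text \<open>
  Write \<open>X\<close> for the space of integrable functions with spectrum in \<open>\<Lambda>\<close> and suppose that every
  \<open>g \<in> L\<^sup>1(A)\<close> is the restriction of some \<open>f \<in> X\<close>, where \<open>m(A) > 0\<close>.

  Since the unit ball of \<open>X\<close> is closed in measure, a decreasing sequence of convex, norm bounded
  and closed conditions on elements of \<open>X\<close> can be satisfied simultaneously: near-minimisers of a
  strictly convex functional converge almost everywhere.  With Baire's argument this gives a bound
  \<open>M\<close> such that every indicator of \<open>I \<subseteq> A\<close> lifts to a function in \<open>X\<close> of norm at most \<open>M m(I)\<close>.
  Applied once more it gives lifts \<open>\<Phi> s\<close> of the indicators of a binary tree of cells \<open>I s\<close> with
  \<open>m(I s) \<rightarrow> 0\<close>, additive in the cell.

  The modulus of \<open>\<Phi>\<close> is an integrable function, so each cell can be squeezed between a compact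
  \<open>K s\<close> and an open \<open>U s\<close> such that along a suitable branch the functions
  \<open>D n = \<Phi> (\<sigma> n) / m(I (\<sigma> n))\<close> have uniformly little mass on all \<open>U s - K s\<close>.  Every weak* cluster
  point \<open>\<mu>\<close> of \<open>D\<close> has spectrum in \<open>\<Lambda>\<close>, and \<open>\<mu> (I (\<sigma> n))\<close> stays away from \<open>0\<close>.  Hence \<open>\<mu>\<close> charges
  the null set \<open>\<Inter>n. I (\<sigma> n)\<close>, contradicting the Riesz property.
\<close>

section \<open>Convex compactness in measure\<close>

text \<open>A weak* limit bounds compact sets from one side and open sets from the other, but the
  cells are merely Borel; without the squeeze, the unit mass that \<open>D k\<close> has on them
  could be lost in the limit. The squeeze looks circular: \<open>K\<close> and \<open>U\<close> must
  suit every \<open>D k\<close> on the branch, yet the branch is picked by the mass found between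
  them. So all nodes are squeezed in advance, at a total cost of \<open>c0\<close> measured by the
  modulus at the root, and the branch is found afterwards by a pigeonhole on weights that are
  additive in the cell. This is what additivity of the lifts and of their modulus is for. The linear
  bound M m(I) fits this scheme because it is itself additive, and it keeps the normalised lifts
  bounded in norm. Norm bounded sequences in L1 need not have weakly convergent subsequences. The
  strictly convex functional replaces weak compactness: midpoints of admissible functions are
  admissible, so near-minimisers cannot stay far apart. As G need not be metrizable, cluster points
  are taken along a filter, and cells shrink in measure instead of diameter.\<close>

lemma AE_summable_of_integrals:
  fixes u :: "nat \<Rightarrow> 'a \<Rightarrow> real"
  assumes "\<And>k. integrable M (u k)" "\<And>k x. 0 \<le> u k x" "summable (\<lambda>k. \<integral>x. u k x \<partial>M)"
  shows "AE x in M. summable (\<lambda>k. u k x)"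
proof -
  have "(\<integral>\<^sup>+x. (\<Sum>k. ennreal (u k x)) \<partial>M) = (\<Sum>k. \<integral>\<^sup>+x. ennreal (u k x) \<partial>M)"
    using assms(1) by (intro nn_integral_suminf) auto
  also have "\<dots> = (\<Sum>k. ennreal (\<integral>x. u k x \<partial>M))"
    using assms(1,2) by (simp add: nn_integral_eq_integral)
  also have "\<dots> = ennreal (\<Sum>k. \<integral>x. u k x \<partial>M)"
    using assms by (intro suminf_ennreal2) (auto intro: Bochner_Integration.integral_nonneg)
  finally have "AE x in M. (\<Sum>k. ennreal (u k x)) \<noteq> \<infinity>"
    using assms(1) by (intro nn_integral_PInf_AE) auto
  then show ?thesis
    by eventually_elim (auto intro!: summable_suminf_not_top assms(2))
qed

text \<open>The length of the vector (1, z). It grows linearly, so its integral is finite on all of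
  L1, and unlike the modulus it is strictly convex, quantitatively so on discs.\<close>

definition japanese :: "complex \<Rightarrow> real" where
  "japanese z = sqrt (1 + (norm z)\<^sup>2)"

lemma japanese_pos: "0 < japanese z"
  and japanese_le: "japanese z \<le> 1 + norm z"
  and japanese_sq: "(japanese z)\<^sup>2 = 1 + (norm z)\<^sup>2"
proof -
  show "0 < japanese z" by (simp add: japanese_def add_pos_nonneg)
  show "japanese z \<le> 1 + norm z" unfolding japanese_def
    by (rule real_le_lsqrt) (auto simp: power2_eq_square algebra_simps)
  show "(japanese z)\<^sup>2 = 1 + (norm z)\<^sup>2" by (simp add: japanese_def)
qed

lemma japanese_measurable [measurable]: "japanese \<in> borel_measurable borel"
  unfolding japanese_def by measurable

text \<open>With \<open>p\<close> the product of the lengths of (1, a) and (1, b) and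
  \<open>q\<close> their inner product, p^2 - q^2 is at least |a - b|^2 by Cauchy-Schwarz, while (s
  - c)(s + c) = 2(p - q) for the sum \<open>s\<close> of the lengths and the length \<open>c\<close>
  of the sum vector. Bounding p + q by 2R^2 and s + c by 4R gives the constant 8R^3.\<close>

lemma japanese_strictly_convex:
  assumes "japanese a \<le> R" "japanese b \<le> R"
  shows "(norm (a - b))\<^sup>2 \<le> 8 * R ^ 3 * ((japanese a + japanese b) / 2 - japanese ((a + b) / 2))"
proof -
  define p where "p = japanese a * japanese b"
  define q where "q = 1 + a \<bullet> b"
  define s where "s = japanese a + japanese b"
  define c where "c = 2 * japanese ((a + b) / 2)"
  have R: "0 < R" using assms(1) japanese_pos[of a] by linarith
  have na: "(norm z)\<^sup>2 = z \<bullet> z" for z :: complex by (simp add: dot_square_norm)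
  have cs: "(a \<bullet> b)\<^sup>2 \<le> (a \<bullet> a) * (b \<bullet> b)" by (rule Cauchy_Schwarz_ineq)
  have p2: "p\<^sup>2 = 1 + a \<bullet> a + b \<bullet> b + (a \<bullet> a) * (b \<bullet> b)"
    by (simp add: p_def power_mult_distrib japanese_sq na algebra_simps)
  have d: "(norm (a - b))\<^sup>2 = a \<bullet> a + b \<bullet> b - 2 * (a \<bullet> b)"
    by (simp add: na inner_diff inner_commute algebra_simps)
  have q2: "q\<^sup>2 = 1 + 2 * (a \<bullet> b) + (a \<bullet> b)\<^sup>2"
    by (simp add: q_def power2_eq_square algebra_simps)
  have pq: "(norm (a - b))\<^sup>2 \<le> (p - q) * (p + q)"
    using cs p2 q2 d by (simp add: power2_eq_square algebra_simps)
  have p0: "0 \<le> p" by (simp add: p_def less_imp_le japanese_pos)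
  have pR: "p \<le> R\<^sup>2" unfolding p_def power2_eq_square
    using assms R by (intro mult_mono) (auto simp: less_imp_le japanese_pos)
  have "q\<^sup>2 \<le> p\<^sup>2" using pq by (simp add: power2_eq_square algebra_simps)
       (smt (verit) zero_le_power2 power2_eq_square)
  then have qp: "\<bar>q\<bar> \<le> p" using p0 abs_le_square_iff[of q p] by simp
  have "(p - q) * (p + q) \<le> (p - q) * (2 * R\<^sup>2)"
    using qp pR by (intro mult_left_mono) auto
  with pq have 1: "(norm (a - b))\<^sup>2 \<le> (p - q) * (2 * R\<^sup>2)" by linarith
  have c2: "c\<^sup>2 = 4 + (norm (a + b))\<^sup>2"
    by (simp add: c_def power_mult_distrib japanese_sq norm_divide power_divide)
  have s2: "s\<^sup>2 = 2 + a \<bullet> a + b \<bullet> b + 2 * p"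
    by (simp add: s_def power2_sum japanese_sq na p_def)
  have sc: "(s - c) * (s + c) = 2 * (p - q)"
    using c2 s2 unfolding q_def na by (simp add: inner_add inner_commute power2_eq_square algebra_simps)
  have c0: "0 \<le> c" and s0: "0 \<le> s" by (simp_all add: c_def s_def less_imp_le japanese_pos)
  have "c\<^sup>2 \<le> s\<^sup>2" using sc qp by (simp add: power2_eq_square algebra_simps)
  then have cls: "c \<le> s" using s0 by (rule power2_le_imp_le)
  have "(s - c) * (s + c) \<le> (s - c) * (4 * R)"
    using cls assms by (intro mult_left_mono) (auto simp: s_def)
  then have "p - q \<le> (s - c) * (2 * R)" using sc by simp
  then have "(p - q) * (2 * R\<^sup>2) \<le> (s - c) * (2 * R) * (2 * R\<^sup>2)"
    by (intro mult_right_mono) auto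
  also have "\<dots> = 8 * R ^ 3 * ((japanese a + japanese b) / 2 - japanese ((a + b) / 2))"
    by (simp add: s_def c_def power2_eq_square power3_eq_cube field_simps)
  finally show ?thesis using 1 by linarith
qed

lemma japanese_convex: "japanese ((a + b) / 2) \<le> (japanese a + japanese b) / 2"
proof -
  define R where "R = max (japanese a) (japanese b)"
  have "0 \<le> 8 * R ^ 3 * ((japanese a + japanese b) / 2 - japanese ((a + b) / 2))"
    by (rule order_trans[OF _ japanese_strictly_convex]) (auto simp: R_def)
  moreover have "0 < R" using japanese_pos[of a] by (simp add: R_def less_max_iff_disj)
  ultimately show ?thesis by (simp add: zero_le_mult_iff)
qed

lemma integrable_japanese:
  assumes "finite_measure M" "integrable M f"
  shows "integrable M (\<lambda>x. japanese (f x))"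
    and "(\<integral>x. japanese (f x) \<partial>M) \<le> measure M (space M) + (\<integral>x. norm (f x) \<partial>M)"
proof -
  interpret finite_measure M by fact
  have i: "integrable M (\<lambda>x. 1 + norm (f x))" using assms(2) by simp
  show *: "integrable M (\<lambda>x. japanese (f x))"
    by (rule Bochner_Integration.integrable_bound[OF i])
      (use assms(2) japanese_le in \<open>auto simp: less_imp_le[OF japanese_pos]\<close>)
  have "(\<integral>x. japanese (f x) \<partial>M) \<le> (\<integral>x. 1 + norm (f x) \<partial>M)"
    by (intro integral_mono * i japanese_le)
  then show "(\<integral>x. japanese (f x) \<partial>M) \<le> measure M (space M) + (\<integral>x. norm (f x) \<partial>M)"
    using assms(2) by simp
qed

text \<open>
  The sequence is obtained by almost minimising a strictly convex functional over the sets \<open>C n\<close>;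
  consecutive near-minimisers are close to each other because their midpoint is again admissible.
\<close>
lemma decreasing_convex_families_converge:
  fixes C :: "nat \<Rightarrow> (nat \<Rightarrow> 'a \<Rightarrow> complex) set"
  assumes fin: "finite_measure M"
    and ne: "\<And>n. C n \<noteq> {}" and dec: "\<And>n. C (Suc n) \<subseteq> C n"
    and mid: "\<And>n f g. f \<in> C n \<Longrightarrow> g \<in> C n \<Longrightarrow> (\<lambda>i x. (f i x + g i x) / 2) \<in> C n"
    and int: "\<And>f i. f \<in> C 0 \<Longrightarrow> integrable M (f i)"
    and bdd: "\<And>f i. f \<in> C 0 \<Longrightarrow> (\<integral>x. norm (f i x) \<partial>M) \<le> B"
  shows "\<exists>F f. (\<forall>k. F k \<in> C k) \<and> (\<forall>i. f i \<in> borel_measurable M) \<and>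
           (\<forall>i. AE x in M. (\<lambda>k. F k i x) \<longlonglongrightarrow> f i x)"
proof -
  interpret finite_measure M by fact
  have C0: "f \<in> C n \<Longrightarrow> f \<in> C 0" for f n
    using lift_Suc_antimono_le[of C, OF dec, of 0 n] by blast
  have Cmono: "n \<le> n' \<Longrightarrow> C n' \<subseteq> C n" for n n'
    using lift_Suc_antimono_le[of C, OF dec] by blast
  define T where "T f i = (\<integral>x. japanese (f i x) \<partial>M)" for f :: "nat \<Rightarrow> 'a \<Rightarrow> complex" and i :: nat
  define D where "D = measure M (space M) + B"
  have T0: "0 \<le> T f i" for f i unfolding T_def by (simp add: less_imp_le[OF japanese_pos])
  have TD: "T f i \<le> D" if "f \<in> C 0" for f i
    using integrable_japanese(2)[OF fin int[OF that, of i]] bdd[OF that, of i] by (simp add: T_def D_def)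
  have sT: "summable (\<lambda>i. (1/2)^i * T f i)" if "f \<in> C 0" for f
  proof (rule summable_comparison_test)
    show "\<exists>N. \<forall>n\<ge>N. norm ((1/2)^n * T f n) \<le> (1/2)^n * D"
      using T0[of f] TD[OF that] by (intro exI[of _ 0]) (auto simp: abs_mult intro!: mult_left_mono)
    show "summable (\<lambda>i. (1/2)^i * D)" by (intro summable_mult2 summable_geometric) auto
  qed
  \<comment> \<open>One functional for all coordinates at once, so that a single sequence of
    near-minimisers converges in each of them.\<close>
  define J where "J f = (\<Sum>i. (1/2)^i * T f i)" for f
  have J0: "0 \<le> J f" if "f \<in> C 0" for f
    unfolding J_def by (rule suminf_nonneg[OF sT[OF that]]) (simp add: T0)
  have JD: "J f \<le> 2 * D" if "f \<in> C 0" for f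
  proof -
    have "J f \<le> (\<Sum>i. (1/2)^i * D)" unfolding J_def
      by (intro suminf_le sT that mult_left_mono TD summable_mult2 summable_geometric) auto
    also have "\<dots> = 2 * D" by (subst suminf_mult2[symmetric]) (auto simp: suminf_geometric)
    finally show ?thesis .
  qed
  define V where "V n = (INF f\<in>C n. J f)" for n
  have bb: "bdd_below (J ` C n)" for n by (rule bdd_belowI[of _ 0]) (auto intro: J0 C0)
  have Vle: "V n \<le> J f" if "f \<in> C n" for n f unfolding V_def by (rule cINF_lower[OF bb that])
  have Vinc: "incseq V" unfolding V_def
    by (intro incseq_SucI cINF_superset_mono) (use ne bb dec in auto)
  have Vup: "V n \<le> 2 * D" for n
  proof -
    obtain f where "f \<in> C n" using ne by blast
    then show ?thesis using Vle[of f n] JD[of f] C0 by (meson order_trans)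
  qed
  define L where "L = (SUP n. V n)"
  have Vlim: "V \<longlonglongrightarrow> L" unfolding L_def
    by (rule LIMSEQ_incseq_SUP[OF _ Vinc]) (use Vup in \<open>auto intro!: bdd_aboveI\<close>)
  have VL: "V n \<le> L" for n using Vinc Vlim by (simp add: incseq_le)
  \<comment> \<open>The rate 64 is spent later: a factor 2 for summability of the integrals leaves
    32, a factor 8 for the cube of the bound 2^k on the values leaves 4, and its square root makes
    the increments geometric.\<close>
  have "\<exists>f n. k \<le> n \<and> L - (1/64)^k \<le> V n \<and> f \<in> C n \<and> J f \<le> L + (1/64)^k" for k
  proof -
    have e: "(0::real) < (1/64)^k" by simp
    from order_tendstoD(1)[OF Vlim, of "L - (1/64)^k"] e
    obtain N where N: "\<And>n. n \<ge> N \<Longrightarrow> L - (1/64)^k < V n" by (auto simp: eventually_sequentially)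
    define n where "n = max N k"
    have "V n < L + (1/64)^k" using VL[of n] e by linarith
    then obtain f where "f \<in> C n" "J f < L + (1/64)^k"
      unfolding V_def using cINF_less_iff[OF ne bb] by blast
    then show ?thesis using N[of n] by (intro exI[of _ f] exI[of _ n]) (auto simp: n_def less_imp_le)
  qed
  then obtain F N where FN: "\<And>k. k \<le> N k" "\<And>k. L - (1/64)^k \<le> V (N k)" "\<And>k. F k \<in> C (N k)"
    "\<And>k. J (F k) \<le> L + (1/64)^k" by metis
  have FC: "F k \<in> C k" for k using FN(1,3)[of k] Cmono by blast
  have FC0: "F k \<in> C 0" for k using FC C0 by blast
  text \<open>\<open>N\<close> need not be monotone, so compare with the smaller of two consecutive indices.\<close>
  define mf where "mf k = (\<lambda>i x. (F k i x + F (Suc k) i x) / 2)" for k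
  define gap where "gap k i x = (japanese (F k i x) + japanese (F (Suc k) i x)) / 2 - japanese (mf k i x)" for k i x
  have mfC: "mf k \<in> C (min (N k) (N (Suc k)))" for k
    unfolding mf_def using FN(3)[of k] FN(3)[of "Suc k"] Cmono[OF min.cobounded1] Cmono[OF min.cobounded2]
    by (intro mid) blast+
  have mf0: "mf k \<in> C 0" for k using mfC C0 by blast
  have Jmf: "L - (1/64)^k \<le> J (mf k)" for k
  proof -
    have "(1/64::real)^(Suc k) \<le> (1/64)^k" by (rule power_decreasing) auto
    then have "L - (1/64)^k \<le> V (min (N k) (N (Suc k)))"
      using FN(2)[of k] FN(2)[of "Suc k"] unfolding min_def by (cases "N k \<le> N (Suc k)"; simp only: if_True if_False; linarith)
    then show ?thesis using Vle[OF mfC, of k] by linarith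
  qed
  have igap: "integrable M (gap k i)" for k i
    unfolding gap_def[abs_def] by (intro Bochner_Integration.integrable_diff integrable_divide Bochner_Integration.integrable_add
       integrable_japanese(1)[OF fin] int FC0 mf0)
  have gap0: "0 \<le> gap k i x" for k i x unfolding gap_def mf_def using japanese_convex by simp
  have gapT: "(\<integral>x. gap k i x \<partial>M) = (T (F k) i + T (F (Suc k)) i) / 2 - T (mf k) i" for k i
    unfolding gap_def T_def by (simp add: integrable_japanese(1)[OF fin] int FC0 mf0)
  have gapb: "(1/2)^i * (\<integral>x. gap k i x \<partial>M) \<le> 2 * (1/64)^k" for k i
  proof -
    have S: "summable (\<lambda>i. (1/2)^i * (\<integral>x. gap k i x \<partial>M))"
      and E: "(\<Sum>i. (1/2)^i * (\<integral>x. gap k i x \<partial>M)) = (J (F k) + J (F (Suc k))) / 2 - J (mf k)"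
    proof -
      have "(\<lambda>i. ((1/2)^i * T (F k) i + (1/2)^i * T (F (Suc k)) i) / 2 - (1/2)^i * T (mf k) i) sums
         ((J (F k) + J (F (Suc k))) / 2 - J (mf k))"
        unfolding J_def by (intro sums_diff sums_divide sums_add summable_sums sT FC0 mf0)
      then have "(\<lambda>i. (1/2)^i * (\<integral>x. gap k i x \<partial>M)) sums ((J (F k) + J (F (Suc k))) / 2 - J (mf k))"
        unfolding gapT by (simp add: algebra_simps add_divide_distrib)
      then show "summable (\<lambda>i. (1/2)^i * (\<integral>x. gap k i x \<partial>M))"
        "(\<Sum>i. (1/2)^i * (\<integral>x. gap k i x \<partial>M)) = (J (F k) + J (F (Suc k))) / 2 - J (mf k)"
        by (auto simp: sums_iff)
    qed
    have "(1/2)^i * (\<integral>x. gap k i x \<partial>M) = (\<Sum>i\<in>{i}. (1/2)^i * (\<integral>x. gap k i x \<partial>M))" by simp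
    also have "\<dots> \<le> (\<Sum>i. (1/2)^i * (\<integral>x. gap k i x \<partial>M))"
      by (rule sum_le_suminf[OF S]) (auto intro!: mult_nonneg_nonneg Bochner_Integration.integral_nonneg gap0)
    also have "\<dots> \<le> 2 * (1/64)^k"
    proof -
      have "J (F (Suc k)) \<le> L + (1/64)^k"
        using FN(4)[of "Suc k"] power_decreasing[of k "Suc k" "1/64::real"] by linarith
      then show ?thesis unfolding E using FN(4)[of k] Jmf[of k] by argo
    qed
    finally show ?thesis .
  qed
  have AEc: "AE x in M. convergent (\<lambda>k. F k i x)" for i
  proof -
    have 1: "AE x in M. summable (\<lambda>k. 32^k * gap k i x)"
    proof (rule AE_summable_of_integrals)
      show "summable (\<lambda>k. \<integral>x. 32^k * gap k i x \<partial>M)"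
      proof (rule summable_comparison_test)
        have "32^k * (\<integral>x. gap k i x \<partial>M) \<le> 2 * 2^i * (1/2)^k" for k
        proof -
          have "32^k * (\<integral>x. gap k i x \<partial>M) = 32^k * 2^i * ((1/2)^i * (\<integral>x. gap k i x \<partial>M))"
            by (simp add: power_one_over)
          also have "\<dots> \<le> 32^k * 2^i * (2 * (1/64)^k)" by (intro mult_left_mono gapb) auto
          also have "\<dots> = 2 * 2^i * ((32 * (1/64))^k)" unfolding power_mult_distrib by (simp only: ac_simps)
          finally show ?thesis by simp
        qed
        then show "\<exists>N. \<forall>k\<ge>N. norm (\<integral>x. 32^k * gap k i x \<partial>M) \<le> 2 * 2^i * (1/2)^k"
          by (intro exI[of _ 0]) (auto simp: abs_mult abs_of_nonneg Bochner_Integration.integral_nonneg gap0)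
        show "summable (\<lambda>k. 2 * 2^i * (1/2::real)^k)"
          by (intro summable_mult summable_geometric) auto
      qed
    qed (auto simp: igap gap0)
    have 2: "AE x in M. summable (\<lambda>k. (1/2)^k * japanese (F k i x))"
    proof (rule AE_summable_of_integrals)
      show "summable (\<lambda>k. \<integral>x. (1/2)^k * japanese (F k i x) \<partial>M)"
      proof (rule summable_comparison_test)
        show "summable (\<lambda>k. (1/2::real)^k * D)" by (intro summable_mult2 summable_geometric) auto
        show "\<exists>N. \<forall>k\<ge>N. norm (\<integral>x. (1/2)^k * japanese (F k i x) \<partial>M) \<le> (1/2)^k * D"
          using T0 TD[OF FC0] unfolding T_def
          by (intro exI[of _ 0]) (auto simp: abs_mult)
      qed
    qed (auto simp: integrable_japanese(1)[OF fin] int FC0 less_imp_le[OF japanese_pos])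
    show ?thesis using 1 2
    proof eventually_elim
      case (elim x)
      \<comment> \<open>The terms of a convergent series are bounded, so at almost every x the gap
        is O(32^-k) and \<open>japanese\<close> of the values is O(2^k). This yields convergence of
        the full sequence, without passing to a subsequence.\<close>
      have "Bseq (\<lambda>k. 32^k * gap k i x)" "Bseq (\<lambda>k. (1/2)^k * japanese (F k i x))"
        using elim by (auto intro!: convergent_imp_Bseq dest!: summable_LIMSEQ_zero simp: convergent_def)
      then obtain c1 c2 where c: "c1 > 0" "c2 > 0" "\<And>k. norm (32^k * gap k i x) \<le> c1"
        "\<And>k. norm ((1/2)^k * japanese (F k i x)) \<le> c2" unfolding Bseq_def by blast
      define c where "c = sqrt (8 * (2 * c2) ^ 3 * c1)"
      have j: "japanese (F k i x) \<le> 2^k * c2" for k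
        using c(4)[of k] less_imp_le[OF japanese_pos] by (simp add: abs_mult power_divide field_simps)
      have g: "gap k i x \<le> (1/32)^k * c1" for k
        using c(3)[of k] gap0[of k i x] by (simp add: abs_mult power_divide field_simps)
      have "norm (F (Suc k) i x - F k i x) \<le> c * (1/2)^k" for k
      proof -
        have "(norm (F (Suc k) i x - F k i x))\<^sup>2 \<le> 8 * (2^(Suc k) * c2)^3 * gap k i x"
          unfolding gap_def mf_def norm_minus_commute[of "F (Suc k) i x"]
          by (rule japanese_strictly_convex)
             (use j[of k] j[of "Suc k"] c in \<open>auto intro: order_trans\<close>)
        also have "\<dots> \<le> 8 * (2^(Suc k) * c2)^3 * ((1/32)^k * c1)"
          by (intro mult_left_mono g) (use c in auto)
        also have "\<dots> = (8 * (2 * c2) ^ 3 * c1) * ((2^k)^3 * (1/32)^k)"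
          by (simp add: power_mult_distrib)
        also have "(2^k)^3 * (1/32)^k = (((1/2::real))^k)\<^sup>2"
        proof -
          have "(2^k)^3 = ((2::real)^3)^k" "((1/2)^k)\<^sup>2 = ((1/2::real)^2)^k"
            by (simp_all only: power_mult[symmetric] mult.commute)
          moreover have "((2::real)^3)^k * (1/32)^k = (2^3 * (1/32))^k" by (simp only: power_mult_distrib)
          ultimately show ?thesis by (simp add: power2_eq_square)
        qed
        also have "(8 * (2 * c2) ^ 3 * c1) = c\<^sup>2" using c by (simp add: c_def)
        finally have "(norm (F (Suc k) i x - F k i x))\<^sup>2 \<le> (c * (1/2)^k)\<^sup>2"
          by (simp add: power_mult_distrib)
        then show ?thesis by (rule power2_le_imp_le) (use c in \<open>simp add: c_def\<close>)
      qed
      then have "summable (\<lambda>k. F (Suc k) i x - F k i x)"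
        by (intro summable_comparison_test[OF _ summable_mult[OF summable_geometric, of "1/2" c]])
           (auto intro!: exI[of _ 0])
      then show "convergent (\<lambda>k. F k i x)"
        using convergent_diff_const_right_iff[of "\<lambda>k. F k i x" "F 0 i x"]
        by (simp add: summable_iff_convergent sum_lessThan_telescope[of "\<lambda>k. F k i x"])
    qed
  qed
  have "(\<lambda>x. lim (\<lambda>k. F k i x)) \<in> borel_measurable M" for i
    by (rule borel_measurable_lim_metric) (use int[OF FC0] in auto)
  then show ?thesis
    using FC AEc by (intro exI[of _ F] exI[of _ "\<lambda>i x. lim (\<lambda>k. F k i x)"])
      (auto simp: convergent_LIMSEQ_iff)
qed

section \<open>Measures from contents\<close>

text \<open>The compact sets K - U and K - V are disjoint; removing disjoint open neighbourhoods of
  them from K leaves the two pieces.\<close>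

lemma compact_subset_Un_open_split:
  fixes K :: "'a::t2_space set"
  assumes "compact K" "K \<subseteq> U \<union> V" "open U" "open V"
  obtains K1 K2 where "compact K1" "compact K2" "K1 \<subseteq> U" "K2 \<subseteq> V" "K = K1 \<union> K2"
proof -
  have H: "Hausdorff_space (euclidean :: 'a topology)"
    unfolding Hausdorff_space_def disjnt_def using hausdorff by auto
  have c: "compact (K - U)" "compact (K - V)" using assms by (auto intro: compact_diff)
  moreover have "disjnt (K - U) (K - V)" using assms by (auto simp: disjnt_def)
  ultimately obtain A B where AB: "open A" "open B" "K - U \<subseteq> A" "K - V \<subseteq> B" "disjnt A B"
    using Hausdorff_space_compact_separation[OF H, of "K - U" "K - V"] by auto
  show thesis
  proof (rule that[of "K - A" "K - B"])
    show "compact (K - A)" "compact (K - B)" using AB assms by (auto intro: compact_diff)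
  qed (use AB in \<open>auto simp: disjnt_def\<close>)
qed

text \<open>\<open>p\<close> will be a limit, along a filter, of integrals over Borel sets, so it is
  only finitely additive and need not be regular. Its values on compact sets generate a regular
  measure that gives continuous functions the limits of their integrals; this takes the place of the
  Riesz representation theorem.\<close>

locale compact_content =
  fixes p :: "'a::t2_space set \<Rightarrow> real"
  assumes compact_space: "compact (UNIV :: 'a set)"
    and content_nonneg: "E \<in> sets borel \<Longrightarrow> 0 \<le> p E"
    and content_Un: "E \<in> sets borel \<Longrightarrow> F \<in> sets borel \<Longrightarrow> E \<inter> F = {} \<Longrightarrow> p (E \<union> F) = p E + p F"
begin

lemma content_mono: "E \<in> sets borel \<Longrightarrow> F \<in> sets borel \<Longrightarrow> E \<subseteq> F \<Longrightarrow> p E \<le> p F"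
  using content_Un[of E "F - E"] content_nonneg[of "F - E"] by (simp add: Un_absorb1)

lemma content_empty: "p {} = 0"
  using content_Un[of "{}" "{}"] by simp

lemma content_subadditive:
  assumes "E \<in> sets borel" "F \<in> sets borel" shows "p (E \<union> F) \<le> p E + p F"
  using content_Un[of E "F - E"] content_mono[of "F - E" F] assms by simp

lemma compact_borel:
  fixes K :: "'a set" shows "compact K \<Longrightarrow> K \<in> sets borel"
  by (intro borel_closed compact_imp_closed)

definition inner_content :: "'a set \<Rightarrow> ennreal" where
  "inner_content U = (SUP K\<in>{K. compact K \<and> K \<subseteq> U}. ennreal (p K))"

definition outer_content :: "'a set \<Rightarrow> ennreal" where
  "outer_content E = (INF U\<in>{U. open U \<and> E \<subseteq> U}. inner_content U)"

lemma inner_content_ge: "compact K \<Longrightarrow> K \<subseteq> U \<Longrightarrow> ennreal (p K) \<le> inner_content U"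
  unfolding inner_content_def by (rule SUP_upper) simp

lemma inner_content_mono: "U \<subseteq> V \<Longrightarrow> inner_content U \<le> inner_content V"
  unfolding inner_content_def by (rule SUP_subset_mono) auto

lemma inner_content_le: "open U \<Longrightarrow> inner_content U \<le> ennreal (p U)"
  unfolding inner_content_def by (rule SUP_least) (auto intro!: ennreal_leI content_mono intro: compact_borel)

lemma inner_content_empty: "inner_content {} = 0"
  using inner_content_le[of "{}"] by (simp add: content_empty)

lemma inner_content_Un:
  assumes "open U" "open V" shows "inner_content (U \<union> V) \<le> inner_content U + inner_content V"
  unfolding inner_content_def[of "U \<union> V"]
proof (rule SUP_least, clarify)
  fix K assume "compact K" "K \<subseteq> U \<union> V"
  then obtain K1 K2 where K: "compact K1" "compact K2" "K1 \<subseteq> U" "K2 \<subseteq> V" "K = K1 \<union> K2"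
    using compact_subset_Un_open_split assms by metis
  have "ennreal (p K) \<le> ennreal (p K1 + p K2)"
    using K by (auto intro!: ennreal_leI content_subadditive compact_borel)
  also have "\<dots> = ennreal (p K1) + ennreal (p K2)"
    using K by (intro ennreal_plus content_nonneg compact_borel)
  also have "\<dots> \<le> inner_content U + inner_content V"
    using K by (intro add_mono inner_content_ge)
  finally show "ennreal (p K) \<le> inner_content U + inner_content V" .
qed

lemma inner_content_finite_UN:
  assumes "\<And>i. open (U i)"
  shows "inner_content (\<Union>i<n. U i) \<le> (\<Sum>i<n::nat. inner_content (U i))"
proof (induction n)
  case (Suc n)
  have "inner_content (\<Union>i<Suc n. U i) \<le> inner_content (\<Union>i<n. U i) + inner_content (U n)"
    using inner_content_Un[of "\<Union>i<n. U i" "U n"] assms by (auto simp: lessThan_Suc Un_commute)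
  with Suc show ?case by (auto intro: order_trans add_right_mono)
qed (simp add: inner_content_empty)

lemma inner_content_UN:
  fixes U :: "nat \<Rightarrow> 'a set"
  assumes "\<And>i. open (U i)"
  shows "inner_content (\<Union>i. U i) \<le> (\<Sum>i. inner_content (U i))"
  unfolding inner_content_def[of "\<Union>i. U i"]
proof (rule SUP_least, clarify)
  fix K assume K: "compact K" "K \<subseteq> (\<Union>i. U i)"
  obtain I where I: "finite I" "K \<subseteq> (\<Union>i\<in>I. U i)"
    using compactE_image[OF K(1), of UNIV U] assms K(2) by metis
  obtain n where "I \<subseteq> {..<n}" using I(1) finite_nat_iff_bounded by blast
  then have "K \<subseteq> (\<Union>i<n. U i)" using I by blast
  then have "ennreal (p K) \<le> inner_content (\<Union>i<n. U i)" by (rule inner_content_ge[OF K(1)])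
  also have "\<dots> \<le> (\<Sum>i<n. inner_content (U i))" by (rule inner_content_finite_UN[OF assms])
  also have "\<dots> \<le> (\<Sum>i. inner_content (U i))" by (rule sum_le_suminf) auto
  finally show "ennreal (p K) \<le> (\<Sum>i. inner_content (U i))" .
qed

lemma outer_content_le: "open U \<Longrightarrow> E \<subseteq> U \<Longrightarrow> outer_content E \<le> inner_content U"
  unfolding outer_content_def by (rule INF_lower) simp

lemma outer_content_open: "open U \<Longrightarrow> outer_content U = inner_content U"
  by (rule antisym, rule outer_content_le)
     (auto simp: outer_content_def intro!: INF_greatest inner_content_mono)

lemma outer_content_mono: "E \<subseteq> F \<Longrightarrow> outer_content E \<le> outer_content F"
  unfolding outer_content_def by (rule INF_superset_mono) auto

lemma outer_content_compact: "compact K \<Longrightarrow> ennreal (p K) \<le> outer_content K"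
  unfolding outer_content_def by (auto intro!: INF_greatest inner_content_ge)

lemma outer_content_finite: "outer_content E \<le> ennreal (p UNIV)"
  using outer_content_mono[of E UNIV] outer_content_open[of UNIV] inner_content_le[of UNIV]
  by simp

lemma outer_content_approx:
  assumes "0 < e" obtains U where "open U" "E \<subseteq> U" "inner_content U \<le> outer_content E + ennreal e"
proof -
  have "outer_content E < outer_content E + ennreal e"
    using ennreal_add_left_cancel_less[of "outer_content E" 0 "ennreal e"] assms
      neq_top_trans[OF ennreal_neq_top outer_content_finite[of E]] by simp
  then show thesis using that unfolding outer_content_def[of E] INF_less_iff by (auto simp: less_imp_le)
qed

lemma outer_measure_space_outer_content: "outer_measure_space (Pow UNIV) outer_content"
  unfolding outer_measure_space_def
proof (intro conjI)
  show "positive (Pow UNIV) outer_content"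
    by (simp add: positive_def outer_content_open inner_content_empty)
  show "increasing (Pow UNIV) outer_content"
    by (simp add: increasing_def outer_content_mono)
  show "countably_subadditive (Pow UNIV) outer_content"
    unfolding countably_subadditive_def
  proof (intro allI impI)
    fix A :: "nat \<Rightarrow> 'a set"
    show "outer_content (\<Union>i. A i) \<le> (\<Sum>i. outer_content (A i))"
    proof (rule ennreal_le_epsilon)
      fix e :: real assume e: "0 < e"
      have "\<exists>U. open U \<and> A n \<subseteq> U \<and> inner_content U \<le> outer_content (A n) + ennreal (e * (1/2)^Suc n)" for n
        using outer_content_approx[of "e * (1/2)^Suc n" "A n"] e by (metis mult_pos_pos zero_less_power half_gt_zero_iff zero_less_one)
      then obtain U where U: "\<And>n. open (U n)" "\<And>n. A n \<subseteq> U n"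
        "\<And>n. inner_content (U n) \<le> outer_content (A n) + ennreal (e * (1/2)^Suc n)" by metis
      have "outer_content (\<Union>i. A i) \<le> inner_content (\<Union>i. U i)"
        using U by (intro outer_content_le) auto
      also have "\<dots> \<le> (\<Sum>i. inner_content (U i))" by (rule inner_content_UN[OF U(1)])
      also have "\<dots> \<le> (\<Sum>n. outer_content (A n) + ennreal (e * (1/2)^Suc n))"
        by (intro suminf_le U) auto
      also have "\<dots> = (\<Sum>n. outer_content (A n)) + (\<Sum>n. ennreal e * ennreal ((1/2) ^ Suc n))"
        using e by (subst suminf_add[symmetric])
                   (auto simp del: ennreal_suminf_cmult simp add: ennreal_mult[symmetric])
      also have "\<dots> = (\<Sum>n. outer_content (A n)) + e"
        unfolding ennreal_suminf_cmult
        by (subst suminf_ennreal_eq[OF zero_le_power power_half_series]) auto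
      finally show "outer_content (\<Union>i. A i) \<le> (\<Sum>n. outer_content (A n)) + ennreal e" .
    qed
  qed
qed

lemma outer_content_Un:
  assumes "E \<inter> F = {}"
  shows "outer_content (E \<union> F) \<le> outer_content E + outer_content F"
proof -
  have "outer_content (\<Union>i. binaryset E F i) \<le> (\<Sum>i. outer_content (binaryset E F i))"
    using outer_measure_space_outer_content assms
    unfolding outer_measure_space_def countably_subadditive_def
    by (elim conjE allE[of _ "binaryset E F"]) (auto simp: disjoint_family_on_def binaryset_def split: if_splits)
  also have "\<dots> = outer_content E + outer_content F"
    by (rule suminf_binaryset_eq) (simp add: outer_content_open inner_content_empty)
  finally show ?thesis by (simp add: UN_binaryset_eq)
qed

text \<open>Enlarge X to an open V and exhaust V \<inter> U by compact K; then exhaust the open set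
  V - K, which still contains X - U, by compact L. As K and L are disjoint subsets of V, finite
  additivity of \<open>p\<close> yields Caratheodory's inequality.\<close>

lemma open_lambda_system:
  assumes U: "open U" shows "U \<in> lambda_system UNIV (Pow UNIV) outer_content"
proof -
  have "outer_content (U \<inter> X) + outer_content ((UNIV - U) \<inter> X) \<le> inner_content V"
    if V: "open V" "X \<subseteq> V" for X V
  proof -
    have "outer_content (U \<inter> X) + outer_content ((UNIV - U) \<inter> X)
        \<le> inner_content (V \<inter> U) + outer_content ((UNIV - U) \<inter> X)"
      using U V by (intro add_right_mono outer_content_le) auto
    also have "\<dots> = (SUP K\<in>{K. compact K \<and> K \<subseteq> V \<inter> U}. ennreal (p K) + outer_content ((UNIV - U) \<inter> X))"
      unfolding inner_content_def by (rule ennreal_SUP_add_left[symmetric]) auto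
    also have "\<dots> \<le> inner_content V"
    proof (rule SUP_least, clarify)
      fix K assume K: "compact K" "K \<subseteq> V \<inter> U"
      have "ennreal (p K) + outer_content ((UNIV - U) \<inter> X) \<le> ennreal (p K) + inner_content (V - K)"
        using U V K by (intro add_left_mono outer_content_le open_Diff compact_imp_closed) auto
      also have "\<dots> = (SUP L\<in>{L. compact L \<and> L \<subseteq> V - K}. ennreal (p K) + ennreal (p L))"
        unfolding inner_content_def by (rule ennreal_SUP_add_right) auto
      also have "\<dots> \<le> inner_content V"
      proof (rule SUP_least, clarify)
        fix L assume L: "compact L" "L \<subseteq> V - K"
        have "ennreal (p K) + ennreal (p L) = ennreal (p K + p L)"
          using K L by (intro ennreal_plus[symmetric] content_nonneg compact_borel)
        also have "p K + p L = p (K \<union> L)"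
          using K L by (intro content_Un[symmetric] compact_borel) auto
        also have "ennreal \<dots> \<le> inner_content V" using K L by (intro inner_content_ge) auto
        finally show "ennreal (p K) + ennreal (p L) \<le> inner_content V" .
      qed
      finally show "ennreal (p K) + outer_content ((UNIV - U) \<inter> X) \<le> inner_content V" .
    qed
    finally show ?thesis .
  qed
  then have "outer_content (U \<inter> X) + outer_content ((UNIV - U) \<inter> X) \<le> outer_content X" for X
    unfolding outer_content_def[of X] by (intro INF_greatest) auto
  moreover have "outer_content X \<le> outer_content (U \<inter> X) + outer_content ((UNIV - U) \<inter> X)" for X
  proof -
    have "X = (U \<inter> X) \<union> ((UNIV - U) \<inter> X)" by auto
    then show ?thesis using outer_content_Un[of "U \<inter> X" "(UNIV - U) \<inter> X"] by auto
  qed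
  ultimately show ?thesis by (simp add: lambda_system_def antisym)
qed

definition content_measure :: "'a measure" where
  "content_measure = measure_of UNIV (sets borel) outer_content"

lemma sets_content_measure [simp, measurable_cong]: "sets content_measure = sets borel"
  unfolding content_measure_def
  by (rule sets.sets_measure_of_eq[where M="borel :: 'a measure", unfolded space_borel])

lemma space_content_measure [simp]: "space content_measure = UNIV"
  unfolding content_measure_def by (simp add: space_measure_of_conv)

lemma emeasure_content_measure:
  assumes "E \<in> sets borel" shows "emeasure content_measure E = outer_content E"
proof -
  interpret P: sigma_algebra UNIV "Pow UNIV :: 'a set set" by (rule sigma_algebra_Pow)
  have ms: "measure_space UNIV (lambda_system UNIV (Pow UNIV) outer_content) outer_content"
    by (rule P.caratheodory_lemma[OF outer_measure_space_outer_content])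
  then interpret L: sigma_algebra UNIV "lambda_system UNIV (Pow UNIV) outer_content"
    by (simp add: measure_space_def)
  have sub: "sets (borel :: 'a measure) \<subseteq> lambda_system UNIV (Pow UNIV) outer_content"
    unfolding borel_def by (simp only: sets_measure_of subset_UNIV Pow_UNIV)
      (rule L.sigma_sets_subset[unfolded Pow_UNIV], auto intro: open_lambda_system[unfolded Pow_UNIV])
  have "sigma_algebra UNIV (sets (borel :: 'a measure))"
    by (metis sets.sigma_algebra_axioms space_borel)
  then have "measure_space UNIV (sets (borel :: 'a measure)) outer_content"
    by (rule measure_down[OF ms _ sub])
  then show ?thesis using assms unfolding content_measure_def
    by (intro emeasure_measure_of_sigma) (auto simp: measure_space_def)
qed

lemma finite_measure_content_measure: "finite_measure content_measure"
  using outer_content_finite[of UNIV]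
  by (intro finite_measureI) (auto simp: emeasure_content_measure top_unique)

text \<open>On compact and on open sets the measure is compared with \<open>p\<close> from opposite
  sides. In general there is no equality, but the whole space is both compact and open, so the total
  masses agree.\<close>

lemma measure_content_measure_compact: "compact K \<Longrightarrow> p K \<le> measure content_measure K"
  using outer_content_compact[of K] outer_content_finite[of K] content_nonneg[OF compact_borel]
  by (simp add: measure_def emeasure_content_measure compact_borel)
     (metis enn2real_ennreal enn2real_mono ennreal_less_top order_le_less_trans)

lemma measure_content_measure_open: "open U \<Longrightarrow> measure content_measure U \<le> p U"
  using inner_content_le[of U] content_nonneg[of U]
  by (simp add: measure_def emeasure_content_measure outer_content_open enn2real_leI)

lemma measure_content_measure_UNIV: "measure content_measure UNIV = p UNIV"
  using measure_content_measure_compact[OF compact_space] measure_content_measure_open[of UNIV] by simp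

lemma content_measure_outer_regular:
  assumes "E \<in> sets borel" "0 < e"
  obtains U where "open U" "E \<subseteq> U" "measure content_measure (U - E) \<le> e"
proof -
  interpret finite_measure content_measure by (rule finite_measure_content_measure)
  obtain U where U: "open U" "E \<subseteq> U" "inner_content U \<le> outer_content E + ennreal e"
    using outer_content_approx[OF assms(2)] by blast
  then have "ennreal (measure content_measure U) \<le> ennreal (measure content_measure E) + ennreal e"
    using assms by (simp flip: emeasure_eq_measure add: emeasure_content_measure outer_content_open)
  then have "measure content_measure U \<le> measure content_measure E + e"
    using assms by (simp flip: ennreal_plus)
  then show thesis using that[OF U(1,2)] assms U by (simp add: finite_measure_Diff)
qed

end

section \<open>Cluster points of bounded sequences and their integrals of continuous
  functions\<close>

lemma bounded_family_converges_along_filter: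
  fixes x :: "nat \<Rightarrow> 'i \<Rightarrow> real"
  assumes "\<And>i. \<exists>B. \<forall>n. \<bar>x n i\<bar> \<le> B"
  shows "\<exists>G. G \<noteq> bot \<and> G \<le> sequentially \<and> (\<forall>i. \<exists>l. ((\<lambda>n. x n i) \<longlongrightarrow> l) G)"
proof -
  obtain B where B: "\<And>i n. \<bar>x n i\<bar> \<le> B i" using assms by metis
  \<comment> \<open>The indices will be all Borel sets, uncountably many, so a subsequence
    converging at every index need not exist; Tychonoff's theorem still gives a cluster
    point.\<close>
  define K where "K = PiE UNIV (\<lambda>i. {- B i..B i})"
  have "compactin (product_topology (\<lambda>i. euclidean) UNIV) K"
    unfolding K_def compactin_PiE by simp
  then have "compact K" by (simp add: euclidean_product_topology)
  moreover have xK: "x n \<in> K" for n using B by (auto simp: K_def PiE_def abs_le_iff minus_le_iff)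
  ultimately obtain q where q: "inf (nhds q) (filtermap x sequentially) \<noteq> bot"
    unfolding compact_filter by (metis (mono_tags, lifting) eventually_filtermap always_eventually
        filtermap_bot_iff sequentially_bot)
  \<comment> \<open>\<open>G\<close> refines \<open>sequentially\<close>, so what holds for all
    large n survives along it, and \<open>x\<close> converges to \<open>q\<close>.\<close>
  define G where "G = inf (filtercomap x (nhds q)) sequentially"
  have "G \<noteq> bot"
  proof
    assume "G = bot"
    then have "eventually (\<lambda>_. False) G" by simp
    then obtain Q R where QR: "eventually Q (filtercomap x (nhds q))" "eventually R sequentially"
      "\<And>n. Q n \<and> R n \<Longrightarrow> False" unfolding G_def eventually_inf by blast
    then obtain Q' where Q': "eventually Q' (nhds q)" "\<And>n. Q' (x n) \<Longrightarrow> Q n"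
      unfolding eventually_filtercomap by blast
    have "eventually (\<lambda>y. \<not> Q' y) (filtermap x sequentially)"
      unfolding eventually_filtermap using QR(2) by eventually_elim (use QR(3) Q'(2) in blast)
    with Q'(1) have "eventually (\<lambda>_. False) (inf (nhds q) (filtermap x sequentially))"
      unfolding eventually_inf by blast
    with q show False by (simp add: trivial_limit_def)
  qed
  moreover have "G \<le> sequentially" by (simp add: G_def)
  moreover have "\<exists>l. ((\<lambda>n. x n i) \<longlongrightarrow> l) G" for i
  proof -
    have "(x \<longlongrightarrow> q) G"
      unfolding G_def by (rule filterlim_mono[OF filterlim_filtercomap]) auto
    then show ?thesis
      using continuous_on_tendsto_compose[OF continuous_on_product_coordinates[of i], of x q G] by auto
  qed
  ultimately show ?thesis by blast
qed

text \<open>Finite additivity passes to a limit along \<open>G\<close>. Countable additivity need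
  not, which is why the limit is handed over as a content.\<close>

lemma limit_is_content:
  fixes d :: "nat \<Rightarrow> 'a::t2_space \<Rightarrow> real"
  assumes K: "compact (UNIV :: 'a set)" and m: "sets m = sets borel"
    and d: "\<And>n. integrable m (d n)" "\<And>n x. 0 \<le> d n x" and G: "G \<noteq> bot"
    and lim: "\<forall>E\<in>sets borel. ((\<lambda>n. \<integral>x. indicator E x * d n x \<partial>m) \<longlongrightarrow> p E) G"
  shows "compact_content p"
proof
  note p = bspec[OF lim]
  show "0 \<le> p E" if "E \<in> sets borel" for E
    by (rule tendsto_lowerbound[OF p[OF that] _ G]) (auto intro!: always_eventually Bochner_Integration.integral_nonneg mult_nonneg_nonneg d)
  show "p (E \<union> F) = p E + p F" if "E \<in> sets borel" "F \<in> sets borel" "E \<inter> F = {}" for E F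
  proof -
    have "(\<integral>x. indicator (E \<union> F) x * d n x \<partial>m) = (\<integral>x. indicator E x * d n x \<partial>m) + (\<integral>x. indicator F x * d n x \<partial>m)" for n
      using that d m integrable_mult_indicator[OF _ d(1)]
      by (subst Bochner_Integration.integral_add[symmetric]) (auto simp: indicator_add[symmetric] distrib_right)
    then have "((\<lambda>n. \<integral>x. indicator (E \<union> F) x * d n x \<partial>m) \<longlongrightarrow> p E + p F) G"
      using tendsto_add[OF p[OF that(1)] p[OF that(2)]] by simp
    then show ?thesis using tendsto_unique[OF G p[of "E \<union> F"]] that by auto
  qed
qed (fact K)

text \<open>The count is the floor of k t. Thus a function with values in [0, 1] is, up to 1/k, an
  average of indicators of its superlevel sets.\<close>

lemma staircase_bounds:
  fixes t :: real and k :: nat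
  assumes "0 \<le> t" "t \<le> 1" "0 < k"
  shows "(\<Sum>j=1..k. if real j / real k \<le> t then 1 else 0) / real k \<le> t"
    and "t \<le> (\<Sum>j=1..k. if real j / real k \<le> t then 1 else 0) / real k + 1 / real k"
proof -
  have "{j\<in>{1..k}. real j / real k \<le> t} = {1..nat \<lfloor>real k * t\<rfloor>}"
  proof (rule set_eqI)
    fix j
    have "j \<le> k" if "real j \<le> real k * t"
      using order_trans[OF that, of "real k"] assms by (simp add: mult_left_le)
    then show "j \<in> {j\<in>{1..k}. real j / real k \<le> t} \<longleftrightarrow> j \<in> {1..nat \<lfloor>real k * t\<rfloor>}"
      using assms by (auto simp: le_nat_iff le_floor_iff field_simps)
  qed
  then have e: "(\<Sum>j=1..k. if real j / real k \<le> t then 1 else (0::real)) = real (nat \<lfloor>real k * t\<rfloor>)"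
    by (subst sum.inter_filter[symmetric]) auto
  have "real (nat \<lfloor>real k * t\<rfloor>) \<le> real k * t" "real k * t \<le> real (nat \<lfloor>real k * t\<rfloor>) + 1"
    using assms by (auto simp: of_nat_nat)
  then show "(\<Sum>j=1..k. if real j / real k \<le> t then 1 else 0) / real k \<le> t"
    "t \<le> (\<Sum>j=1..k. if real j / real k \<le> t then 1 else 0) / real k + 1 / real k"
    unfolding e using assms by (auto simp: field_simps)
qed

context compact_content
begin

context
  fixes d :: "nat \<Rightarrow> 'a \<Rightarrow> real" and m :: "'a measure" and G
  assumes m: "sets m = sets borel" and d: "\<And>n. integrable m (d n)" "\<And>n x. 0 \<le> d n x"
    and lim: "\<forall>E\<in>sets borel. ((\<lambda>n. \<integral>x. indicator E x * d n x \<partial>m) \<longlongrightarrow> p E) G"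
begin

text \<open>The superlevel sets of \<phi> are compact, and there \<open>p\<close> is at most the
  measure, so only an upper bound comes out. The lower bound follows by applying this to 1 - \<phi>,
  as the total masses agree.\<close>

lemma integral_limit_upper:
  assumes c: "continuous_on UNIV \<phi>" and b: "\<And>x. 0 \<le> \<phi> x" "\<And>x. \<phi> x \<le> 1" and e: "0 < e"
  shows "\<forall>\<^sub>F n in G. (\<integral>x. \<phi> x * d n x \<partial>m) \<le> (\<integral>x. \<phi> x \<partial>content_measure) + e"
proof -
  interpret R: finite_measure content_measure by (rule finite_measure_content_measure)
  obtain k :: nat where k: "(p UNIV + 1) / e < real k" using reals_Archimedean2 by blast
  have p0: "0 \<le> p UNIV" by (simp add: content_nonneg)
  have k0: "0 < k" using k e p0 by (cases k) (auto simp: divide_simps split: if_splits)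
  have ke: "p UNIV / real k < e" using k e k0 by (simp add: divide_simps mult.commute)
  define F where "F j = {x. real j / real k \<le> \<phi> x}" for j
  have F: "closed (F j)" for j unfolding F_def
    using closed_Collect_le[of "\<lambda>_. real j / real k" \<phi>] c by simp
  have [measurable]: "F j \<in> sets borel" for j using F by simp
  have FK: "compact (F j)" for j using compact_Int_closed[OF compact_space F] by simp
  have c': "\<phi> \<in> borel_measurable borel" by (rule borel_measurable_continuous_onI[OF c])
  note [measurable] = c' m
  have ind: "(if real j / real k \<le> \<phi> x then 1 else 0) = indicator (F j) x" for j x
    by (simp add: F_def indicator_def)
  define \<sigma> where "\<sigma> x = (\<Sum>j=1..k. indicator (F j) x) / real k" for x :: 'a
  have \<sigma>: "\<sigma> x \<le> \<phi> x" "\<phi> x \<le> \<sigma> x + 1 / real k" for x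
    using staircase_bounds[OF b k0, of x] by (auto simp: \<sigma>_def ind)
  have id: "integrable m (\<lambda>x. indicator E x * d n x)" if "E \<in> sets borel" for E n
    using integrable_mult_indicator[OF _ d(1), of E n] that m by simp
  define S where "S n = (\<Sum>j=1..k. (\<integral>x. indicator (F j) x * d n x \<partial>m)) / real k + (\<integral>x. indicator UNIV x * d n x \<partial>m) / real k" for n
  have upper: "(\<integral>x. \<phi> x * d n x \<partial>m) \<le> S n" for n
  proof -
    have *: "(\<sigma> x + 1 / real k) * d n x = (\<Sum>j=1..k. indicator (F j) x * d n x) / real k + indicator UNIV x * d n x / real k" for x
      by (simp add: \<sigma>_def sum_distrib_right add_divide_distrib distrib_right)
    have i: "integrable m (\<lambda>x. (\<sigma> x + 1 / real k) * d n x)" unfolding *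
      by (intro Bochner_Integration.integrable_add integrable_divide Bochner_Integration.integrable_sum id) auto
    have "integrable m (\<lambda>x. \<phi> x * d n x)"
      by (rule Bochner_Integration.integrable_bound[OF d(1)[of n]])
         (use b d m in \<open>auto simp: abs_mult mult_left_le_one_le intro!: AE_I2 borel_measurable_times c'[folded measurable_cong_sets[OF m refl]]\<close>)
    then have "(\<integral>x. \<phi> x * d n x \<partial>m) \<le> (\<integral>x. (\<sigma> x + 1 / real k) * d n x \<partial>m)"
      using i by (rule integral_mono) (use \<sigma> d in \<open>auto intro: mult_right_mono\<close>)
    also have "\<dots> = S n"
    proof -
      define g where "g E x = indicator E x * d n x" for E x
      have ig: "integrable m (g E)" if "E \<in> sets borel" for E
        using id[OF that] by (simp add: g_def[abs_def])
      have "(\<integral>x. (\<Sum>j=1..k. g (F j) x) / real k + g UNIV x / real k \<partial>m) =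
          (\<Sum>j=1..k. \<integral>x. g (F j) x \<partial>m) / real k + (\<integral>x. g UNIV x \<partial>m) / real k"
        by (simp add: ig Bochner_Integration.integral_sum)
      then show ?thesis unfolding * S_def g_def .
    qed
    finally show ?thesis .
  qed
  have "(S \<longlongrightarrow> (\<Sum>j=1..k. p (F j)) / real k + p UNIV / real k) G"
    unfolding S_def by (intro tendsto_intros bspec[OF lim]) (use k0 in auto)
  moreover have "(\<Sum>j=1..k. p (F j)) / real k + p UNIV / real k < (\<integral>x. \<phi> x \<partial>content_measure) + e"
  proof -
    have "(\<Sum>j=1..k. p (F j)) / real k \<le> (\<Sum>j=1..k. measure content_measure (F j)) / real k"
      by (intro divide_right_mono sum_mono measure_content_measure_compact FK) auto
    also have "\<dots> = (\<integral>x. \<sigma> x \<partial>content_measure)"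
      unfolding \<sigma>_def by (simp add: R.emeasure_eq_measure)
    also have "\<dots> \<le> (\<integral>x. \<phi> x \<partial>content_measure)"
    proof (rule integral_mono)
      show "integrable content_measure \<sigma>" unfolding \<sigma>_def
        by (intro integrable_divide Bochner_Integration.integrable_sum integrable_real_indicator) (auto simp: R.emeasure_eq_measure)
      show "integrable content_measure \<phi>"
        by (rule R.integrable_const_bound[of _ 1]) (use b c' in auto)
    qed (rule \<sigma>)
    finally show ?thesis using ke by linarith
  qed
  ultimately have "\<forall>\<^sub>F n in G. S n < (\<integral>x. \<phi> x \<partial>content_measure) + e"
    by (rule order_tendstoD(2))
  then show ?thesis by eventually_elim (use upper in \<open>auto intro: order_trans less_imp_le\<close>)
qed

lemma integral_limit:
  assumes c: "continuous_on UNIV \<phi>" and b: "\<And>x. 0 \<le> \<phi> x" "\<And>x. \<phi> x \<le> 1"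
  shows "((\<lambda>n. \<integral>x. \<phi> x * d n x \<partial>m) \<longlongrightarrow> (\<integral>x. \<phi> x \<partial>content_measure)) G"
proof (rule tendstoI)
  fix e :: real assume e: "0 < e"
  interpret R: finite_measure content_measure by (rule finite_measure_content_measure)
  have c': "\<phi> \<in> borel_measurable borel" by (rule borel_measurable_continuous_onI[OF c])
  have i: "integrable content_measure \<phi>"
    by (rule R.integrable_const_bound[of _ 1]) (use b c' in auto)
  have im: "integrable m (\<lambda>x. \<phi> x * d n x)" for n
      by (rule Bochner_Integration.integrable_bound[OF d(1)[of n]])
         (use b d m in \<open>auto simp: abs_mult mult_left_le_one_le intro!: AE_I2 borel_measurable_times c'[folded measurable_cong_sets[OF m refl]]\<close>)
  have 1: "\<forall>\<^sub>F n in G. (\<integral>x. \<phi> x * d n x \<partial>m) \<le> (\<integral>x. \<phi> x \<partial>content_measure) + e/2"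
    using assms e by (intro integral_limit_upper) auto
  have 2: "\<forall>\<^sub>F n in G. (\<integral>x. (1 - \<phi> x) * d n x \<partial>m) \<le> (\<integral>x. 1 - \<phi> x \<partial>content_measure) + e/4"
    using assms e by (intro integral_limit_upper continuous_intros) auto
  have 3: "\<forall>\<^sub>F n in G. p UNIV - e/4 < (\<integral>x. indicator UNIV x * d n x \<partial>m)"
    using bspec[OF lim, of UNIV] e by (intro order_tendstoD(1)) auto
  have r: "(\<integral>x. 1 - \<phi> x \<partial>content_measure) = p UNIV - (\<integral>x. \<phi> x \<partial>content_measure)"
    using i measure_content_measure_UNIV by simp
  show "\<forall>\<^sub>F n in G. dist (\<integral>x. \<phi> x * d n x \<partial>m) (\<integral>x. \<phi> x \<partial>content_measure) < e"
    using 1 2 3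
  proof eventually_elim
    case (elim n)
    have "(\<integral>x. (1 - \<phi> x) * d n x \<partial>m) = (\<integral>x. indicator UNIV x * d n x \<partial>m) - (\<integral>x. \<phi> x * d n x \<partial>m)"
      using d(1) im by (simp add: left_diff_distrib)
    then show ?case using elim e r by (simp add: dist_real_def abs_less_iff)
  qed
qed

lemma integral_limit':
  assumes c: "continuous_on UNIV \<phi>" and b: "\<And>x. \<bar>\<phi> x\<bar> \<le> 1"
  shows "((\<lambda>n. \<integral>x. \<phi> x * d n x \<partial>m) \<longlongrightarrow> (\<integral>x. \<phi> x \<partial>content_measure)) G"
proof -
  interpret R: finite_measure content_measure by (rule finite_measure_content_measure)
  have c': "\<phi> \<in> borel_measurable borel" by (rule borel_measurable_continuous_onI[OF c])
  have i: "integrable content_measure \<phi>"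
    by (rule R.integrable_const_bound[of _ 1]) (use b c' in auto)
  have im: "integrable m (\<lambda>x. \<phi> x * d n x)" for n
      by (rule Bochner_Integration.integrable_bound[OF d(1)[of n]])
         (use b d m in \<open>auto simp: abs_mult mult_left_le_one_le intro!: AE_I2 borel_measurable_times c'[folded measurable_cong_sets[OF m refl]]\<close>)
  have b': "0 \<le> (1 + \<phi> x) / 2" "(1 + \<phi> x) / 2 \<le> 1" for x using b[of x] by auto
  have "((\<lambda>n. 2 * (\<integral>x. (1 + \<phi> x) / 2 * d n x \<partial>m) - (\<integral>x. indicator UNIV x * d n x \<partial>m)) \<longlongrightarrow>
      2 * (\<integral>x. (1 + \<phi> x) / 2 \<partial>content_measure) - p UNIV) G"
    using c b' by (intro tendsto_intros integral_limit bspec[OF lim] continuous_intros) auto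
  moreover have "2 * (\<integral>x. (1 + \<phi> x) / 2 \<partial>content_measure) - p UNIV = (\<integral>x. \<phi> x \<partial>content_measure)"
    using i measure_content_measure_UNIV by (simp add: field_simps)
  moreover have "2 * (\<integral>x. (1 + \<phi> x) / 2 * d n x \<partial>m) - (\<integral>x. indicator UNIV x * d n x \<partial>m) = (\<integral>x. \<phi> x * d n x \<partial>m)" for n
    using d(1) im by (simp add: distrib_right add_divide_distrib)
  ultimately show ?thesis by simp
qed

end

end

section \<open>Complex measures\<close>

text \<open>Two differences of measures are compared by cross-addition, which avoids subtracting
  infinite values.\<close>

lemma nn_integral_measure_sum_eq:
  assumes s: "sets M1 = sets M" "sets M2 = sets M" "sets M3 = sets M"
    and eq: "\<And>A. A \<in> sets M \<Longrightarrow> emeasure M A + emeasure M1 A = emeasure M2 A + emeasure M3 A"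
    and f: "f \<in> borel_measurable M"
  shows "(\<integral>\<^sup>+x. f x \<partial>M) + (\<integral>\<^sup>+x. f x \<partial>M1) = (\<integral>\<^sup>+x. f x \<partial>M2) + (\<integral>\<^sup>+x. f x \<partial>M3)"
proof -
  have meas: "g \<in> borel_measurable M1" "g \<in> borel_measurable M2" "g \<in> borel_measurable M3"
    if "g \<in> borel_measurable M" for g :: "'a \<Rightarrow> ennreal"
    unfolding measurable_cong_sets[OF s(1) refl] measurable_cong_sets[OF s(2) refl]
      measurable_cong_sets[OF s(3) refl] using that by assumption+
  show ?thesis using f
  proof (induction rule: borel_measurable_induct)
    case (cong f g)
    have "(\<integral>\<^sup>+x. f x \<partial>N) = (\<integral>\<^sup>+x. g x \<partial>N)" if "sets N = sets M" for N
      using sets_eq_imp_space_eq[OF that] cong(3) by (intro nn_integral_cong) auto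
    then show ?case using cong(4) s by simp
  next
    case (set A)
    then show ?case using eq[OF set] s by simp
  next
    case (mult u c)
    note u = mult(2) meas[OF mult(2)]
    have "c * ((\<integral>\<^sup>+x. u x \<partial>M) + (\<integral>\<^sup>+x. u x \<partial>M1)) = c * ((\<integral>\<^sup>+x. u x \<partial>M2) + (\<integral>\<^sup>+x. u x \<partial>M3))"
      using mult by simp
    then show ?case by (simp add: u nn_integral_cmult distrib_left)
  next
    case (add u v)
    note uv = \<open>u \<in> borel_measurable M\<close> meas[OF \<open>u \<in> borel_measurable M\<close>]
      \<open>v \<in> borel_measurable M\<close> meas[OF \<open>v \<in> borel_measurable M\<close>]
    have "((\<integral>\<^sup>+x. u x \<partial>M) + (\<integral>\<^sup>+x. u x \<partial>M1)) + ((\<integral>\<^sup>+x. v x \<partial>M) + (\<integral>\<^sup>+x. v x \<partial>M1)) =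
      ((\<integral>\<^sup>+x. u x \<partial>M2) + (\<integral>\<^sup>+x. u x \<partial>M3)) + ((\<integral>\<^sup>+x. v x \<partial>M2) + (\<integral>\<^sup>+x. v x \<partial>M3))"
      using add by simp
    then show ?case by (simp add: uv nn_integral_add ac_simps)
  next
    case (seq U)
    have i: "incseq (\<lambda>i. \<integral>\<^sup>+x. U i x \<partial>N)" for N
      using \<open>incseq U\<close> by (auto simp: incseq_def le_fun_def intro!: nn_integral_mono)
    have e: "(\<integral>\<^sup>+x. (SUP i. U i) x \<partial>N) = (SUP i. \<integral>\<^sup>+x. U i x \<partial>N)" if "\<And>i. U i \<in> borel_measurable N" for N
      using nn_integral_monotone_convergence_SUP[OF \<open>incseq U\<close> that] by (simp only: SUP_apply)
    show ?case
      unfolding e[OF seq(1)] e[OF meas(1)[OF seq(1)]] e[OF meas(2)[OF seq(1)]] e[OF meas(3)[OF seq(1)]]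
        ennreal_SUP_add[OF i i, symmetric] seq.IH ..
  qed
qed

lemma integral_measure_sum_eq:
  fixes f :: "'a \<Rightarrow> complex"
  assumes fin: "finite_measure M" "finite_measure M1" "finite_measure M2" "finite_measure M3"
    and s: "sets M1 = sets M" "sets M2 = sets M" "sets M3 = sets M"
    and eq: "\<And>A. A \<in> sets M \<Longrightarrow> measure M A + measure M1 A = measure M2 A + measure M3 A"
    and f: "f \<in> borel_measurable M" and b: "\<And>x. norm (f x) \<le> B"
  shows "integral\<^sup>L M f + integral\<^sup>L M1 f = integral\<^sup>L M2 f + integral\<^sup>L M3 f"
proof -
  interpret finite_measure M by fact
  interpret M1: finite_measure M1 by fact
  interpret M2: finite_measure M2 by fact
  interpret M3: finite_measure M3 by fact
  have eq': "emeasure M A + emeasure M1 A = emeasure M2 A + emeasure M3 A" if "A \<in> sets M" for A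
    using eq[OF that] by (simp add: emeasure_eq_measure M1.emeasure_eq_measure M2.emeasure_eq_measure
         M3.emeasure_eq_measure flip: ennreal_plus)
  have meas: "g \<in> borel_measurable M \<Longrightarrow> g \<in> borel_measurable N" if "sets N = sets M" for N g
    unfolding measurable_cong_sets[OF that refl] .
  have nonneg: "integral\<^sup>L M g + integral\<^sup>L M1 g = integral\<^sup>L M2 g + integral\<^sup>L M3 g"
    if g: "g \<in> borel_measurable M" "\<And>x. 0 \<le> g x" "\<And>x. g x \<le> C" for g :: "'a \<Rightarrow> real" and C
  proof -
    have i: "integrable N g" if "finite_measure N" "sets N = sets M" for N
      by (rule finite_measure.integrable_const_bound[OF that(1), of _ C]) (use g meas[OF that(2)] in auto)
    have e: "ennreal (integral\<^sup>L N g) = (\<integral>\<^sup>+x. g x \<partial>N)" if "finite_measure N" "sets N = sets M" for N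
      using g by (intro nn_integral_eq_integral[symmetric] i that) auto
    have "ennreal (integral\<^sup>L M g) + ennreal (integral\<^sup>L M1 g) = ennreal (integral\<^sup>L M2 g) + ennreal (integral\<^sup>L M3 g)"
      using nn_integral_measure_sum_eq[OF s eq', of g] g fin s by (simp add: e)
    then show ?thesis using g(2) by (simp flip: ennreal_plus)
  qed
  have bounded: "integral\<^sup>L M g + integral\<^sup>L M1 g = integral\<^sup>L M2 g + integral\<^sup>L M3 g"
    if g: "g \<in> borel_measurable M" "\<And>x. \<bar>g x\<bar> \<le> C" for g :: "'a \<Rightarrow> real" and C
  proof -
    have i: "integrable N g" if "finite_measure N" "sets N = sets M" for N
      by (rule finite_measure.integrable_const_bound[OF that(1), of _ C]) (use g meas[OF that(2)] in auto)
    have e: "(\<integral>x. g x + C \<partial>N) = integral\<^sup>L N g + C * measure N (space M)"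
      if "finite_measure N" "sets N = sets M" for N
      using i[OF that] that sets_eq_imp_space_eq[OF that(2)] finite_measure.emeasure_finite[OF that(1)]
      by (subst Bochner_Integration.integral_add) (auto intro!: finite_measure.integrable_const)
    \<comment> \<open>Adding C makes the function nonnegative; the extra terms cancel because the
      total masses satisfy the same identity.\<close>
    have "(\<integral>x. g x + C \<partial>M) + (\<integral>x. g x + C \<partial>M1) = (\<integral>x. g x + C \<partial>M2) + (\<integral>x. g x + C \<partial>M3)"
    proof (rule nonneg)
      show "0 \<le> g x + C" "g x + C \<le> 2 * C" for x using g(2)[of x] by auto
    qed (use g in auto)
    moreover have "C * measure M (space M) + C * measure M1 (space M) = C * measure M2 (space M) + C * measure M3 (space M)"
      using eq[of "space M"] by (simp flip: distrib_left)
    ultimately show ?thesis using fin s by (simp add: e)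
  qed
  have i: "integrable N f" if "finite_measure N" "sets N = sets M" for N
    by (rule finite_measure.integrable_const_bound[OF that(1), of _ B]) (use f b meas[OF that(2)] in auto)
  have R: "integral\<^sup>L M (\<lambda>x. Re (f x)) + integral\<^sup>L M1 (\<lambda>x. Re (f x)) = integral\<^sup>L M2 (\<lambda>x. Re (f x)) + integral\<^sup>L M3 (\<lambda>x. Re (f x))"
  proof (rule bounded)
    show "\<bar>Re (f x)\<bar> \<le> B" for x using b[of x] abs_Re_le_cmod[of "f x"] by linarith
  qed (use f in simp)
  have I: "integral\<^sup>L M (\<lambda>x. Im (f x)) + integral\<^sup>L M1 (\<lambda>x. Im (f x)) = integral\<^sup>L M2 (\<lambda>x. Im (f x)) + integral\<^sup>L M3 (\<lambda>x. Im (f x))"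
  proof (rule bounded)
    show "\<bar>Im (f x)\<bar> \<le> B" for x using b[of x] abs_Im_le_cmod[of "f x"] by linarith
  qed (use f in simp)
  have parts: "Re (integral\<^sup>L N f) = (\<integral>x. Re (f x) \<partial>N)" "Im (integral\<^sup>L N f) = (\<integral>x. Im (f x) \<partial>N)"
    if "finite_measure N" "sets N = sets M" for N
    using i[OF that] by (simp_all add: integral_Re integral_Im)
  show ?thesis
    unfolding complex_eq_iff plus_complex.sel parts[OF fin(1) refl] parts[OF fin(2) s(1)]
      parts[OF fin(3) s(2)] parts[OF fin(4) s(3)] using R I ..
qed

text \<open>\<open>Y\<close> is a Hahn set for \<alpha> - \<beta>: a Borel B \<subseteq> A gains by
  dropping its part outside Y and by adding the rest of A \<inter> Y, so the supremum is attained at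
  A \<inter> Y.\<close>

lemma pos_variation_of_difference:
  fixes \<alpha> \<beta> :: "'a::topological_space measure"
  assumes fin: "finite_measure \<alpha>" "finite_measure \<beta>" and s: "sets \<alpha> = sets borel" "sets \<beta> = sets borel"
    and Y: "Y \<in> sets borel" "\<forall>X\<in>sets borel. X \<subseteq> Y \<longrightarrow> measure \<beta> X \<le> measure \<alpha> X"
      "\<forall>X\<in>sets borel. X \<inter> Y = {} \<longrightarrow> measure \<alpha> X \<le> measure \<beta> X"
  defines "\<nu> \<equiv> (\<lambda>A. measure \<alpha> A - measure \<beta> A)"
  shows "sets (pos_variation \<nu>) = sets borel" "finite_measure (pos_variation \<nu>)"
    "\<And>A. A \<in> sets borel \<Longrightarrow> measure (pos_variation \<nu>) A = \<nu> (A \<inter> Y)"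
proof -
  interpret \<alpha>: finite_measure \<alpha> by fact
  interpret \<beta>: finite_measure \<beta> by fact
  have \<nu>: "\<nu> A = measure \<alpha> A - measure \<beta> A" for A by (simp add: \<nu>_def)
  let ?p = "\<lambda>A. SUP B\<in>{B \<in> sets borel. B \<subseteq> A}. ennreal (\<nu> B)"
  have p: "?p A = ennreal (\<nu> (A \<inter> Y))" if A: "A \<in> sets borel" for A
  proof (rule antisym)
    show "?p A \<le> ennreal (\<nu> (A \<inter> Y))"
    proof (rule SUP_least, clarify)
      fix B :: "'a set" assume B: "B \<in> sets borel" "B \<subseteq> A"
      have "\<nu> B = \<nu> (B \<inter> Y) + \<nu> (B - Y)"
      proof -
        have "(B \<inter> Y) \<union> (B - Y) = B" "(B \<inter> Y) \<inter> (B - Y) = {}" by auto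
        then show ?thesis
          using \<alpha>.finite_measure_Union[of "B \<inter> Y" "B - Y"] \<beta>.finite_measure_Union[of "B \<inter> Y" "B - Y"] B Y(1) s
          by (simp add: \<nu>)
      qed
      also have "\<dots> \<le> \<nu> (B \<inter> Y)" using Y(3)[rule_format, of "B - Y"] B Y(1) by (auto simp: \<nu>)
      also have "\<dots> \<le> \<nu> (B \<inter> Y) + \<nu> ((A - B) \<inter> Y)" using Y(2)[rule_format, of "(A - B) \<inter> Y"] A B Y(1) by (auto simp: \<nu>)
      also have "\<dots> = \<nu> (A \<inter> Y)"
      proof -
        have "A \<inter> Y = (B \<inter> Y) \<union> ((A - B) \<inter> Y)" "(B \<inter> Y) \<inter> ((A - B) \<inter> Y) = {}" using B by auto
        then show ?thesis
          using \<alpha>.finite_measure_Union[of "B \<inter> Y" "(A - B) \<inter> Y"] \<beta>.finite_measure_Union[of "B \<inter> Y" "(A - B) \<inter> Y"] A B Y(1) s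
          by (simp add: \<nu>)
      qed
      finally show "ennreal (\<nu> B) \<le> ennreal (\<nu> (A \<inter> Y))" by (rule ennreal_leI)
    qed
    show "ennreal (\<nu> (A \<inter> Y)) \<le> ?p A" using A Y(1) by (intro SUP_upper) auto
  qed
  have sa: "sigma_algebra UNIV (sets (borel :: 'a measure))"
    by (metis sets.sigma_algebra_axioms space_borel)
  have \<nu>0: "\<nu> {} = 0" by (simp add: \<nu>)
  have pos: "0 \<le> \<nu> (A \<inter> Y)" if "A \<in> sets borel" for A
    using Y(2)[rule_format, of "A \<inter> Y"] that Y(1) by (simp add: \<nu>)
  have ca: "countably_additive (sets borel) ?p"
    unfolding countably_additive_def
  proof (intro allI impI)
    fix A :: "nat \<Rightarrow> 'a set" assume A: "range A \<subseteq> sets borel" "disjoint_family A" "(\<Union>i. A i) \<in> sets borel"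
    have A': "range (\<lambda>i. A i \<inter> Y) \<subseteq> sets borel" "disjoint_family (\<lambda>i. A i \<inter> Y)"
      using A Y(1) by (auto simp: disjoint_family_on_def)
    have "(\<lambda>i. \<nu> (A i \<inter> Y)) sums \<nu> (\<Union>i. A i \<inter> Y)"
      unfolding \<nu> using A' s by (intro sums_diff \<alpha>.finite_measure_UNION \<beta>.finite_measure_UNION) auto
    then have "(\<Sum>i. ennreal (\<nu> (A i \<inter> Y))) = ennreal (\<nu> (\<Union>i. A i \<inter> Y))"
      using A pos by (intro suminf_ennreal_eq) auto
    moreover have "(\<Union>i. A i \<inter> Y) = (\<Union>i. A i) \<inter> Y" by auto
    moreover have "?p (A i) = ennreal (\<nu> (A i \<inter> Y))" for i using A by (intro p) auto
    ultimately show "(\<Sum>i. ?p (A i)) = ?p (\<Union>i. A i)" using p[OF A(3)] by simp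
  qed
  show s': "sets (pos_variation \<nu>) = sets borel"
    unfolding pos_variation_def by (rule sets.sets_measure_of_eq[where M="borel :: 'a measure", unfolded space_borel])
  have em: "emeasure (pos_variation \<nu>) A = ennreal (\<nu> (A \<inter> Y))" if "A \<in> sets borel" for A
    unfolding pos_variation_def
    using p[OF that] p[of "{}"] \<nu>0
    by (subst emeasure_measure_of_sigma[OF sa _ ca that]) (auto simp: positive_def)
  show "finite_measure (pos_variation \<nu>)"
    using em[of UNIV] s' sets_eq_imp_space_eq[OF s'] by (intro finite_measureI) auto
  show "measure (pos_variation \<nu>) A = \<nu> (A \<inter> Y)" if "A \<in> sets borel" for A
    using em[OF that] pos[OF that] by (simp add: measure_def)
qed

text \<open>Limits of positive and negative parts may overlap, so \<alpha> and \<beta> are in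
  general not the Jordan parts of their difference. Still, positive variation plus \<beta> equals
  negative variation plus \<alpha>, and integrating this identity suffices.\<close>

lemma real_measure_integral_difference:
  fixes \<alpha> \<beta> :: "'a::topological_space measure"
  assumes fin: "finite_measure \<alpha>" "finite_measure \<beta>" and s: "sets \<alpha> = sets borel" "sets \<beta> = sets borel"
    and f: "f \<in> borel_measurable borel" and b: "\<And>x. norm (f x) \<le> B"
  shows "real_measure_integral (\<lambda>A. measure \<alpha> A - measure \<beta> A) f = integral\<^sup>L \<alpha> f - integral\<^sup>L \<beta> f"
proof -
  interpret \<alpha>: finite_measure \<alpha> by fact
  interpret \<beta>: finite_measure \<beta> by fact
  let ?\<nu> = "\<lambda>A. measure \<alpha> A - measure \<beta> A"
  obtain Y where Y: "Y \<in> sets \<alpha>" "\<And>X. X \<in> sets \<alpha> \<Longrightarrow> X \<subseteq> Y \<Longrightarrow> emeasure \<beta> X \<le> emeasure \<alpha> X"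
     "\<And>X. X \<in> sets \<alpha> \<Longrightarrow> X \<inter> Y = {} \<Longrightarrow> emeasure \<alpha> X \<le> emeasure \<beta> X"
    using finite_unsigned_Hahn_decomposition[OF fin] s by metis
  have Y': "Y \<in> sets borel" "- Y \<in> sets borel" using Y s by auto
  have le: "\<forall>X\<in>sets borel. X \<subseteq> Y \<longrightarrow> measure \<beta> X \<le> measure \<alpha> X"
    using Y(2) s by (simp add: \<alpha>.emeasure_eq_measure \<beta>.emeasure_eq_measure)
  have ge: "\<forall>X\<in>sets borel. X \<inter> Y = {} \<longrightarrow> measure \<alpha> X \<le> measure \<beta> X"
    using Y(3) s by (simp add: \<alpha>.emeasure_eq_measure \<beta>.emeasure_eq_measure)
  note P = pos_variation_of_difference[OF fin s Y'(1) le ge]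
  have ge': "\<forall>X\<in>sets borel. X \<subseteq> - Y \<longrightarrow> measure \<alpha> X \<le> measure \<beta> X"
    using ge by (metis disjoint_eq_subset_Compl)
  have le': "\<forall>X\<in>sets borel. X \<inter> - Y = {} \<longrightarrow> measure \<beta> X \<le> measure \<alpha> X"
    using le by (metis disjoint_eq_subset_Compl double_complement)
  have neg: "(\<lambda>A. - ?\<nu> A) = (\<lambda>A. measure \<beta> A - measure \<alpha> A)" by auto
  note N = pos_variation_of_difference[OF fin(2) fin(1) s(2) s(1) Y'(2) ge' le']
  have "integral\<^sup>L (pos_variation ?\<nu>) f + integral\<^sup>L \<beta> f
     = integral\<^sup>L (pos_variation (\<lambda>A. measure \<beta> A - measure \<alpha> A)) f + integral\<^sup>L \<alpha> f"
  proof (rule integral_measure_sum_eq[where B=B])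
    fix A assume "A \<in> sets (pos_variation ?\<nu>)"
    then have A: "A \<in> sets borel" using P(1) by simp
    have AY: "A \<inter> Y \<union> A \<inter> - Y = A" "(A \<inter> Y) \<inter> (A \<inter> - Y) = {}" by auto
    have "measure \<alpha> A = measure \<alpha> (A \<inter> Y) + measure \<alpha> (A \<inter> - Y)" "measure \<beta> A = measure \<beta> (A \<inter> Y) + measure \<beta> (A \<inter> - Y)"
      using \<alpha>.finite_measure_Union[of "A \<inter> Y" "A \<inter> -Y"] \<beta>.finite_measure_Union[of "A \<inter> Y" "A \<inter> -Y"] A Y' s
      unfolding AY by simp_all
    then show "measure (pos_variation ?\<nu>) A + measure \<beta> A =
      measure (pos_variation (\<lambda>A. measure \<beta> A - measure \<alpha> A)) A + measure \<alpha> A"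
      using P(3)[OF A] N(3)[OF A] by simp
  next
    show "f \<in> borel_measurable (pos_variation ?\<nu>)"
      using f unfolding measurable_cong_sets[OF P(1) refl] .
  qed (use P(1,2) N(1,2) fin s b in simp_all)
  then show ?thesis unfolding real_measure_integral_def neg by (simp add: algebra_simps)
qed

definition complex_of_four :: "(nat \<Rightarrow> 'a measure) \<Rightarrow> 'a set \<Rightarrow> complex" where
  "complex_of_four \<rho> E = Complex (measure (\<rho> 0) E - measure (\<rho> 1) E) (measure (\<rho> 2) E - measure (\<rho> 3) E)"

lemma complex_measure_integral_of_four:
  assumes "\<And>c. finite_measure (\<rho> c)" "\<And>c. sets (\<rho> c) = sets borel"
    and "f \<in> borel_measurable borel" "\<And>x. norm (f x) \<le> B"
  shows "complex_measure_integral (complex_of_four \<rho>) f =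
     (integral\<^sup>L (\<rho> 0) f - integral\<^sup>L (\<rho> 1) f) + \<i> * (integral\<^sup>L (\<rho> 2) f - integral\<^sup>L (\<rho> 3) f)"
  unfolding complex_measure_integral_def complex_of_four_def
  using real_measure_integral_difference[OF assms(1) assms(1) assms(2) assms(2) assms(3,4)] by simp

lemma complex_of_four_sums:
  assumes fin: "\<And>c. finite_measure (\<rho> c)" and s: "\<And>c. sets (\<rho> c) = sets borel"
    and A: "range A \<subseteq> sets borel" "disjoint_family A"
  shows "(\<lambda>i. complex_of_four \<rho> (A i)) sums complex_of_four \<rho> (\<Union>i. A i)"
proof -
  have "(\<lambda>i. measure (\<rho> c) (A i)) sums measure (\<rho> c) (\<Union>i. A i)" for c
    using A s by (intro finite_measure.finite_measure_UNION[OF fin]) auto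
  then show ?thesis unfolding complex_of_four_def sums_complex_iff by (auto intro!: sums_diff)
qed

section \<open>Total variation and regularity\<close>

lemma total_variation_mono:
  fixes E F :: "'a::topological_space set"
  assumes "E \<in> sets borel" "F \<in> sets borel" "E \<subseteq> F"
  shows "total_variation \<mu> E \<le> total_variation \<mu> F"
  unfolding total_variation_def[of _ E]
proof (rule SUP_least)
  fix A :: "nat \<Rightarrow> 'a set"
  assume "A \<in> {A. range A \<subseteq> sets borel \<and> disjoint_family A \<and> (\<Union>i. A i) = E}"
  then have A: "range A \<subseteq> sets borel" "disjoint_family A" "(\<Union>i. A i) = E" by auto
  \<comment> \<open>A countable partition of E becomes one of F by prepending F - E.\<close>
  define A' where "A' = case_nat (F - E) A"
  have A': "A' 0 = F - E" "A' (Suc i) = A i" for i by (simp_all add: A'_def)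
  have AE: "A i \<subseteq> E" for i using A by auto
  have dA: "A i \<inter> A j = {}" if "i \<noteq> j" for i j using A(2) that by (auto simp: disjoint_family_on_def)
  have "disjoint_family A'" unfolding disjoint_family_on_def
  proof (intro ballI impI)
    fix i j :: nat assume "i \<noteq> j"
    then show "A' i \<inter> A' j = {}"
      using AE dA by (cases i; cases j) (auto simp: A')
  qed
  moreover have "A' i \<in> sets borel" for i using A(1) assms by (cases i) (auto simp: A')
  moreover have "(\<Union>i. A' i) = F"
  proof
    show "(\<Union>i. A' i) \<subseteq> F"
    proof (rule UN_least)
      show "A' i \<subseteq> F" for i using AE assms by (cases i) (auto simp: A')
    qed
    show "F \<subseteq> (\<Union>i. A' i)"
    proof
      fix x assume x: "x \<in> F"
      show "x \<in> (\<Union>i. A' i)"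
      proof (cases "x \<in> E")
        case True
        then obtain i where "x \<in> A i" using A(3) by blast
        then have "x \<in> A' (Suc i)" by (simp add: A')
        then show ?thesis by blast
      next
        case False
        then have "x \<in> A' 0" using x by (simp add: A')
        then show ?thesis by blast
      qed
    qed
  qed
  ultimately have "(\<Sum>i. ennreal (norm (\<mu> (A' i)))) \<le> total_variation \<mu> F"
    unfolding total_variation_def by (intro SUP_upper) auto
  moreover have "(\<Sum>i. ennreal (norm (\<mu> (A i)))) \<le> (\<Sum>i. ennreal (norm (\<mu> (A' i))))"
  proof -
    have "summable (\<lambda>i. ennreal (norm (\<mu> (A' (i + 1)))))" by simp
    from suminf_offset[of "\<lambda>i. ennreal (norm (\<mu> (A' i)))", OF this]
    have "(\<Sum>i. ennreal (norm (\<mu> (A' i)))) = (\<Sum>i. ennreal (norm (\<mu> (A i)))) + ennreal (norm (\<mu> (F - E)))"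
      by (simp add: A')
    then show ?thesis by simp
  qed
  ultimately show "(\<Sum>i. ennreal (norm (\<mu> (A i)))) \<le> total_variation \<mu> F" by (rule order_trans[rotated])
qed

lemma total_variation_Un:
  assumes ca: "complex_borel_measure \<mu>" and EF: "E \<in> sets borel" "F \<in> sets borel" "E \<inter> F = {}"
  shows "total_variation \<mu> (E \<union> F) \<le> total_variation \<mu> E + total_variation \<mu> F"
  unfolding total_variation_def[of _ "E \<union> F"]
proof (rule SUP_least, clarify)
  fix A :: "nat \<Rightarrow> _" assume A: "range A \<subseteq> sets borel" "disjoint_family A" "(\<Union>i. A i) = E \<union> F"
  \<comment> \<open>On the constantly empty family, countable additivity sums a constant series,
    which forces the constant to vanish.\<close>
  have "(\<lambda>i. \<mu> {}) sums \<mu> (\<Union>i::nat. {})"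
    using ca unfolding complex_borel_measure_def by (auto simp: disjoint_family_on_def elim!: allE[of _ "\<lambda>_. {}"])
  then have e: "\<mu> {} = 0" by (auto dest!: sums_summable summable_LIMSEQ_zero simp: LIMSEQ_const_iff)
  have "\<mu> (A i) = \<mu> (A i \<inter> E) + \<mu> (A i \<inter> F)" for i
  proof -
    let ?B = "binaryset (A i \<inter> E) (A i \<inter> F)"
    have s1: "(\<lambda>j. \<mu> (?B j)) sums \<mu> (\<Union>j. ?B j)"
      using ca EF A unfolding complex_borel_measure_def
      by (elim allE[of _ ?B]) (auto simp: disjoint_family_on_def binaryset_def split: if_splits)
    have U: "(\<Union>j. ?B j) = A i" using A by (auto simp: UN_binaryset_eq)
    have "(\<lambda>j. \<mu> (?B j)) sums (\<mu> (A i \<inter> E) + \<mu> (A i \<inter> F))"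
      using binaryset_sums[of \<mu> "A i \<inter> E" "A i \<inter> F"] e by blast
    from sums_unique2[OF s1[unfolded U] this] show ?thesis .
  qed
  then have "norm (\<mu> (A i)) \<le> norm (\<mu> (A i \<inter> E)) + norm (\<mu> (A i \<inter> F))" for i
    by (simp add: norm_triangle_ineq)
  then have "(\<Sum>i. ennreal (norm (\<mu> (A i)))) \<le> (\<Sum>i. ennreal (norm (\<mu> (A i \<inter> E))) + ennreal (norm (\<mu> (A i \<inter> F))))"
    by (intro suminf_le) (auto simp flip: ennreal_plus intro: ennreal_leI)
  also have "\<dots> = (\<Sum>i. ennreal (norm (\<mu> (A i \<inter> E)))) + (\<Sum>i. ennreal (norm (\<mu> (A i \<inter> F))))"
    by (rule suminf_add[symmetric]) auto
  also have "\<dots> \<le> total_variation \<mu> E + total_variation \<mu> F"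
  proof -
    have part: "(\<Sum>i. ennreal (norm (\<mu> (A i \<inter> D)))) \<le> total_variation \<mu> D" if "D \<in> sets borel" "D \<subseteq> E \<union> F" for D
    proof -
      have "(\<Union>i. A i \<inter> D) = D" using that(2) A(3) by blast
      moreover have "disjoint_family (\<lambda>i. A i \<inter> D)"
        using A(2) unfolding disjoint_family_on_def by blast
      moreover have "range (\<lambda>i. A i \<inter> D) \<subseteq> sets borel" using A(1) that(1) by auto
      ultimately have "(\<lambda>i. A i \<inter> D) \<in> {A. range A \<subseteq> sets borel \<and> disjoint_family A \<and> \<Union> (range A) = D}"
        by simp
      then show ?thesis unfolding total_variation_def by (rule SUP_upper)
    qed
    show ?thesis by (intro add_mono part) (use EF in auto)
  qed
  finally show "(\<Sum>i. ennreal (norm (\<mu> (A i)))) \<le> total_variation \<mu> E + total_variation \<mu> F" .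
qed

lemma total_variation_of_four:
  assumes fin: "\<And>c. finite_measure (\<rho> c)" and s: "\<And>c. sets (\<rho> c) = sets borel"
    and E: "E \<in> sets borel"
  shows "total_variation (complex_of_four \<rho>) E \<le> ennreal (\<Sum>c<4. measure (\<rho> c) E)"
  unfolding total_variation_def
proof (rule SUP_least)
  fix A :: "nat \<Rightarrow> 'a set"
  assume "A \<in> {A. range A \<subseteq> sets borel \<and> disjoint_family A \<and> (\<Union>i. A i) = E}"
  then have A: "range A \<subseteq> sets borel" "disjoint_family A" "E = (\<Union>i. A i)" by auto
  have n: "norm (complex_of_four \<rho> B) \<le> (\<Sum>c<4. measure (\<rho> c) B)" for B
  proof -
    have *: "\<bar>a - b\<bar> \<le> a + b" if "0 \<le> a" "0 \<le> b" for a b :: real using that by auto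
    have "(\<Sum>c<4. measure (\<rho> c) B) = measure (\<rho> 0) B + measure (\<rho> 1) B + (measure (\<rho> 2) B + measure (\<rho> 3) B)"
      by (simp add: eval_nat_numeral lessThan_Suc)
    then show ?thesis
      unfolding complex_of_four_def by (intro order_trans[OF cmod_le]) (simp add: add_mono *)
  qed
  have r: "range A \<subseteq> sets (\<rho> c)" for c using A(1) s by simp
  have "(\<lambda>i. measure (\<rho> c) (A i)) sums measure (\<rho> c) E" for c
    using finite_measure.finite_measure_UNION[OF fin r A(2)] unfolding A(3) .
  then have "(\<lambda>i. \<Sum>c<4. measure (\<rho> c) (A i)) sums (\<Sum>c<4. measure (\<rho> c) E)"
    by (intro sums_sum)
  then have "(\<Sum>i. ennreal (\<Sum>c<4. measure (\<rho> c) (A i))) = ennreal (\<Sum>c<4. measure (\<rho> c) E)"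
    by (intro suminf_ennreal_eq) (simp_all add: sum_nonneg)
  moreover have "(\<Sum>i. ennreal (norm (complex_of_four \<rho> (A i)))) \<le> (\<Sum>i. ennreal (\<Sum>c<4. measure (\<rho> c) (A i)))"
    by (intro suminf_le ennreal_leI n) auto
  ultimately show "(\<Sum>i. ennreal (norm (complex_of_four \<rho> (A i)))) \<le> ennreal (\<Sum>c<4. measure (\<rho> c) E)"
    by simp
qed

text \<open>The sum of the four measures dominates the total variation, so outer regularity passes
  to it. Inner regularity at E is outer regularity at the complement, complements of open sets being
  compact.\<close>

lemma complex_of_four_in_M_space:
  fixes \<rho> :: "nat \<Rightarrow> 'a::t2_space measure"
  assumes K: "compact (UNIV :: 'a set)"
    and fin: "\<And>c. finite_measure (\<rho> c)" and s: "\<And>c. sets (\<rho> c) = sets borel"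
    and reg: "\<And>c. \<forall>E\<in>sets borel. \<forall>e>0. \<exists>U. open U \<and> E \<subseteq> U \<and> measure (\<rho> c) (U - E) \<le> e"
  shows "complex_of_four \<rho> \<in> M_space"
proof -
  let ?\<mu> = "complex_of_four \<rho>" let ?T = "total_variation ?\<mu>"
  have ca: "complex_borel_measure ?\<mu>"
    unfolding complex_borel_measure_def by (intro allI impI, elim conjE) (rule complex_of_four_sums[OF fin s])
  have outer: "\<exists>U. open U \<and> E \<subseteq> U \<and> ?T (U - E) \<le> ennreal e" if E: "E \<in> sets borel" and e: "0 < e" for E e
  proof -
    have "\<exists>U. open U \<and> E \<subseteq> U \<and> measure (\<rho> c) (U - E) \<le> e / 4" for c
      using reg[of c, rule_format, OF E, of "e/4"] e by simp
    then obtain U where U: "\<And>c. open (U c)" "\<And>c. E \<subseteq> U c" "\<And>c. measure (\<rho> c) (U c - E) \<le> e / 4" by metis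
    define V where "V = (\<Inter>c<4. U c)"
    have V: "open V" "E \<subseteq> V" using U by (auto simp: V_def)
    have "?T (V - E) \<le> ennreal (\<Sum>c<4. measure (\<rho> c) (V - E))"
      using V E by (intro total_variation_of_four fin s) auto
    also have "\<dots> \<le> ennreal (\<Sum>c<(4::nat). e / 4)"
    proof (intro ennreal_leI sum_mono)
      fix c :: nat assume "c \<in> {..<4}"
      then have "measure (\<rho> c) (V - E) \<le> measure (\<rho> c) (U c - E)"
        using U E V s by (intro finite_measure.finite_measure_mono[OF fin]) (auto simp: V_def)
      then show "measure (\<rho> c) (V - E) \<le> e / 4" using U(3)[of c] by linarith
    qed
    finally show ?thesis using V by auto
  qed
  have "regular_on_borel ?T" unfolding regular_on_borel_def
  proof (intro ballI conjI antisym)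
    fix E :: "'a set" assume E: "E \<in> sets borel"
    show "?T E \<le> (INF U\<in>{U. open U \<and> E \<subseteq> U}. ?T U)"
      by (intro INF_greatest total_variation_mono E) auto
    show "(SUP K\<in>{K. compact K \<and> K \<in> sets borel \<and> K \<subseteq> E}. ?T K) \<le> ?T E"
      by (intro SUP_least total_variation_mono E) auto
    show "(INF U\<in>{U. open U \<and> E \<subseteq> U}. ?T U) \<le> ?T E"
    proof (rule ennreal_le_epsilon)
      fix e :: real assume "0 < e"
      then obtain U where U: "open U" "E \<subseteq> U" "?T (U - E) \<le> ennreal e" using outer[OF E] by blast
      have "(INF U\<in>{U. open U \<and> E \<subseteq> U}. ?T U) \<le> ?T U" using U by (intro INF_lower) auto
      also have "\<dots> \<le> ?T E + ?T (U - E)"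
        using total_variation_Un[OF ca E, of "U - E"] U E by (simp add: Un_absorb1)
      finally show "(INF U\<in>{U. open U \<and> E \<subseteq> U}. ?T U) \<le> ?T E + ennreal e"
        using U(3) by (meson add_left_mono order_trans)
    qed
    show "?T E \<le> (SUP K\<in>{K. compact K \<and> K \<in> sets borel \<and> K \<subseteq> E}. ?T K)"
    proof (rule ennreal_le_epsilon)
      fix e :: real assume "0 < e"
      then obtain U where U: "open U" "- E \<subseteq> U" "?T (U - - E) \<le> ennreal e" using outer[of "- E"] E by auto
      have K': "compact (- U)" using U(1) compact_Int_closed[OF K, of "- U"] by auto
      have "?T E \<le> ?T (- U) + ?T (E - (- U))"
      proof -
        have "- U \<union> (E - - U) = E" "- U \<inter> (E - - U) = {}" using U(2) by auto
        then show ?thesis using total_variation_Un[OF ca, of "- U" "E - (- U)"] U(1) E by auto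
      qed
      also have "E - - U = U - - E" by auto
      also have "?T (- U) \<le> (SUP K\<in>{K. compact K \<and> K \<in> sets borel \<and> K \<subseteq> E}. ?T K)"
        using U K' by (intro SUP_upper) auto
      finally show "?T E \<le> (SUP K\<in>{K. compact K \<and> K \<in> sets borel \<and> K \<subseteq> E}. ?T K) + ennreal e"
        using U(3) by (meson add_mono order_trans order_refl)
    qed
  qed
  then show ?thesis using ca by (simp add: M_space_def)
qed

section \<open>Haar measure and spectral subspaces\<close>

lemma normalized_haarD:
  assumes "normalized_haar m"
  shows "sets m = sets borel" "space m = UNIV" "finite_measure m" "measure m UNIV = 1"
proof -
  show s: "sets m = sets borel" using assms by (simp add: normalized_haar_def)
  show sp: "space m = UNIV" using sets_eq_imp_space_eq[OF s] by simp
  have e: "emeasure m UNIV = 1" using assms by (simp add: normalized_haar_def)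
  show "finite_measure m" using e sp by (intro finite_measureI) auto
  show "measure m UNIV = 1" using e by (simp add: measure_def)
qed

lemma haar_outer_regular:
  fixes m :: "'a::{topological_ab_group_add, t2_space} measure"
  assumes m: "normalized_haar m" and E: "E \<in> sets borel" and e: "0 < e"
  shows "\<exists>U. open U \<and> E \<subseteq> U \<and> measure m (U - E) \<le> e"
proof -
  note mD = normalized_haarD[OF m]
  interpret finite_measure m by (rule mD(3))
  have "emeasure m E = (INF U\<in>{U. open U \<and> E \<subseteq> U}. emeasure m U)"
    using m E by (simp add: normalized_haar_def regular_on_borel_def)
  moreover have "emeasure m E < emeasure m E + ennreal e"
    using ennreal_add_left_cancel_less[of "emeasure m E" 0 "ennreal e"] e by simp
  ultimately have "\<exists>U\<in>{U. open U \<and> E \<subseteq> U}. emeasure m U < emeasure m E + ennreal e"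
    by (simp only: INF_less_iff)
  then obtain U where U: "open U" "E \<subseteq> U" "emeasure m U < emeasure m E + ennreal e" by blast
  have "measure m U \<le> measure m E + e"
  proof -
    have "ennreal (measure m U) \<le> ennreal (measure m E + e)"
      using U(3) e by (simp add: emeasure_eq_measure)
    then show ?thesis using e by (simp del: ennreal_plus)
  qed
  then have "measure m (U - E) \<le> e" using U(1,2) E mD(1) by (simp add: finite_measure_Diff)
  then show ?thesis using U(1,2) by blast
qed

lemma haar_inner_regular:
  fixes m :: "'a::{topological_ab_group_add, t2_space} measure"
  assumes K: "compact (UNIV :: 'a set)" and m: "normalized_haar m" and E: "E \<in> sets borel" and e: "0 < e"
  shows "\<exists>K. compact K \<and> K \<subseteq> E \<and> measure m (E - K) \<le> e"
proof -
  have "- E \<in> sets borel" using E by auto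
  then obtain U where U: "open U" "- E \<subseteq> U" "measure m (U - - E) \<le> e"
    using haar_outer_regular[OF m _ e] by blast
  show ?thesis
  proof (intro exI[of _ "- U"] conjI)
    show "compact (- U)" using compact_Int_closed[OF K, of "- U"] U(1) by auto
    have "E - - U = U - - E" by auto
    then show "measure m (E - - U) \<le> e" using U(3) by simp
  qed (use U(2) in auto)
qed

text \<open>All points have equal mass by translation invariance, and any n of them have total mass
  at most 1.\<close>

lemma haar_singleton_null:
  fixes m :: "'a::{topological_ab_group_add, t2_space} measure"
  assumes m: "normalized_haar m" and inf: "infinite (UNIV :: 'a set)"
  shows "measure m {x} = 0"
proof -
  note mD = normalized_haarD[OF m]
  interpret finite_measure m by (rule mD(3))
  have s: "{y} \<in> sets borel" for y :: 'a by simp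
  have tr: "measure m {y} = measure m {0}" for y
  proof -
    have "emeasure m ((\<lambda>z. y + z) ` {0}) = emeasure m {0}"
      using m s unfolding normalized_haar_def by blast
    then show ?thesis by (simp add: measure_def)
  qed
  have "real n * measure m {x} \<le> 1" for n
  proof -
    obtain F :: "'a set" where F: "finite F" "card F = n" using inf infinite_arbitrarily_large by blast
    have "measure m F = (\<Sum>y\<in>F. measure m {y})"
      using F(1) s mD(1) by (intro finite_measure_eq_sum_singleton) auto
    also have "\<dots> = real n * measure m {0}" using F by (subst tr) simp
    finally show ?thesis using bounded_measure[of F] mD tr[of x] by simp
  qed
  then have "measure m {x} \<le> 0" using reals_Archimedean3[of "measure m {x}"]
    by (metis linorder_not_le less_le_not_le)
  then show ?thesis by (simp add: measure_le_0_iff)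
qed

section \<open>Cells of small Haar measure\<close>

definition cell :: "(nat \<Rightarrow> 'a set) \<Rightarrow> bool list \<Rightarrow> 'a set" where
  "cell E s = {x. \<forall>i<length s. x \<in> E i \<longleftrightarrow> s ! i}"

lemma cell_Nil [simp]: "cell E [] = UNIV"
  by (simp add: cell_def)

lemma cell_snoc: "cell E (s @ [b]) = cell E s \<inter> {x. x \<in> E (length s) \<longleftrightarrow> b}"
  by (auto simp: cell_def nth_append less_Suc_eq)

lemma cell_split:
  "cell E s = cell E (s @ [False]) \<union> cell E (s @ [True])"
  "cell E (s @ [False]) \<inter> cell E (s @ [True]) = {}"
  by (auto simp: cell_snoc)

lemma cell_borel:
  assumes "\<And>i. E i \<in> sets borel" shows "cell E s \<in> sets borel"
proof (induction s rule: rev_induct)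
  case (snoc b s)
  have "{x. x \<in> E (length s) \<longleftrightarrow> b} = (if b then E (length s) else - E (length s))" by auto
  also have "\<dots> \<in> sets borel" using assms by auto
  finally show ?case unfolding cell_snoc using snoc by auto
qed simp

text \<open>Points are null, so outer regularity and compactness give, for each k, a finite cover by
  open sets of measure at most 1/(k + 1). The sets \<open>E\<close> run through all these covers. A
  word long enough to decide membership in every set of the k-th cover has its cell inside one of
  them, or has an empty cell.\<close>

lemma haar_shrinking_cells:
  fixes m :: "'a::{topological_ab_group_add, t2_space} measure"
  assumes K: "compact (UNIV :: 'a set)" and m: "normalized_haar m" and inf: "infinite (UNIV :: 'a set)"
  obtains E :: "nat \<Rightarrow> 'a set" where "\<And>i. E i \<in> sets borel"
    "\<And>e. 0 < e \<Longrightarrow> \<exists>N. \<forall>s. N \<le> length s \<longrightarrow> measure m (cell E s) \<le> e"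
proof -
  note mD = normalized_haarD[OF m]
  interpret finite_measure m by (rule mD(3))
  define cover where "cover k W n \<longleftrightarrow>
    (\<forall>j. open (W j) \<and> measure m (W j) \<le> 1 / (real k + 1)) \<and> (\<Union>j<n. W j) = UNIV"
    for k n :: nat and W :: "nat \<Rightarrow> 'a set"
  have "\<exists>W n. cover k W n" for k
  proof -
    have "\<exists>U. open U \<and> x \<in> U \<and> measure m U \<le> 1 / (real k + 1)" for x :: 'a
    proof -
      obtain U where U: "open U" "{x} \<subseteq> U" "measure m (U - {x}) \<le> 1 / (real k + 1)"
        using haar_outer_regular[OF m borel_singleton[OF sets.empty_sets], of "1 / (real k + 1)" x] by auto
      then have "measure m U \<le> 1 / (real k + 1)"
        using haar_singleton_null[OF m inf, of x] mD(1) by (simp add: finite_measure_Diff)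
      with U show ?thesis by blast
    qed
    then obtain U :: "'a \<Rightarrow> 'a set" where U: "\<And>x. open (U x)" "\<And>x. x \<in> U x" "\<And>x. measure m (U x) \<le> 1 / (real k + 1)"
      by metis
    have "UNIV \<subseteq> (\<Union>x. U x)" using U(2) by auto
    then obtain F where F: "finite F" "UNIV \<subseteq> (\<Union>x\<in>F. U x)"
      using compactE_image[OF K, of UNIV U] U(1) by auto
    obtain xs where xs: "set xs = F" using F(1) finite_list by blast
    \<comment> \<open>Padding by the empty set turns each finite cover into a sequence, so that
      \<open>prod_encode\<close> can enumerate all of them.\<close>
    define W where "W j = (if j < length xs then U (xs ! j) else {})" for j
    have "(\<Union>j<length xs. W j) = (\<Union>x\<in>F. U x)"
      using xs by (auto simp: W_def set_conv_nth)
    moreover have "\<forall>j. open (W j) \<and> measure m (W j) \<le> 1 / (real k + 1)" using U by (auto simp: W_def)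
    ultimately have "cover k W (length xs)" using F(2) by (auto simp: cover_def)
    then show ?thesis by blast
  qed
  then obtain W n where "\<And>k. cover k (W k) (n k)" by metis
  then have W: "\<And>k j. open (W k j)" "\<And>k j. measure m (W k j) \<le> 1 / (real k + 1)" "\<And>k. (\<Union>j<n k. W k j) = UNIV"
    unfolding cover_def by blast+
  define E where "E i = W (fst (prod_decode i)) (snd (prod_decode i))" for i
  have EW: "E (prod_encode (k, j)) = W k j" for k j by (simp add: E_def)
  show thesis
  proof (rule that)
    show "E i \<in> sets borel" for i unfolding E_def using W(1) by (intro borel_open)
  next
    fix e :: real assume "0 < e"
    then obtain k where k: "1 / (real k + 1) < e"
      using reals_Archimedean[of e] by (auto simp: inverse_eq_divide add.commute)
    define N where "N = Suc (Max (insert 0 ((\<lambda>j. prod_encode (k, j)) ` {..<n k})))"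
    have N: "prod_encode (k, j) < N" if "j < n k" for j
      using that unfolding N_def by (intro le_imp_less_Suc Max_ge) auto
    have "measure m (cell E s) \<le> e" if s: "N \<le> length s" for s
    proof (cases "\<exists>j<n k. s ! prod_encode (k, j)")
      case True
      then obtain j where j: "j < n k" "s ! prod_encode (k, j)" by blast
      have "cell E s \<subseteq> W k j"
        using N[OF j(1)] s j(2) unfolding cell_def EW[symmetric] by auto
      then have "measure m (cell E s) \<le> measure m (W k j)"
        using W(1) mD(1) by (intro finite_measure_mono) auto
      then show ?thesis using W(2)[of k j] k by linarith
    next
      case False
      have "cell E s = {}"
      proof (rule ccontr)
        assume "cell E s \<noteq> {}"
        then obtain x where x: "x \<in> cell E s" by blast
        obtain j where j: "j < n k" "x \<in> W k j" using W(3)[of k] by blast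
        then have "s ! prod_encode (k, j)"
          using x N[OF j(1)] s unfolding cell_def EW[symmetric] by auto
        with False j(1) show False by blast
      qed
      then show ?thesis using \<open>0 < e\<close> by simp
    qed
    then show "\<exists>N. \<forall>s. N \<le> length s \<longrightarrow> measure m (cell E s) \<le> e" by blast
  qed
qed

section \<open>Characters and spectral subspaces\<close>

lemma dual_group_measurable: "\<gamma> \<in> dual_group \<Longrightarrow> \<gamma> \<in> borel_measurable borel"
  by (simp add: dual_group_def borel_measurable_continuous_onI)

lemma integrable_mult_character:
  assumes s: "sets m = sets borel" and f: "integrable m f" and \<gamma>: "\<gamma> \<in> dual_group"
  shows "integrable m (\<lambda>x. f x * cnj (\<gamma> x))"
proof (rule Bochner_Integration.integrable_bound[OF f])
  have "\<gamma> \<in> borel_measurable m"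
    unfolding measurable_cong_sets[OF s refl] using \<gamma> by (rule dual_group_measurable)
  moreover have "cnj \<in> borel_measurable borel"
    by (intro borel_measurable_continuous_onI continuous_intros)
  ultimately have "(\<lambda>x. cnj (\<gamma> x)) \<in> borel_measurable m" by (rule measurable_compose)
  then show "(\<lambda>x. f x * cnj (\<gamma> x)) \<in> borel_measurable m"
    using f by (intro borel_measurable_times) auto
  show "AE x in m. norm (f x * cnj (\<gamma> x)) \<le> norm (f x)"
    using \<gamma> by (simp add: dual_group_def norm_mult)
qed

lemma L1_subspace_L1_spectrum:
  assumes s: "sets m = sets borel"
  shows "L1_subspace m (L1_spectrum m \<Lambda>)"
  unfolding L1_subspace_def
proof (intro conjI ballI allI impI)
  show "L1_spectrum m \<Lambda> \<subseteq> L1_space m" by (auto simp: L1_spectrum_def)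
  show "(\<lambda>_. 0) \<in> L1_spectrum m \<Lambda>" by (simp add: L1_spectrum_def L1_space_def fourier_def)
next
  fix f g assume fg: "f \<in> L1_spectrum m \<Lambda>" "g \<in> L1_spectrum m \<Lambda>"
  then have i: "integrable m f" "integrable m g" by (auto simp: L1_spectrum_def L1_space_def)
  have "fourier m (\<lambda>x. f x + g x) \<gamma> = fourier m f \<gamma> + fourier m g \<gamma>" if "\<gamma> \<in> dual_group" for \<gamma>
    using integrable_mult_character[OF s i(1) that] integrable_mult_character[OF s i(2) that]
    by (simp add: fourier_def distrib_right)
  then show "(\<lambda>x. f x + g x) \<in> L1_spectrum m \<Lambda>" using fg i by (auto simp: L1_spectrum_def L1_space_def)
next
  fix c f assume f: "f \<in> L1_spectrum m \<Lambda>"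
  have "fourier m (\<lambda>x. c * f x) \<gamma> = c * fourier m f \<gamma>" for \<gamma>
    by (simp add: fourier_def mult.assoc)
  then show "(\<lambda>x. c * f x) \<in> L1_spectrum m \<Lambda>" using f by (auto simp: L1_spectrum_def L1_space_def)
next
  fix f g assume f: "f \<in> L1_spectrum m \<Lambda>" and g: "g \<in> L1_space m" and ae: "AE x in m. f x = g x"
  have i: "integrable m f" "integrable m g" using f g by (auto simp: L1_spectrum_def L1_space_def)
  have "fourier m f \<gamma> = fourier m g \<gamma>" if "\<gamma> \<in> dual_group" for \<gamma>
    unfolding fourier_def using ae
    by (intro integral_cong_AE borel_measurable_integrable integrable_mult_character[OF s _ that] i) auto
  then show "g \<in> L1_spectrum m \<Lambda>" using f g by (auto simp: L1_spectrum_def)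
qed

lemma AE_tendsto_imp_converges_in_measure:
  assumes fin: "finite_measure m" and meas: "\<And>n. f n \<in> borel_measurable m" "g \<in> borel_measurable m"
    and ae: "AE x in m. (\<lambda>n. f n x) \<longlonglongrightarrow> g x"
  shows "converges_in_measure m f g"
  unfolding converges_in_measure_def
proof (intro allI impI)
  fix e :: real assume e: "0 < e"
  interpret finite_measure m by fact
  define A where "A n = {x \<in> space m. norm (f n x - g x) > e}" for n
  have A: "A n \<in> sets m" for n unfolding A_def using meas by measurable
  have "(\<lambda>n. \<integral>x. indicator (A n) x \<partial>m) \<longlonglongrightarrow> (\<integral>x. (0::real) \<partial>m)"
  proof (rule integral_dominated_convergence[where w="\<lambda>_. 1"])
    show "AE x in m. (\<lambda>n. indicator (A n) x :: real) \<longlonglongrightarrow> 0" using ae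
    proof eventually_elim
      case (elim x)
      have "\<forall>\<^sub>F n in sequentially. dist (f n x) (g x) < e" using elim e by (rule tendstoD)
      then have "\<forall>\<^sub>F n in sequentially. indicator (A n) x = (0::real)"
        by eventually_elim (simp add: A_def dist_norm)
      then show ?case by (rule tendsto_eventually)
    qed
  qed (use A in \<open>auto simp: indicator_def\<close>)
  then show "(\<lambda>n. measure m {x \<in> space m. norm (f n x - g x) > e}) \<longlonglongrightarrow> 0"
    using A by (simp add: A_def[symmetric])
qed

text \<open>Nice placement speaks of the unit ball; scaling by 1/t transfers it to other radii. As r
  may be 0, one scales with t > r and lets t decrease to r.\<close>

lemma nicely_placed_AE_closed:
  assumes s: "sets m = sets borel" and fin: "finite_measure m" and np: "nicely_placed m \<Lambda>"
    and f: "\<And>n. f n \<in> L1_spectrum m \<Lambda>" "\<And>n. L1_norm m (f n) \<le> r"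
    and g: "g \<in> borel_measurable m" "AE x in m. (\<lambda>n. f n x) \<longlonglongrightarrow> g x"
  shows "g \<in> L1_spectrum m \<Lambda>" "L1_norm m g \<le> r"
proof -
  have cmul: "(\<lambda>x. c * h x) \<in> L1_spectrum m \<Lambda>" if "h \<in> L1_spectrum m \<Lambda>" for c h
    using L1_subspace_L1_spectrum[OF s, of \<Lambda>] that by (auto simp: L1_subspace_def)
  have r: "0 \<le> r" using f(2)[of 0] order_trans[of 0 "L1_norm m (f 0)" r]
    by (simp add: L1_norm_def)
  have *: "g \<in> L1_spectrum m \<Lambda> \<and> L1_norm m g \<le> t" if t: "r < t" for t
  proof -
    have t0: "0 < t" using r t by simp
    have nrm: "L1_norm m (\<lambda>x. c * h x) = norm c * L1_norm m h" for c and h :: "'a \<Rightarrow> complex"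
      by (simp add: L1_norm_def norm_mult)
    define c where "c = complex_of_real (1 / t)"
    have nc: "norm c = 1 / t" using t0 by (simp add: c_def norm_divide)
    have "converges_in_measure m (\<lambda>n x. c * f n x) (\<lambda>x. c * g x)"
    proof (rule AE_tendsto_imp_converges_in_measure[OF fin])
      show "AE x in m. (\<lambda>n. c * f n x) \<longlonglongrightarrow> c * g x"
        using g(2) by eventually_elim (intro tendsto_mult tendsto_const)
      show "(\<lambda>x. c * f n x) \<in> borel_measurable m" for n
        using f(1)[of n] by (auto simp: L1_spectrum_def L1_space_def)
    qed (use g(1) in auto)
    moreover have "(\<lambda>x. c * f n x) \<in> {f \<in> L1_spectrum m \<Lambda>. L1_norm m f \<le> 1}" for n
    proof -
      have "L1_norm m (f n) / t \<le> 1" using f(2)[of n] t t0 by (simp add: divide_le_eq)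
      then show ?thesis using cmul[OF f(1), of c n] nrm[of c "f n"] nc by simp
    qed
    moreover have "(\<lambda>x. c * g x) \<in> borel_measurable m" using g(1) by simp
    ultimately have "(\<lambda>x. c * g x) \<in> {f \<in> L1_spectrum m \<Lambda>. L1_norm m f \<le> 1}"
      using np unfolding nicely_placed_def closed_in_measure_def
      by (elim allE[of _ "\<lambda>n x. c * f n x"] allE[of _ "\<lambda>x. c * g x"]) blast
    then have G: "(\<lambda>x. c * g x) \<in> L1_spectrum m \<Lambda>" "L1_norm m (\<lambda>x. c * g x) \<le> 1" by auto
    have "(\<lambda>x. of_real t * (c * g x)) = g" using t0 by (auto simp: c_def)
    then have "g \<in> L1_spectrum m \<Lambda>" using cmul[OF G(1), of "of_real t"] by simp
    moreover have "L1_norm m g \<le> t" using G(2) t0 by (simp add: nrm nc divide_simps)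
    ultimately show ?thesis by blast
  qed
  show "g \<in> L1_spectrum m \<Lambda>" using *[of "r + 1"] by simp
  show "L1_norm m g \<le> r" by (rule dense_ge) (use * in blast)
qed

section \<open>Uniform lifting\<close>

text \<open>Lifting uses no characters. What it takes from the spectral subspace is that almost
  everywhere limits of norm bounded sequences stay in it and obey the same norm bound.\<close>

locale measure_closed_subspace =
  fixes m :: "'a measure" and X :: "('a \<Rightarrow> complex) set" and A :: "'a set"
  assumes fin: "finite_measure m" and subspace: "L1_subspace m X" and A: "A \<in> sets m"
    and AE_closed: "\<And>f g r. (\<And>n::nat. f n \<in> X) \<Longrightarrow> (\<And>n. L1_norm m (f n) \<le> r) \<Longrightarrow>
      g \<in> borel_measurable m \<Longrightarrow> (AE x in m. (\<lambda>n. f n x) \<longlonglongrightarrow> g x) \<Longrightarrow> g \<in> X \<and> L1_norm m g \<le> r"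
begin

definition lifts :: "real \<Rightarrow> ('a \<Rightarrow> complex) \<Rightarrow> ('a \<Rightarrow> complex) set" where
  "lifts r g = {f \<in> X. L1_norm m f \<le> r \<and> (AE x in m. x \<in> A \<longrightarrow> f x = g x)}"

lemma X_integrable: "f \<in> X \<Longrightarrow> integrable m f"
  using subspace by (auto simp: L1_subspace_def L1_space_def)

lemma lifts_integrable: "f \<in> lifts r g \<Longrightarrow> integrable m f"
  by (simp add: lifts_def X_integrable)

lemma L1_norm_add:
  assumes "integrable m f" "integrable m g"
  shows "L1_norm m (\<lambda>x. f x + g x) \<le> L1_norm m f + L1_norm m g"
proof -
  have "(\<integral>x. norm (f x + g x) \<partial>m) \<le> (\<integral>x. norm (f x) + norm (g x) \<partial>m)"
    using assms by (intro integral_mono) (auto intro: norm_triangle_ineq)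
  then show ?thesis using assms by (simp add: L1_norm_def)
qed

lemma L1_norm_scale: "L1_norm m (\<lambda>x. c * f x) = norm c * L1_norm m f"
  by (simp add: L1_norm_def norm_mult)

lemma lifts_add:
  assumes "f \<in> lifts r g" "f' \<in> lifts r' g'"
  shows "(\<lambda>x. f x + f' x) \<in> lifts (r + r') (\<lambda>x. g x + g' x)"
proof -
  have "(\<lambda>x. f x + f' x) \<in> X" using assms subspace by (auto simp: lifts_def L1_subspace_def)
  moreover have "L1_norm m (\<lambda>x. f x + f' x) \<le> r + r'"
    using L1_norm_add[of f f'] assms lifts_integrable by (fastforce simp: lifts_def)
  moreover have "AE x in m. x \<in> A \<longrightarrow> f x + f' x = g x + g' x"
  proof -
    have "AE x in m. x \<in> A \<longrightarrow> f x = g x" "AE x in m. x \<in> A \<longrightarrow> f' x = g' x"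
      using assms by (auto simp: lifts_def)
    then show ?thesis by eventually_elim auto
  qed
  ultimately show ?thesis by (simp add: lifts_def)
qed

lemma lifts_scale:
  assumes "f \<in> lifts r g" shows "(\<lambda>x. c * f x) \<in> lifts (norm c * r) (\<lambda>x. c * g x)"
proof -
  have "(\<lambda>x. c * f x) \<in> X" using assms subspace by (auto simp: lifts_def L1_subspace_def)
  moreover have "L1_norm m (\<lambda>x. c * f x) \<le> norm c * r"
    using assms by (simp add: L1_norm_scale lifts_def mult_left_mono)
  moreover have "AE x in m. x \<in> A \<longrightarrow> c * f x = c * g x"
  proof -
    have "AE x in m. x \<in> A \<longrightarrow> f x = g x" using assms by (simp add: lifts_def)
    then show ?thesis by eventually_elim auto
  qed
  ultimately show ?thesis by (simp add: lifts_def)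
qed

lemma lifts_midpoint:
  assumes "f \<in> lifts r g" "f' \<in> lifts r g" shows "(\<lambda>x. (f x + f' x) / 2) \<in> lifts r g"
proof -
  have "(\<lambda>x. 1/2 * (f x + f' x)) \<in> lifts (norm (1/2 :: complex) * (r + r)) (\<lambda>x. 1/2 * (g x + g x))"
    by (intro lifts_scale lifts_add assms)
  then show ?thesis by simp
qed

lemma lifts_AE_limit:
  assumes f: "\<And>n::nat. f n \<in> lifts r g" and h: "h \<in> borel_measurable m"
    and lim: "AE x in m. (\<lambda>n. f n x) \<longlonglongrightarrow> h x"
  shows "h \<in> lifts r g"
proof -
  have "h \<in> X \<and> L1_norm m h \<le> r"
    by (rule AE_closed[OF _ _ h lim]) (use f in \<open>auto simp: lifts_def\<close>)
  moreover have "AE x in m. \<forall>n. x \<in> A \<longrightarrow> f n x = g x"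
    unfolding AE_all_countable using f by (auto simp: lifts_def)
  then have "AE x in m. x \<in> A \<longrightarrow> h x = g x" using lim
  proof eventually_elim
    case (elim x)
    show ?case
    proof
      assume "x \<in> A"
      then have "(\<lambda>n. f n x) = (\<lambda>n. g x)" using elim(1) by auto
      then show "h x = g x" using elim(2) LIMSEQ_unique tendsto_const by metis
    qed
  qed
  ultimately show ?thesis by (simp add: lifts_def)
qed

text \<open>
  The set of functions that lift with norm at most \<open>r\<close> is closed, because the unit ball of \<open>X\<close> is
  not only closed but convexly compact in measure.
\<close>
lemma lifts_closed:
  assumes g: "integrable m g"
    and approx: "\<And>e. 0 < e \<Longrightarrow> \<exists>h f. integrable m h \<and> (\<integral>x. norm (h x - g x) \<partial>m) \<le> e \<and> f \<in> lifts r h"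
  shows "lifts r g \<noteq> {}"
proof -
  let ?d = "\<lambda>f x. indicator A x * norm (f x - g x)"
  \<comment> \<open>Approximate lifts: an error of 2^-n on \<open>A\<close> is tolerated. The
    condition is convex, decreases with n and can be met by assumption, whereas solvability of the
    exact one is the claim.\<close>
  define P where "P n f \<longleftrightarrow> f \<in> X \<and> L1_norm m f \<le> r \<and> (\<integral>x. ?d f x \<partial>m) \<le> (1/2)^n" for n :: nat and f
  have id: "integrable m (?d f)" if "f \<in> X" for f
    using integrable_mult_indicator[OF A, of "\<lambda>x. norm (f x - g x)"] X_integrable[OF that] g by simp
  \<comment> \<open>A single function is sought: every coordinate carries the same condition and
    only coordinate 0 is used.\<close>
  define C :: "nat \<Rightarrow> (nat \<Rightarrow> 'a \<Rightarrow> complex) set" where "C n = {F. \<forall>i. P n (F i)}" for n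
  have "\<exists>F f. (\<forall>k. F k \<in> C k) \<and> (\<forall>i. f i \<in> borel_measurable m) \<and> (\<forall>i. AE x in m. (\<lambda>k. F k i x) \<longlonglongrightarrow> f i x)"
  proof (rule decreasing_convex_families_converge[OF fin])
    fix n
    obtain h f where hf: "integrable m h" "(\<integral>x. norm (h x - g x) \<partial>m) \<le> (1/2)^n" "f \<in> lifts r h"
      using approx[of "(1/2)^n"] by auto
    have fX: "f \<in> X" using hf(3) by (simp add: lifts_def)
    have "(\<integral>x. ?d f x \<partial>m) \<le> (\<integral>x. norm (h x - g x) \<partial>m)"
    proof (rule integral_mono_AE)
      have "AE x in m. x \<in> A \<longrightarrow> f x = h x" using hf(3) by (simp add: lifts_def)
      then show "AE x in m. ?d f x \<le> norm (h x - g x)" by eventually_elim (auto simp: indicator_def)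
    qed (use id[OF fX] hf(1) g in auto)
    then have "P n f" using hf by (auto simp: P_def lifts_def)
    then have "(\<lambda>_. f) \<in> C n" by (simp add: C_def)
    then show "C n \<noteq> {}" by blast
    show "C (Suc n) \<subseteq> C n"
    proof -
      have "(1/2 :: real) ^ Suc n \<le> (1/2) ^ n" by (rule power_decreasing) auto
      then have "P (Suc n) f \<Longrightarrow> P n f" for f unfolding P_def by (meson order_trans)
      then show ?thesis by (auto simp: C_def)
    qed
  next
    fix n F G assume FG: "F \<in> C n" "G \<in> C n"
    have "P n (\<lambda>x. (f x + f' x) / 2)" if ff: "P n f" "P n f'" for f f'
    proof -
      have X: "f \<in> X" "f' \<in> X" using ff by (auto simp: P_def)
      have "f \<in> lifts r f" "f' \<in> lifts r f'" using ff by (auto simp: P_def lifts_def)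
      then have "(\<lambda>x. 1/2 * (f x + f' x)) \<in> lifts (norm (1/2 :: complex) * (r + r)) (\<lambda>x. 1/2 * (f x + f' x))"
        by (intro lifts_scale lifts_add)
      then have *: "(\<lambda>x. (f x + f' x) / 2) \<in> X" "L1_norm m (\<lambda>x. (f x + f' x) / 2) \<le> r"
        by (auto simp: lifts_def)
      have "(\<integral>x. ?d (\<lambda>x. (f x + f' x) / 2) x \<partial>m) \<le> (\<integral>x. (?d f x + ?d f' x) / 2 \<partial>m)"
      proof (rule integral_mono)
        fix x
        have "(f x + f' x) / 2 - g x = ((f x - g x) + (f' x - g x)) / 2" by (simp add: field_simps)
        then have nrm: "norm ((f x + f' x) / 2 - g x) = norm ((f x - g x) + (f' x - g x)) / 2"
          by (simp only: norm_divide) simp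
        have "norm ((f x + f' x) / 2 - g x) \<le> (norm (f x - g x) + norm (f' x - g x)) / 2"
          unfolding nrm by (rule divide_right_mono[OF norm_triangle_ineq]) simp
        then show "?d (\<lambda>x. (f x + f' x) / 2) x \<le> (?d f x + ?d f' x) / 2"
          by (auto simp: indicator_def)
      qed (use id[OF *(1)] id[OF X(1)] id[OF X(2)] in auto)
      also have "\<dots> \<le> (1/2)^n"
        using ff id[OF X(1)] id[OF X(2)] by (simp add: P_def)
      finally show ?thesis using * by (simp add: P_def)
    qed
    then show "(\<lambda>i x. (F i x + G i x) / 2) \<in> C n" using FG by (simp add: C_def)
  next
    fix F i assume "F \<in> C 0"
    then have "P 0 (F i)" by (simp add: C_def)
    then show "integrable m (F i)" "(\<integral>x. norm (F i x) \<partial>m) \<le> r"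
      by (auto simp: P_def X_integrable L1_norm_def)
  qed
  then obtain F f where F: "\<And>k. F k \<in> C k" "\<And>i. f i \<in> borel_measurable m"
    "\<And>i. AE x in m. (\<lambda>k. F k i x) \<longlonglongrightarrow> f i x" by blast
  have PF: "P k (F k 0)" for k using F(1)[of k] by (simp add: C_def)
  have fX: "f 0 \<in> X \<and> L1_norm m (f 0) \<le> r"
    by (rule AE_closed[of "\<lambda>k. F k 0"]) (use PF F in \<open>auto simp: P_def\<close>)
  \<comment> \<open>The errors on \<open>A\<close> have summable integrals, so the approximate lifts
    tend to g there almost everywhere and their limit is an exact lift.\<close>
  have "AE x in m. summable (\<lambda>k. ?d (F k 0) x)"
  proof (rule AE_summable_of_integrals)
    show "summable (\<lambda>k. \<integral>x. ?d (F k 0) x \<partial>m)"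
    proof (rule summable_comparison_test)
      show "summable (\<lambda>k. (1/2::real)^k)" by simp
      show "\<exists>N. \<forall>k\<ge>N. norm (\<integral>x. ?d (F k 0) x \<partial>m) \<le> (1/2)^k"
        using PF by (intro exI[of _ 0]) (simp add: P_def)
    qed
  qed (use id PF in \<open>auto simp: P_def\<close>)
  then have "AE x in m. x \<in> A \<longrightarrow> f 0 x = g x" using F(3)[of 0]
  proof eventually_elim
    case (elim x)
    show ?case
    proof
      assume x: "x \<in> A"
      have "(\<lambda>k. norm (F k 0 x - g x)) \<longlonglongrightarrow> 0" using summable_LIMSEQ_zero[OF elim(1)] x by simp
      then have "(\<lambda>k. F k 0 x) \<longlonglongrightarrow> g x" by (simp add: tendsto_norm_zero_iff LIM_zero_iff)
      then show "f 0 x = g x" using elim(2) LIMSEQ_unique by blast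
    qed
  qed
  then show ?thesis using fX by (auto simp: lifts_def)
qed

lemma lifts_exact:
  assumes onto: "\<forall>g\<in>L1_on m A. \<exists>f\<in>X. AE x in m. restriction_op A f x = g x"
    and g: "g \<in> L1_on m A"
  shows "\<exists>f r. 0 \<le> r \<and> f \<in> lifts r g"
proof -
  obtain f where f: "f \<in> X" "AE x in m. restriction_op A f x = g x" using onto g by blast
  have "AE x in m. x \<in> A \<longrightarrow> f x = g x"
    using f(2) by eventually_elim (auto simp: restriction_op_def)
  then have "f \<in> lifts (L1_norm m f) g" using f(1) by (simp add: lifts_def)
  moreover have "0 \<le> L1_norm m f" by (simp add: L1_norm_def)
  ultimately show ?thesis by blast
qed

lemma lifts_indicator_null:
  assumes "I \<in> sets m" "measure m I = 0" shows "(\<lambda>_. 0) \<in> lifts 0 (indicator I)"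
proof -
  interpret finite_measure m by (rule fin)
  have "AE x in m. x \<notin> I" using assms by (intro AE_not_in) (simp add: null_sets_def emeasure_eq_measure)
  then have "AE x in m. x \<in> A \<longrightarrow> 0 = (indicator I x :: complex)" by eventually_elim simp
  moreover have "(\<lambda>_. 0) \<in> X" using subspace by (simp add: L1_subspace_def)
  ultimately show ?thesis by (simp add: lifts_def L1_norm_def)
qed

text \<open>The step of Baire's argument. If S has a lift of norm q and S + a 1_I one of norm n,
  their difference divided by a lifts the indicator of I with norm (n + q)/a; a set I that lifts
  badly excludes this. So arbitrarily near S there is a ball whose members do not lift with norm
  n.\<close>

lemma unliftable_perturbation:
  assumes onto: "\<forall>g\<in>L1_on m A. \<exists>f\<in>X. AE x in m. restriction_op A f x = g x"
    and unbounded: "\<forall>M\<ge>0. \<exists>I\<in>sets m. I \<subseteq> A \<and> lifts (M * measure m I) (indicator I) = {}"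
    and S: "integrable m S" "\<forall>x. x \<notin> A \<longrightarrow> S x = 0" and d: "0 < d"
  shows "\<exists>S' d'. integrable m S' \<and> (\<forall>x. x \<notin> A \<longrightarrow> S' x = 0) \<and> 0 < d' \<and> d' \<le> d / 2 \<and>
    (\<integral>x. norm (S' x - S x) \<partial>m) \<le> d / 2 \<and>
    (\<forall>h. integrable m h \<longrightarrow> (\<integral>x. norm (h x - S' x) \<partial>m) \<le> d' \<longrightarrow> lifts (real n) h = {})"
proof -
  interpret finite_measure m by (rule fin)
  have "S \<in> L1_on m A" using S by (simp add: L1_on_def L1_space_def)
  then obtain f q where f: "0 \<le> q" "f \<in> lifts q S" using lifts_exact[OF onto] by blast
  \<comment> \<open>Chosen so that (n + q)/a = M m(I) for the amplitude \<open>a\<close> below, for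
    which the perturbation a 1_I has norm d/2.\<close>
  define M where "M = (real n + q) * 2 / d"
  have "0 \<le> M" using f d by (simp add: M_def)
  then obtain I where I: "I \<in> sets m" "I \<subseteq> A" "lifts (M * measure m I) (indicator I) = {}"
    using unbounded by blast
  have mI: "0 < measure m I"
  proof (rule ccontr)
    assume "\<not> 0 < measure m I"
    then have 0: "measure m I = 0" using measure_nonneg[of m I] by linarith
    then show False using lifts_indicator_null[OF I(1) 0] I(3) by simp
  qed
  define a where "a = d / (2 * measure m I)"
  have a: "0 < a" using d mI by (simp add: a_def)
  define S' where "S' x = S x + of_real a * indicator I x" for x
  have iI: "integrable m (\<lambda>x. complex_of_real a * indicator I x)"
    by (rule integrable_const_bound[where B=a])
       (use I(1) a in \<open>auto simp: indicator_def intro!: borel_measurable_times borel_measurable_indicator\<close>)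
  have S': "integrable m S'" unfolding S'_def using S(1) iI by (rule Bochner_Integration.integrable_add)
  have "(\<integral>x. norm (S' x - S x) \<partial>m) = (\<integral>x. a * indicator I x \<partial>m)"
    using a by (intro Bochner_Integration.integral_cong) (auto simp: S'_def indicator_def)
  also have "\<dots> = d / 2" using I(1) mI by (simp add: a_def)
  finally have nS: "(\<integral>x. norm (S' x - S x) \<partial>m) \<le> d / 2" by simp
  have "lifts (real n) S' = {}"
  proof (rule ccontr)
    assume "lifts (real n) S' \<noteq> {}"
    then obtain f' where f': "f' \<in> lifts (real n) S'" by blast
    let ?c = "complex_of_real (1 / a)"
    have "(\<lambda>x. ?c * (f' x + (-1) * f x)) \<in> lifts (norm ?c * (real n + norm (-1 :: complex) * q)) (\<lambda>x. ?c * (S' x + (-1) * S x))"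
      by (intro lifts_scale lifts_add f f')
    moreover have "(\<lambda>x. ?c * (S' x + (-1) * S x)) = indicator I"
      using a by (auto simp: S'_def)
    moreover have "norm ?c * (real n + norm (-1 :: complex) * q) = M * measure m I"
      using a mI d by (simp add: norm_divide M_def a_def)
    ultimately show False using I(3) by auto
  qed
  \<comment> \<open>If functions arbitrarily close to S' lifted with norm n, so would S' itself, by
    \<open>lifts_closed\<close>; hence a whole ball fails.\<close>
  then obtain e where e: "0 < e"
    "\<And>h. integrable m h \<Longrightarrow> (\<integral>x. norm (h x - S' x) \<partial>m) \<le> e \<Longrightarrow> lifts (real n) h = {}"
    using lifts_closed[OF S', of "real n"] by blast
  show ?thesis
  proof (intro exI conjI allI impI)
    show "integrable m S'" by (rule S')
    show "S' x = 0" if "x \<notin> A" for x using that S(2)[rule_format, OF that] I(2) by (auto simp: S'_def indicator_def)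
    show "0 < min e (d/2)" "min e (d/2) \<le> d/2" using e d by auto
    show "(\<integral>x. norm (S' x - S x) \<partial>m) \<le> d / 2" by (rule nS)
    show "lifts (real n) h = {}" if "integrable m h" "(\<integral>x. norm (h x - S' x) \<partial>m) \<le> min e (d/2)" for h
      using e(2)[OF that(1)] that(2) by simp
  qed
qed

text \<open>Every g in L1(A) lifts with some norm, so the closed sets of functions that lift with
  norm n cover the space. If no bound were linear in m(I), one could nest balls with centres
  \<open>S n\<close> and radii \<open>d n\<close> so that nothing in the n-th lifts with norm n, and
  their common point would not lift at all.\<close>

lemma uniform_lifting:
  assumes onto: "\<forall>g\<in>L1_on m A. \<exists>f\<in>X. AE x in m. restriction_op A f x = g x"
  shows "\<exists>M\<ge>0. \<forall>I\<in>sets m. I \<subseteq> A \<longrightarrow> lifts (M * measure m I) (indicator I) \<noteq> {}"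
proof (rule ccontr)
  assume "\<not> ?thesis"
  then have unbounded: "\<forall>M\<ge>0. \<exists>I\<in>sets m. I \<subseteq> A \<and> lifts (M * measure m I) (indicator I) = {}"
    by blast
  define inv where "inv n Sd \<longleftrightarrow> integrable m (fst Sd) \<and> (\<forall>x. x \<notin> A \<longrightarrow> fst Sd x = 0) \<and> 0 < snd Sd \<and>
     (0 < n \<longrightarrow> (\<forall>h. integrable m h \<longrightarrow> (\<integral>x. norm (h x - fst Sd x) \<partial>m) \<le> snd Sd \<longrightarrow> lifts (real n) h = {}))"
    for n and Sd :: "('a \<Rightarrow> complex) \<times> real"
  define stp where "stp Sd Sd' \<longleftrightarrow> snd Sd' \<le> snd Sd / 2 \<and> (\<integral>x. norm (fst Sd' x - fst Sd x) \<partial>m) \<le> snd Sd / 2"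
    for Sd Sd' :: "('a \<Rightarrow> complex) \<times> real"
  have "\<exists>f. \<forall>n. inv n (f n) \<and> stp (f n) (f (Suc n))"
  proof (rule dependent_nat_choice)
    show "\<exists>x. inv 0 x" by (rule exI[of _ "(\<lambda>_. 0, 1)"]) (simp add: inv_def)
    fix Sd n assume i: "inv n Sd"
    from i have i': "integrable m (fst Sd)" "\<forall>x. x \<notin> A \<longrightarrow> fst Sd x = 0" "0 < snd Sd" by (auto simp: inv_def)
    obtain S' d' where "integrable m S' \<and> (\<forall>x. x \<notin> A \<longrightarrow> S' x = 0) \<and> 0 < d' \<and> d' \<le> snd Sd / 2 \<and>
      (\<integral>x. norm (S' x - fst Sd x) \<partial>m) \<le> snd Sd / 2 \<and>
      (\<forall>h. integrable m h \<longrightarrow> (\<integral>x. norm (h x - S' x) \<partial>m) \<le> d' \<longrightarrow> lifts (real (Suc n)) h = {})"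
      using unliftable_perturbation[OF onto unbounded i', of "Suc n"] by (elim exE)
    then show "\<exists>y. inv (Suc n) y \<and> stp Sd y"
      by (intro exI[of _ "(S', d')"]) (simp add: inv_def stp_def)
  qed
  then obtain Z where Z: "\<And>n. inv n (Z n)" "\<And>n. stp (Z n) (Z (Suc n))" by blast
  define S where "S n = fst (Z n)" for n
  define d where "d n = snd (Z n)" for n
  have S: "integrable m (S n)" "x \<notin> A \<Longrightarrow> S n x = 0" "0 < d n" for n x
    using Z(1)[of n] by (auto simp: inv_def S_def d_def)
  have bad: "lifts (real n) h = {}" if "0 < n" "integrable m h" "(\<integral>x. norm (h x - S n x) \<partial>m) \<le> d n" for n h
    using Z(1)[of n] that by (auto simp: inv_def S_def d_def)
  have stp: "d (Suc n) \<le> d n / 2" "(\<integral>x. norm (S (Suc n) x - S n x) \<partial>m) \<le> d n / 2" for n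
    using Z(2)[of n] by (auto simp: stp_def S_def d_def)
  have dk: "d n \<le> d 0 * (1/2)^n" for n
  proof (induction n)
    case (Suc n) then show ?case using stp(1)[of n] by simp
  qed simp
  \<comment> \<open>A step moves the centre by at most d n / 2, and the radius drops by at least as
    much, so the distances telescope.\<close>
  have dist: "(\<integral>x. norm (S (n + k) x - S n x) \<partial>m) \<le> d n - d (n + k)" for n k
  proof (induction k)
    case (Suc k)
    have "(\<integral>x. norm (S (n + Suc k) x - S n x) \<partial>m) \<le>
       (\<integral>x. norm (S (Suc (n + k)) x - S (n + k) x) + norm (S (n + k) x - S n x) \<partial>m)"
    proof (rule integral_mono)
      fix x
      have "S (n + Suc k) x - S n x = (S (Suc (n + k)) x - S (n + k) x) + (S (n + k) x - S n x)" by simp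
      then show "norm (S (n + Suc k) x - S n x) \<le> norm (S (Suc (n + k)) x - S (n + k) x) + norm (S (n + k) x - S n x)"
        by (metis norm_triangle_ineq)
    qed (use S(1) in auto)
    also have "\<dots> = (\<integral>x. norm (S (Suc (n + k)) x - S (n + k) x) \<partial>m) + (\<integral>x. norm (S (n + k) x - S n x) \<partial>m)"
      using S(1) by (intro Bochner_Integration.integral_add) auto
    also have "\<dots> \<le> d n - d (n + Suc k)"
      using Suc stp(1)[of "n + k"] stp(2)[of "n + k"] by simp
    finally show ?case .
  qed simp
  have "AE x in m. summable (\<lambda>k. norm (S (Suc k) x - S k x))"
  proof (rule AE_summable_of_integrals)
    show "summable (\<lambda>k. \<integral>x. norm (S (Suc k) x - S k x) \<partial>m)"
    proof (rule summable_comparison_test)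
      show "summable (\<lambda>k. d 0 * (1/2)^k)" by (intro summable_mult summable_geometric) simp
      have "norm (\<integral>x. norm (S (Suc k) x - S k x) \<partial>m) \<le> d 0 * (1/2)^k" for k
        using stp(2)[of k] dk[of k] S(3)[of k] by simp
      then show "\<exists>N. \<forall>k\<ge>N. norm (\<integral>x. norm (S (Suc k) x - S k x) \<partial>m) \<le> d 0 * (1/2)^k" by blast
    qed
  qed (use S(1) in auto)
  then have conv: "AE x in m. convergent (\<lambda>k. S k x)"
  proof eventually_elim
    case (elim x)
    then have "summable (\<lambda>k. S (Suc k) x - S k x)" by (rule summable_norm_cancel)
    then show ?case
      using convergent_diff_const_right_iff[of "\<lambda>k. S k x" "S 0 x"]
      by (simp add: summable_iff_convergent sum_lessThan_telescope[of "\<lambda>k. S k x"])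
  qed
  define g where "g x = lim (\<lambda>k. S k x)" for x
  have gm: "g \<in> borel_measurable m" unfolding g_def
    by (rule borel_measurable_lim_metric) (use S(1) in auto)
  \<comment> \<open>Fatou's lemma in k keeps the limit g in each of the closed balls.\<close>
  have gd: "(\<integral>\<^sup>+x. norm (g x - S n x) \<partial>m) \<le> ennreal (d n)" for n
  proof -
    have "(\<integral>\<^sup>+x. norm (g x - S n x) \<partial>m) = (\<integral>\<^sup>+x. liminf (\<lambda>k. ennreal (norm (S (n + k) x - S n x))) \<partial>m)"
    proof (rule nn_integral_cong_AE)
      show "AE x in m. ennreal (norm (g x - S n x)) = liminf (\<lambda>k. ennreal (norm (S (n + k) x - S n x)))"
        using conv
      proof eventually_elim
        case (elim x)
        then have "(\<lambda>k. S k x) \<longlonglongrightarrow> g x" by (simp add: g_def convergent_LIMSEQ_iff)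
        then have "(\<lambda>k. S (n + k) x) \<longlonglongrightarrow> g x" using LIMSEQ_ignore_initial_segment[of _ _ n] by (simp add: add.commute)
        then have "(\<lambda>k. ennreal (norm (S (n + k) x - S n x))) \<longlonglongrightarrow> ennreal (norm (g x - S n x))"
          by (intro tendsto_ennrealI tendsto_norm tendsto_diff tendsto_const)
        then show ?case by (rule lim_imp_Liminf[OF sequentially_bot, symmetric])
      qed
    qed
    also have "\<dots> \<le> liminf (\<lambda>k. \<integral>\<^sup>+x. ennreal (norm (S (n + k) x - S n x)) \<partial>m)"
      by (rule nn_integral_liminf) (use S(1) in auto)
    also have "\<dots> \<le> limsup (\<lambda>k. \<integral>\<^sup>+x. ennreal (norm (S (n + k) x - S n x)) \<partial>m)"
      by (rule Liminf_le_Limsup) simp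
    also have "\<dots> \<le> ennreal (d n)"
    proof (rule Limsup_bounded, rule always_eventually, rule allI)
      fix k
      have "(\<integral>\<^sup>+x. ennreal (norm (S (n + k) x - S n x)) \<partial>m) = ennreal (\<integral>x. norm (S (n + k) x - S n x) \<partial>m)"
        by (rule nn_integral_eq_integral) (use S(1) in auto)
      also have "\<dots> \<le> ennreal (d n)" using dist[of n k] S(3)[of "n + k"] by (intro ennreal_leI) linarith
      finally show "(\<integral>\<^sup>+x. ennreal (norm (S (n + k) x - S n x)) \<partial>m) \<le> ennreal (d n)" .
    qed
    finally show ?thesis .
  qed
  have idiff: "integrable m (\<lambda>x. g x - S n x)" for n
    using gm S(1)[of n] gd[of n] by (intro integrableI_bounded) (auto simp: less_top[symmetric] top_unique)
  have gi: "integrable m g"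
    using Bochner_Integration.integrable_add[OF idiff[of 0] S(1)[of 0]] by simp
  have gdist: "(\<integral>x. norm (g x - S n x) \<partial>m) \<le> d n" for n
  proof -
    have "ennreal (\<integral>x. norm (g x - S n x) \<partial>m) \<le> ennreal (d n)"
      using gd[of n] idiff[of n] by (subst nn_integral_eq_integral[symmetric]) auto
    then show ?thesis using S(3)[of n] by simp
  qed
  have "g x = 0" if "x \<notin> A" for x using S(2)[OF that] by (simp add: g_def)
  then have "g \<in> L1_on m A" using gi by (simp add: L1_on_def L1_space_def)
  then obtain f r where f: "f \<in> lifts r g" using lifts_exact[OF onto] by blast
  obtain k where k: "r < real k" using reals_Archimedean2 by blast
  have "f \<in> lifts (real (Suc k)) g" using f k by (auto simp: lifts_def)
  then show False using bad[of "Suc k" g] gi gdist[of "Suc k"] by simp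
qed

end

section \<open>Additive lifting along a tree of sets\<close>

context measure_closed_subspace
begin

lemma lifts_AE_cong:
  assumes f: "f \<in> lifts r g" and f': "f' \<in> borel_measurable m" and ae: "AE x in m. f x = f' x"
  shows "f' \<in> lifts r g"
proof -
  have i: "integrable m f" by (rule lifts_integrable[OF f])
  have i': "integrable m f'" using i f' ae by (rule integrable_cong_AE_imp) 
  have "f' \<in> X" using subspace f i' ae by (auto simp: L1_subspace_def lifts_def L1_space_def)
  moreover have "L1_norm m f' = L1_norm m f"
    unfolding L1_norm_def using ae i i' by (intro integral_cong_AE) auto
  moreover have "AE x in m. x \<in> A \<longrightarrow> f x = g x" using f by (simp add: lifts_def)
  then have "AE x in m. x \<in> A \<longrightarrow> f' x = g x" using ae by eventually_elim auto
  ultimately show ?thesis using f by (simp add: lifts_def)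
qed

context
  fixes I :: "bool list \<Rightarrow> 'a set" and M :: real
  assumes I: "\<And>s. I s \<in> sets m" "\<And>s. I s \<subseteq> A"
    and split: "\<And>s. I s = I (s @ [False]) \<union> I (s @ [True])" "\<And>s. I (s @ [False]) \<inter> I (s @ [True]) = {}"
    and M: "0 \<le> M" "\<And>s. lifts (M * measure m (I s)) (indicator (I s)) \<noteq> {}"
begin

definition tree_lifts :: "bool list \<Rightarrow> ('a \<Rightarrow> complex) set" where
  "tree_lifts s = lifts (M * measure m (I s)) (indicator (I s))"

lemma tree_measure: "measure m (I s) = measure m (I (s @ [False])) + measure m (I (s @ [True]))"
proof -
  interpret finite_measure m by (rule fin)
  show ?thesis using finite_measure_Union[OF I(1) I(1) split(2)[of s]] split(1)[of s] by simp
qed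

lemma tree_lifts_join:
  assumes "f \<in> tree_lifts (s @ [False])" "f' \<in> tree_lifts (s @ [True])"
  shows "(\<lambda>x. f x + f' x) \<in> tree_lifts s"
proof -
  have "(indicator (I s) :: 'a \<Rightarrow> complex) = (\<lambda>x. indicator (I (s @ [False])) x + indicator (I (s @ [True])) x)"
    using split[of s] by (auto simp: indicator_def fun_eq_iff)
  then show ?thesis
    using lifts_add[OF assms[unfolded tree_lifts_def]] tree_measure[of s]
    by (simp add: tree_lifts_def distrib_left)
qed

text \<open>Choosing lifts from the root downwards spoils the norm bound, since a child obtained as
  a difference of lifts inherits the sum of two bounds. Summing upwards from depth n keeps the bound
  but gives additivity only above depth n. These conditions are convex and decrease with n, so a
  limit satisfies all of them.\<close>

lemma additive_lifting_AE:
  "\<exists>\<Phi>. (\<forall>s. \<Phi> s \<in> tree_lifts s) \<and> (\<forall>s. AE x in m. \<Phi> s x = \<Phi> (s @ [False]) x + \<Phi> (s @ [True]) x)"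
proof -
  interpret finite_measure m by (rule fin)
  define node :: "nat \<Rightarrow> bool list" where "node = from_nat"
  define additive where "additive F s \<longleftrightarrow>
      (AE x in m. F (to_nat s) x = F (to_nat (s @ [False])) x + F (to_nat (s @ [True])) x)"
    for F :: "nat \<Rightarrow> 'a \<Rightarrow> complex" and s :: "bool list"
  define C where "C n = {F. (\<forall>i. F i \<in> tree_lifts (node i)) \<and> (\<forall>s. length s < n \<longrightarrow> additive F s)}" for n
  have "\<exists>F f. (\<forall>k. F k \<in> C k) \<and> (\<forall>i. f i \<in> borel_measurable m) \<and> (\<forall>i. AE x in m. (\<lambda>k. F k i x) \<longlonglongrightarrow> f i x)"
  proof (rule decreasing_convex_families_converge[OF fin])
    fix n
    have "\<exists>f. f \<in> tree_lifts s" for s using M(2)[of s] unfolding tree_lifts_def by blast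
    then obtain \<psi> where \<psi>: "\<And>s. \<psi> s \<in> tree_lifts s" by metis
    \<comment> \<open>\<open>R k s\<close> sums the chosen lifts over the descendants of s that lie
      k levels below.\<close>
    define R where "R = rec_nat \<psi> (\<lambda>_ r s x. r (s @ [False]) x + r (s @ [True]) x)"
    have R0: "R 0 = \<psi>" and RS: "R (Suc k) s = (\<lambda>x. R k (s @ [False]) x + R k (s @ [True]) x)" for k s
      by (simp_all add: R_def)
    have R: "R k s \<in> tree_lifts s" for k s
    proof (induction k arbitrary: s)
      case 0 show ?case unfolding R0 by (rule \<psi>)
    next
      case (Suc k) show ?case unfolding RS by (intro tree_lifts_join Suc)
    qed
    \<comment> \<open>Nodes at depth n or deeper keep their own lift, the truncated difference being
      0.\<close>
    define F where "F i = R (n - length (node i)) (node i)" for i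
    have Fs: "F (to_nat s) = R (n - length s) s" for s by (simp add: F_def node_def)
    have "additive F s" if "length s < n" for s
    proof -
      have "n - length s = Suc (n - Suc (length s))" using that by simp
      then show ?thesis unfolding additive_def Fs by (simp add: RS)
    qed
    then have "F \<in> C n" using R by (simp add: C_def F_def)
    then show "C n \<noteq> {}" by blast
    show "C (Suc n) \<subseteq> C n" by (auto simp: C_def)
  next
    fix n F G assume FG: "F \<in> C n" "G \<in> C n"
    have "(\<lambda>x. (F i x + G i x) / 2) \<in> tree_lifts (node i)" for i
      using FG lifts_midpoint by (simp add: C_def tree_lifts_def)
    moreover have "additive (\<lambda>i x. (F i x + G i x) / 2) s" if "length s < n" for s
    proof -
      have "additive F s" "additive G s" using FG that by (auto simp: C_def)
      then show ?thesis unfolding additive_def by eventually_elim (simp add: add_divide_distrib)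
    qed
    ultimately show "(\<lambda>i x. (F i x + G i x) / 2) \<in> C n" by (simp add: C_def)
  next
    fix F i assume "F \<in> C 0"
    then have F: "F i \<in> tree_lifts (node i)" by (simp add: C_def)
    then show "integrable m (F i)" unfolding tree_lifts_def by (rule lifts_integrable)
    have "(\<integral>x. norm (F i x) \<partial>m) \<le> M * measure m (I (node i))"
      using F by (simp add: tree_lifts_def lifts_def L1_norm_def)
    also have "\<dots> \<le> M * measure m (space m)" by (intro mult_left_mono bounded_measure M(1))
    finally show "(\<integral>x. norm (F i x) \<partial>m) \<le> M * measure m (space m)" .
  qed
  then obtain F f where F: "\<And>k. F k \<in> C k" and f: "\<And>i. f i \<in> borel_measurable m"
    and lim: "\<And>i. AE x in m. (\<lambda>k. F k i x) \<longlonglongrightarrow> f i x" by blast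
  have L: "f (to_nat s) \<in> tree_lifts s" for s :: "bool list"
    unfolding tree_lifts_def
  proof (rule lifts_AE_limit[OF _ f lim])
    show "F n (to_nat s) \<in> lifts (M * measure m (I s)) (indicator (I s))" for n
    proof -
      have "F n (to_nat s) \<in> tree_lifts (node (to_nat s))" using F[of n] by (simp add: C_def)
      then show ?thesis by (simp add: node_def tree_lifts_def)
    qed
  qed
  have "AE x in m. f (to_nat s) x = f (to_nat (s @ [False])) x + f (to_nat (s @ [True])) x" for s :: "bool list"
  proof -
    have "AE x in m. \<forall>n. length s < n \<longrightarrow> F n (to_nat s) x = F n (to_nat (s @ [False])) x + F n (to_nat (s @ [True])) x"
    proof (subst AE_all_countable, rule allI)
      fix n show "AE x in m. length s < n \<longrightarrow> F n (to_nat s) x = F n (to_nat (s @ [False])) x + F n (to_nat (s @ [True])) x"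
        using F[of n] by (cases "length s < n") (auto simp: C_def additive_def)
    qed
    then show ?thesis using lim[of "to_nat s"] lim[of "to_nat (s @ [False])"] lim[of "to_nat (s @ [True])"]
    proof eventually_elim
      case (elim x)
      have "(\<lambda>n. F n (to_nat (s @ [False])) x + F n (to_nat (s @ [True])) x) \<longlonglongrightarrow>
          f (to_nat (s @ [False])) x + f (to_nat (s @ [True])) x"
        by (intro tendsto_add elim)
      moreover have "\<forall>\<^sub>F n in sequentially. F n (to_nat (s @ [False])) x + F n (to_nat (s @ [True])) x = F n (to_nat s) x"
        using eventually_gt_at_top[of "length s"] by eventually_elim (use elim(1) in simp)
      ultimately have "(\<lambda>n. F n (to_nat s) x) \<longlonglongrightarrow> f (to_nat (s @ [False])) x + f (to_nat (s @ [True])) x"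
        by (rule Lim_transform_eventually)
      then show ?case using elim(2) LIMSEQ_unique by blast
    qed
  qed
  then show ?thesis using L by (intro exI[of _ "\<lambda>s. f (to_nat s)"]) blast
qed

text \<open>There are countably many nodes, so one null set contains all exceptions; setting every
  lift to 0 on it makes the identity hold everywhere.\<close>

lemma additive_lifting:
  "\<exists>\<Phi>. (\<forall>s. \<Phi> s \<in> tree_lifts s) \<and> (\<forall>s x. \<Phi> s x = \<Phi> (s @ [False]) x + \<Phi> (s @ [True]) x)"
proof -
  obtain \<Psi> where \<Psi>: "\<And>s. \<Psi> s \<in> tree_lifts s"
    "\<And>s. AE x in m. \<Psi> s x = \<Psi> (s @ [False]) x + \<Psi> (s @ [True]) x" using additive_lifting_AE by blast
  have "AE x in m. \<forall>s. \<Psi> s x = \<Psi> (s @ [False]) x + \<Psi> (s @ [True]) x"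
    using \<Psi>(2) by (simp add: AE_all_countable)
  then obtain N where N: "{x \<in> space m. \<not> (\<forall>s. \<Psi> s x = \<Psi> (s @ [False]) x + \<Psi> (s @ [True]) x)} \<subseteq> N"
    "N \<in> null_sets m" unfolding eventually_ae_filter by blast
  define \<Phi> where "\<Phi> s x = indicator (space m - N) x * \<Psi> s x" for s x
  have Nm: "space m - N \<in> sets m" using N(2) by auto
  have ae: "AE x in m. \<Psi> s x = \<Phi> s x" for s
    using AE_not_in[OF N(2)] AE_space by eventually_elim (simp add: \<Phi>_def)
  have "\<Phi> s \<in> tree_lifts s" for s
    unfolding tree_lifts_def
  proof (rule lifts_AE_cong[OF \<Psi>(1)[unfolded tree_lifts_def] _ ae])
    have "\<Psi> s \<in> borel_measurable m"
      using lifts_integrable[OF \<Psi>(1)[of s, unfolded tree_lifts_def]] by simp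
    then show "\<Phi> s \<in> borel_measurable m"
      unfolding \<Phi>_def[abs_def] using Nm by (intro borel_measurable_times borel_measurable_indicator)
  qed
  moreover have "\<Phi> s x = \<Phi> (s @ [False]) x + \<Phi> (s @ [True]) x" for s x
  proof (cases "x \<in> space m - N")
    case True
    then have "\<Psi> s x = \<Psi> (s @ [False]) x + \<Psi> (s @ [True]) x" using N(1) by blast
    then show ?thesis by (simp add: \<Phi>_def distrib_left)
  qed (simp add: \<Phi>_def)
  ultimately show ?thesis by blast
qed

text \<open>
  \<open>H s\<close> is the modulus of the vector measure \<open>s \<mapsto> \<Phi> s\<close>, the supremum over refinements of the sum
  of the absolute values.
\<close>
lemma additive_lifting_with_modulus:
  "\<exists>\<Phi> H. (\<forall>s. \<Phi> s \<in> tree_lifts s) \<and> (\<forall>s. H s \<in> borel_measurable m) \<and>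
     (\<forall>s x. H s x = H (s @ [False]) x + H (s @ [True]) x) \<and>
     (\<forall>s x. ennreal (norm (\<Phi> s x)) \<le> H s x) \<and> (\<forall>s. (\<integral>\<^sup>+x. H s x \<partial>m) \<le> ennreal (M * measure m (I s)))"
proof -
  obtain \<Phi> where \<Phi>: "\<And>s. \<Phi> s \<in> tree_lifts s" "\<And>s x. \<Phi> s x = \<Phi> (s @ [False]) x + \<Phi> (s @ [True]) x"
    using additive_lifting by blast
  have int: "integrable m (\<Phi> s)" for s
    using \<Phi>(1)[of s] unfolding tree_lifts_def by (rule lifts_integrable)
  \<comment> \<open>\<open>h n s\<close> adds the absolute values over the descendants n levels
    below s. The triangle inequality makes it increase with n, and additivity of M m(I s) bounds its
    integral uniformly in n.\<close>
  define h :: "nat \<Rightarrow> bool list \<Rightarrow> 'a \<Rightarrow> ennreal" where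
    "h = rec_nat (\<lambda>s x. ennreal (norm (\<Phi> s x))) (\<lambda>_ r s x. r (s @ [False]) x + r (s @ [True]) x)"
  have h0: "h 0 s x = ennreal (norm (\<Phi> s x))"
    and hS: "h (Suc n) s x = h n (s @ [False]) x + h n (s @ [True]) x" for n s x by (simp_all add: h_def)
  have hm: "h n s \<in> borel_measurable m" for n s
  proof (induction n arbitrary: s)
    case 0 then show ?case using int[of s] unfolding h0[abs_def] by (intro measurable_compose[OF _ measurable_ennreal]) auto
  next
    case (Suc n) then show ?case unfolding hS[abs_def] by (intro borel_measurable_add)
  qed
  have hmono: "h n s x \<le> h (Suc n) s x" for n s x
  proof (induction n arbitrary: s)
    case 0
    have "norm (\<Phi> s x) \<le> norm (\<Phi> (s @ [False]) x) + norm (\<Phi> (s @ [True]) x)"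
      unfolding \<Phi>(2)[of s x] by (rule norm_triangle_ineq)
    then show ?case unfolding hS h0 by (simp flip: ennreal_plus add: ennreal_leI)
  next
    case (Suc n) show ?case unfolding hS[of "Suc n"] hS[of n s] by (intro add_mono Suc)
  qed
  have inc: "incseq (\<lambda>n. h n s x)" for s x by (rule incseq_SucI) (rule hmono)
  have hint: "(\<integral>\<^sup>+x. h n s x \<partial>m) \<le> ennreal (M * measure m (I s))" for n s
  proof (induction n arbitrary: s)
    case 0
    have "(\<integral>\<^sup>+x. h 0 s x \<partial>m) = ennreal (L1_norm m (\<Phi> s))"
      unfolding h0 L1_norm_def using int[of s] by (intro nn_integral_eq_integral) auto
    then show ?case using \<Phi>(1)[of s] by (simp add: tree_lifts_def lifts_def ennreal_leI)
  next
    case (Suc n)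
    have "(\<integral>\<^sup>+x. h (Suc n) s x \<partial>m) = (\<integral>\<^sup>+x. h n (s @ [False]) x \<partial>m) + (\<integral>\<^sup>+x. h n (s @ [True]) x \<partial>m)"
      unfolding hS by (rule nn_integral_add[OF hm hm])
    also have "\<dots> \<le> ennreal (M * measure m (I (s @ [False]))) + ennreal (M * measure m (I (s @ [True])))"
      by (intro add_mono Suc)
    also have "\<dots> = ennreal (M * measure m (I s))"
      unfolding tree_measure[of s] distrib_left using M(1) by (intro ennreal_plus[symmetric]) auto
    finally show ?case .
  qed
  define H where "H s x = (SUP n. h n s x)" for s x
  have "H s \<in> borel_measurable m" for s
    unfolding H_def[abs_def] by (intro borel_measurable_SUP hm) auto
  moreover have "H s x = H (s @ [False]) x + H (s @ [True]) x" for s x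
  proof -
    have "H s x = (SUP n. h (Suc n) s x)"
      unfolding H_def by (intro antisym SUP_mono) (use hmono in auto)
    also have "\<dots> = H (s @ [False]) x + H (s @ [True]) x"
      unfolding hS H_def by (rule ennreal_SUP_add[OF inc inc])
    finally show ?thesis .
  qed
  moreover have "ennreal (norm (\<Phi> s x)) \<le> H s x" for s x
    unfolding H_def h0[symmetric] by (rule SUP_upper) simp
  moreover have "(\<integral>\<^sup>+x. H s x \<partial>m) \<le> ennreal (M * measure m (I s))" for s
  proof -
    have "incseq (\<lambda>n. h n s)" using inc by (auto simp: incseq_def le_fun_def)
    then have "(\<integral>\<^sup>+x. H s x \<partial>m) = (SUP n. \<integral>\<^sup>+x. h n s x \<partial>m)"
      unfolding H_def by (rule nn_integral_monotone_convergence_SUP[OF _ hm])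
    also have "\<dots> \<le> ennreal (M * measure m (I s))" by (intro SUP_least hint)
    finally show ?thesis .
  qed
  ultimately show ?thesis using \<Phi>(1) by (intro exI[of _ \<Phi>] exI[of _ H]) blast
qed

end

end

section \<open>Absolute continuity of the integral\<close>

lemma nn_integral_absolutely_continuous:
  assumes fin: "finite_measure m" and H: "H \<in> borel_measurable m" "(\<integral>\<^sup>+x. H x \<partial>m) < \<infinity>" and e: "0 < e"
  shows "\<exists>\<delta>>0. \<forall>E\<in>sets m. measure m E \<le> \<delta> \<longrightarrow> (\<integral>\<^sup>+x. H x * indicator E x \<partial>m) \<le> ennreal e"
proof -
  interpret finite_measure m by fact
  define Hk where "Hk k x = min (H x) (of_nat k)" for k :: nat and x
  have Hkm: "Hk k \<in> borel_measurable m" for k unfolding Hk_def[abs_def] using H(1) by measurable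
  have inc: "incseq Hk" unfolding Hk_def incseq_def le_fun_def
    by (auto simp: min_le_iff_disj intro: of_nat_mono)
  have sup: "(SUP k. Hk k x) = H x" for x
  proof (rule antisym)
    show "(SUP k. Hk k x) \<le> H x" by (rule SUP_least) (simp add: Hk_def)
    show "H x \<le> (SUP k. Hk k x)"
    proof (rule dense_le)
      fix y assume y: "y < H x"
      then have "y < top" using less_le_trans[OF y top_greatest] by simp
      then obtain k :: nat where "y < of_nat k" using ennreal_Ex_less_of_nat by blast
      then have "y \<le> Hk k x" using y by (simp add: Hk_def less_imp_le)
      also have "\<dots> \<le> (SUP k. Hk k x)" by (rule SUP_upper) simp
      finally show "y \<le> (SUP k. Hk k x)" .
    qed
  qed
  have "(\<integral>\<^sup>+x. H x \<partial>m) = (SUP k. \<integral>\<^sup>+x. Hk k x \<partial>m)"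
    using nn_integral_monotone_convergence_SUP[OF inc Hkm] by (simp add: sup)
  moreover have "(\<integral>\<^sup>+x. H x \<partial>m) \<le> (SUP k. \<integral>\<^sup>+x. Hk k x \<partial>m) \<Longrightarrow>
     \<exists>k. (\<integral>\<^sup>+x. H x \<partial>m) < (\<integral>\<^sup>+x. Hk k x \<partial>m) + ennreal (e/2)"
  proof -
    assume le: "(\<integral>\<^sup>+x. H x \<partial>m) \<le> (SUP k. \<integral>\<^sup>+x. Hk k x \<partial>m)"
    show ?thesis
    proof (rule ccontr)
      assume "\<nexists>k. (\<integral>\<^sup>+x. H x \<partial>m) < (\<integral>\<^sup>+x. Hk k x \<partial>m) + ennreal (e/2)"
      then have "(\<integral>\<^sup>+x. Hk k x \<partial>m) + ennreal (e/2) \<le> (\<integral>\<^sup>+x. H x \<partial>m)" for k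
        by (simp add: not_less)
      then have "(SUP k. (\<integral>\<^sup>+x. Hk k x \<partial>m) + ennreal (e/2)) \<le> (\<integral>\<^sup>+x. H x \<partial>m)" by (rule SUP_least)
      then have "(SUP k. \<integral>\<^sup>+x. Hk k x \<partial>m) + ennreal (e/2) \<le> (\<integral>\<^sup>+x. H x \<partial>m)"
        by (simp add: ennreal_SUP_add_left)
      then have "(\<integral>\<^sup>+x. H x \<partial>m) + ennreal (e/2) \<le> (\<integral>\<^sup>+x. H x \<partial>m) + 0"
        unfolding add_0_right by (rule order_trans[OF add_right_mono[OF le]])
      then have "ennreal (e/2) \<le> 0" using H(2) ennreal_add_left_cancel_le by fastforce
      then show False using e by simp
    qed
  qed
  ultimately obtain k where k: "(\<integral>\<^sup>+x. H x \<partial>m) < (\<integral>\<^sup>+x. Hk k x \<partial>m) + ennreal (e/2)" by auto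
  \<comment> \<open>Truncating H at height k loses at most e/2, and on E the truncation contributes
    at most k m(E). The k + 1 in the denominator covers k = 0.\<close>
  show ?thesis
  proof (intro exI[of _ "e / (2 * (real k + 1))"] conjI ballI impI)
    show "0 < e / (2 * (real k + 1))" using e by (intro divide_pos_pos) auto
    fix E assume E: "E \<in> sets m" "measure m E \<le> e / (2 * (real k + 1))"
    let ?in = "\<integral>\<^sup>+x. H x * indicator E x \<partial>m" and ?out = "\<integral>\<^sup>+x. H x * indicator (space m - E) x \<partial>m"
    have H_split: "(\<integral>\<^sup>+x. H x \<partial>m) = ?in + ?out"
      using E(1) H(1)
      by (subst nn_integral_add[symmetric]) (auto simp: indicator_def intro!: nn_integral_cong)
    have "(\<integral>\<^sup>+x. Hk k x \<partial>m) \<le> (\<integral>\<^sup>+x. of_nat k * indicator E x + H x * indicator (space m - E) x \<partial>m)"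
      by (intro nn_integral_mono) (auto simp: Hk_def indicator_def)
    also have "\<dots> = of_nat k * emeasure m E + ?out"
      using E(1) H(1) by (subst nn_integral_add) (auto simp: nn_integral_cmult)
    also have "of_nat k * emeasure m E = ennreal (real k * measure m E)"
      by (simp add: emeasure_eq_measure ennreal_mult ennreal_of_nat_eq_real_of_nat)
    also have "real k * measure m E \<le> e / 2"
    proof -
      have "real k * measure m E \<le> (real k + 1) * (e / (2 * (real k + 1)))"
        using E(2) by (intro mult_mono) auto
      also have "\<dots> = e / 2" by (simp add: field_simps)
      finally show ?thesis .
    qed
    finally have "(\<integral>\<^sup>+x. Hk k x \<partial>m) \<le> ennreal (e/2) + ?out"
      by (meson add_right_mono ennreal_leI order_trans)
    then have "?in + ?out \<le> ennreal (e/2) + ?out + ennreal (e/2)"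
      using k unfolding H_split by (meson add_right_mono less_imp_le order_trans)
    also have "\<dots> = ?out + ennreal e"
      using e by (simp add: add.commute add.left_commute flip: ennreal_plus)
    finally have "?out + ?in \<le> ?out + ennreal e" by (simp add: add.commute)
    moreover have "?out \<noteq> top" using H(2) H_split by auto
    ultimately show "?in \<le> ennreal e" by (simp add: ennreal_add_left_cancel_le)
  qed
qed

section \<open>Weak cluster points\<close>

text \<open>The positive parts whose limits become the entries of \<open>complex_of_four\<close>.
  Every c beyond 3 is treated like 3, so that facts hold for all c without a range
  condition.\<close>

definition quarter :: "nat \<Rightarrow> complex \<Rightarrow> real" where
  "quarter c z = (if c = 0 then max 0 (Re z) else if c = 1 then max 0 (- Re z)
     else if c = 2 then max 0 (Im z) else max 0 (- Im z))"

lemma quarter_nonneg: "0 \<le> quarter c z"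
  by (simp add: quarter_def)

lemma quarter_le_norm: "quarter c z \<le> norm z"
  using abs_Re_le_cmod[of z] abs_Im_le_cmod[of z] by (auto simp: quarter_def)

lemma quarter_measurable [measurable]: "quarter c \<in> borel_measurable borel"
  by (cases "c = 0"; cases "c = 1"; cases "c = 2")
     (auto simp: quarter_def[abs_def] intro!: borel_measurable_continuous_onI continuous_intros)

lemma quarter_decomposition:
  "z = (of_real (quarter 0 z) - of_real (quarter 1 z)) + \<i> * (of_real (quarter 2 z) - of_real (quarter 3 z))"
  by (simp add: quarter_def complex_eq_iff max_def)

lemma integrable_quarter: "integrable m f \<Longrightarrow> integrable m (\<lambda>x. quarter c (f x))"
  by (rule Bochner_Integration.integrable_bound[of m f])
     (auto simp: quarter_nonneg quarter_le_norm intro: measurable_compose[OF _ quarter_measurable])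

lemma integral_limit_complex:
  fixes \<phi> :: "'a::t2_space \<Rightarrow> complex" and m :: "'a measure" and d :: "nat \<Rightarrow> 'a \<Rightarrow> real"
  assumes p: "compact_content p" and m: "sets m = sets borel"
    and d: "\<And>n. integrable m (d n)" "\<And>n x. 0 \<le> d n x"
    and lim: "\<forall>E\<in>sets borel. ((\<lambda>n. \<integral>x. indicator E x * d n x \<partial>m) \<longlongrightarrow> p E) G"
    and \<phi>: "continuous_on UNIV \<phi>" "\<And>x. norm (\<phi> x) \<le> 1"
  shows "((\<lambda>n. \<integral>x. \<phi> x * of_real (d n x) \<partial>m) \<longlongrightarrow> (\<integral>x. \<phi> x \<partial>compact_content.content_measure p)) G"
proof -
  interpret compact_content p by fact
  interpret R: finite_measure content_measure by (rule finite_measure_content_measure)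
  have \<phi>m: "\<phi> \<in> borel_measurable borel" by (rule borel_measurable_continuous_onI[OF \<phi>(1)])
  then have \<phi>m': "\<phi> \<in> borel_measurable m" unfolding measurable_cong_sets[OF m refl] .
  have i1: "integrable content_measure \<phi>"
    by (rule R.integrable_const_bound[where B=1]) (use \<phi> \<phi>m in auto)
  have i2: "integrable m (\<lambda>x. \<phi> x * of_real (d n x))" for n
  proof (rule Bochner_Integration.integrable_bound[OF d(1)[of n]])
    show "(\<lambda>x. \<phi> x * of_real (d n x)) \<in> borel_measurable m"
      using \<phi>m' d(1)[of n] by (intro borel_measurable_times) auto
    show "AE x in m. norm (\<phi> x * of_real (d n x)) \<le> norm (d n x)"
      using \<phi>(2) by (intro AE_I2) (simp add: norm_mult mult_left_le_one_le)
  qed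
  have Re: "((\<lambda>n. \<integral>x. Re (\<phi> x) * d n x \<partial>m) \<longlongrightarrow> (\<integral>x. Re (\<phi> x) \<partial>content_measure)) G"
  proof (rule integral_limit'[OF m d lim])
    show "\<bar>Re (\<phi> x)\<bar> \<le> 1" for x using abs_Re_le_cmod[of "\<phi> x"] \<phi>(2)[of x] by linarith
  qed (intro continuous_intros \<phi>)
  have Im: "((\<lambda>n. \<integral>x. Im (\<phi> x) * d n x \<partial>m) \<longlongrightarrow> (\<integral>x. Im (\<phi> x) \<partial>content_measure)) G"
  proof (rule integral_limit'[OF m d lim])
    show "\<bar>Im (\<phi> x)\<bar> \<le> 1" for x using abs_Im_le_cmod[of "\<phi> x"] \<phi>(2)[of x] by linarith
  qed (intro continuous_intros \<phi>)
  have "Re (\<integral>x. \<phi> x * of_real (d n x) \<partial>m) = (\<integral>x. Re (\<phi> x) * d n x \<partial>m)"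
    "Im (\<integral>x. \<phi> x * of_real (d n x) \<partial>m) = (\<integral>x. Im (\<phi> x) * d n x \<partial>m)" for n
    by (subst integral_Re[OF i2, symmetric], simp, subst integral_Im[OF i2, symmetric], simp)
  moreover have "Re (\<integral>x. \<phi> x \<partial>content_measure) = (\<integral>x. Re (\<phi> x) \<partial>content_measure)"
    "Im (\<integral>x. \<phi> x \<partial>content_measure) = (\<integral>x. Im (\<phi> x) \<partial>content_measure)"
    by (rule integral_Re[OF i1, symmetric], rule integral_Im[OF i1, symmetric])
  ultimately show ?thesis unfolding tendsto_complex_iff using Re Im by simp
qed

text \<open>
  A weak* cluster point of a bounded sequence in \<open>L\<^sup>1\<close>, taken separately for the four positive
  parts. Mass of the limit on the sets \<open>J n\<close> is controlled because little of the mass of the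
  \<open>D k\<close> lies between \<open>K n\<close> and \<open>U n\<close>.
\<close>
lemma weak_cluster_measure:
  fixes m :: "'a::{topological_ab_group_add, t2_space} measure"
  assumes cpt: "compact (UNIV :: 'a set)" and m: "sets m = sets borel"
    and D: "\<And>k. integrable m (D k)" "\<And>k. L1_norm m (D k) \<le> B"
    and J: "\<And>n. J n \<in> sets borel" "\<And>n. J (Suc n) \<subseteq> J n"
    and KU: "\<And>n. compact (K n)" "\<And>n. open (U n)" "\<And>n. K n \<subseteq> J n" "\<And>n. J n \<subseteq> U n"
    and small: "\<And>n k. (\<integral>x. indicator (U n - K n) x * norm (D k x) \<partial>m) \<le> 1/16"
    and one: "\<forall>n k. n \<le> k \<longrightarrow> (\<integral>x. indicator (J n) x * D k x \<partial>m) = 1"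
  shows "\<exists>\<mu>\<in>M_space. \<mu> (\<Inter>n. J n) \<noteq> 0 \<and>
     (\<forall>\<gamma>\<in>dual_group. (\<forall>k. fourier m (D k) \<gamma> = 0) \<longrightarrow> fourier_stieltjes \<mu> \<gamma> = 0)"
proof -
  define d where "d c k x = quarter c (D k x)" for c k x
  have d: "integrable m (d c k)" "0 \<le> d c k x" for c k x
    unfolding d_def[abs_def] by (auto intro: integrable_quarter D(1) quarter_nonneg)
  have id: "integrable m (\<lambda>x. indicator E x * d c k x)" if "E \<in> sets borel" for E c k
    using integrable_mult_indicator[OF _ d(1), of E c k] that m by simp
  have iD: "integrable m (\<lambda>x. indicator E x * norm (D k x))" if "E \<in> sets borel" for E k
    using integrable_mult_indicator[OF _ integrable_norm[OF D(1)], of E k] that m by simp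
  have iDc: "integrable m (\<lambda>x. indicator E x * D k x)" if "E \<in> sets borel" for E k
  proof -
    have "(\<lambda>x. indicator E x *\<^sub>R D k x) = (\<lambda>x. indicator E x * D k x)" by (auto simp: indicator_def)
    then show ?thesis using integrable_mult_indicator[OF _ D(1), of E k] that m by simp
  qed
  \<comment> \<open>The value 0 at non-Borel sets makes the family bounded at every index, as the
    compactness argument requires.\<close>
  define x where "x k i = (if snd i \<in> sets borel then \<integral>y. indicator (snd i) y * d (fst i) k y \<partial>m else 0)"
    for k and i :: "nat \<times> 'a set"
  have bounded: "\<exists>C. \<forall>k. \<bar>x k i\<bar> \<le> C" for i
  proof -
    have "\<bar>x k i\<bar> \<le> B" for k
    proof (cases "snd i \<in> sets borel")
      case True
      have "\<bar>x k i\<bar> = (\<integral>y. indicator (snd i) y * d (fst i) k y \<partial>m)"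
        using True by (simp add: x_def d(2) Bochner_Integration.integral_nonneg)
      also have "\<dots> \<le> (\<integral>y. norm (D k y) \<partial>m)"
        using D(1) by (intro integral_mono id True)
          (auto simp: indicator_def d_def quarter_le_norm)
      finally show ?thesis using D(2)[of k] by (simp add: L1_norm_def)
    next
      case False
      have "0 \<le> L1_norm m (D k)" by (simp add: L1_norm_def)
      then show ?thesis using False D(2)[of k] by (simp add: x_def)
    qed
    then show ?thesis by blast
  qed
  obtain G where G: "G \<noteq> bot" "G \<le> sequentially" "\<And>i. \<exists>l. ((\<lambda>k. x k i) \<longlongrightarrow> l) G"
    using bounded_family_converges_along_filter[of x, OF bounded] by blast
  obtain q where q: "\<And>i. ((\<lambda>k. x k i) \<longlongrightarrow> q i) G" using G(3) by metis
  define p where "p c E = q (c, E)" for c E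
  have p': "((\<lambda>k. x k (c, E)) \<longlongrightarrow> p c E) G" for c E unfolding p_def by (rule q)
  have p: "((\<lambda>k. \<integral>y. indicator E y * d c k y \<partial>m) \<longlongrightarrow> p c E) G" if "E \<in> sets borel" for c E
    using p'[of c E] that by (simp add: x_def)
  have pl: "\<forall>E\<in>sets borel. ((\<lambda>k. \<integral>y. indicator E y * d c k y \<partial>m) \<longlongrightarrow> p c E) G" for c
    using p by blast
  have content: "compact_content (p c)" for c
    by (rule limit_is_content[OF cpt m d G(1) pl])
  define \<rho> where "\<rho> c = compact_content.content_measure (p c)" for c
  have fin: "finite_measure (\<rho> c)" and s: "sets (\<rho> c) = sets borel" for c
    unfolding \<rho>_def using content
    by (auto simp: compact_content.finite_measure_content_measure compact_content.sets_content_measure)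
  have reg: "\<forall>E\<in>sets borel. \<forall>e>0. \<exists>V. open V \<and> E \<subseteq> V \<and> measure (\<rho> c) (V - E) \<le> e" for c
  proof (intro ballI allI impI)
    fix E :: "'a set" and e :: real assume "E \<in> sets borel" "0 < e"
    from compact_content.content_measure_outer_regular[OF content this]
    obtain V where "open V" "E \<subseteq> V" "measure (\<rho> c) (V - E) \<le> e" unfolding \<rho>_def .
    then show "\<exists>V. open V \<and> E \<subseteq> V \<and> measure (\<rho> c) (V - E) \<le> e" by blast
  qed
  have [measurable]: "U n \<in> sets borel" "K n \<in> sets borel" "J n \<in> sets borel" for n
    by (rule borel_open[OF KU(2)], rule borel_closed[OF compact_imp_closed[OF KU(1)]], rule J(1))
  have gap: "p c (U n - K n) \<le> 1/16" for c n
  proof (rule tendsto_upperbound[OF p _ G(1)])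
    show "\<forall>\<^sub>F k in G. (\<integral>y. indicator (U n - K n) y * d c k y \<partial>m) \<le> 1/16"
    proof (intro always_eventually allI)
      fix k
      have "(\<integral>y. indicator (U n - K n) y * d c k y \<partial>m) \<le> (\<integral>y. indicator (U n - K n) y * norm (D k y) \<partial>m)"
        by (intro integral_mono id iD) (auto simp: indicator_def d_def quarter_le_norm)
      then show "(\<integral>y. indicator (U n - K n) y * d c k y \<partial>m) \<le> 1/16" using small[of n k] by linarith
    qed
  qed simp
  \<comment> \<open>Both numbers lie between p c (K n) and p c (U n): the measure by its comparison
    with \<open>p c\<close> on compact and on open sets, \<open>p c\<close> itself by
    monotonicity.\<close>
  have near: "\<bar>measure (\<rho> c) (J n) - p c (J n)\<bar> \<le> 1/16" for c n
  proof -
    interpret P: compact_content "p c" by (rule content)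
    interpret R: finite_measure "\<rho> c" by (rule fin)
    have "p c (U n) = p c (J n) + p c (U n - J n)"
      using P.content_Un[of "J n" "U n - J n"] KU(4)[of n] by (simp add: Un_absorb1)
    moreover have "p c (U n - J n) \<le> p c (U n - K n)"
      using KU(3)[of n] by (intro P.content_mono) auto
    moreover have "p c (J n) = p c (K n) + p c (J n - K n)"
      using P.content_Un[of "K n" "J n - K n"] KU(3)[of n] by (simp add: Un_absorb1)
    moreover have "p c (J n - K n) \<le> p c (U n - K n)"
      using KU(4)[of n] by (intro P.content_mono) auto
    moreover have "measure (\<rho> c) (J n) \<le> measure (\<rho> c) (U n)" "measure (\<rho> c) (K n) \<le> measure (\<rho> c) (J n)"
      using KU(3,4)[of n] s[of c] by (auto intro!: R.finite_measure_mono)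
    moreover have "measure (\<rho> c) (U n) \<le> p c (U n)" "p c (K n) \<le> measure (\<rho> c) (K n)"
      unfolding \<rho>_def using P.measure_content_measure_open[OF KU(2)] P.measure_content_measure_compact[OF KU(1)] by auto
    ultimately show ?thesis using gap[of c n] by linarith
  qed
  have diff: "p 0 (J n) - p 1 (J n) = 1" for n
  proof -
    have "(\<integral>y. indicator (J n) y * d 0 k y \<partial>m) - (\<integral>y. indicator (J n) y * d 1 k y \<partial>m) = 1" if "n \<le> k" for k
    proof -
      have "(\<integral>y. indicator (J n) y * d 0 k y \<partial>m) - (\<integral>y. indicator (J n) y * d 1 k y \<partial>m)
          = (\<integral>y. indicator (J n) y * d 0 k y - indicator (J n) y * d 1 k y \<partial>m)"
        by (rule Bochner_Integration.integral_diff[symmetric]) (intro id J(1))+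
      also have "\<dots> = (\<integral>y. Re (indicator (J n) y * D k y) \<partial>m)"
        by (intro Bochner_Integration.integral_cong) (auto simp: d_def quarter_def indicator_def)
      also have "\<dots> = Re (\<integral>y. indicator (J n) y * D k y \<partial>m)" by (rule integral_Re[OF iDc[OF J(1)]])
      finally show ?thesis using one that by simp
    qed
    then have "\<forall>\<^sub>F k in G. (\<integral>y. indicator (J n) y * d 0 k y \<partial>m) - (\<integral>y. indicator (J n) y * d 1 k y \<partial>m) = 1"
      using filter_leD[OF G(2) eventually_ge_at_top[of n]] by (auto elim: eventually_mono)
    then have "((\<lambda>k. (\<integral>y. indicator (J n) y * d 0 k y \<partial>m) - (\<integral>y. indicator (J n) y * d 1 k y \<partial>m)) \<longlongrightarrow> 1) G"
      by (rule tendsto_eventually)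
    from tendsto_unique[OF G(1) this tendsto_diff[OF p[OF J(1)] p[OF J(1)]]] show ?thesis by simp
  qed
  define \<mu> where "\<mu> = complex_of_four \<rho>"
  have "\<mu> \<in> M_space"
    unfolding \<mu>_def by (rule complex_of_four_in_M_space[OF cpt fin s reg])
  moreover have "\<mu> (\<Inter>n. J n) \<noteq> 0"
  proof
    assume 0: "\<mu> (\<Inter>n. J n) = 0"
    have dec: "decseq J" using J(2) by (rule decseq_SucI)
    have range: "range J \<subseteq> sets (\<rho> c)" for c using J(1) unfolding s by blast
    have l: "(\<lambda>n. measure (\<rho> c) (J n)) \<longlonglongrightarrow> measure (\<rho> c) (\<Inter>n. J n)" for c
      by (rule finite_measure.finite_Lim_measure_decseq[OF fin range dec])
    \<comment> \<open>The contents differ by 1 on J n, and each of the two measures is within 1/16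
      of its content.\<close>
    have "7/8 \<le> measure (\<rho> 0) (J n) - measure (\<rho> 1) (J n)" for n
      using diff[of n] near[of 0 n] near[of 1 n] by linarith
    then have "7/8 \<le> measure (\<rho> 0) (\<Inter>n. J n) - measure (\<rho> 1) (\<Inter>n. J n)"
      by (intro tendsto_lowerbound[OF tendsto_diff[OF l l] always_eventually sequentially_bot] allI)
    then show False using 0 by (simp add: \<mu>_def complex_of_four_def complex_eq_iff)
  qed
  moreover have "fourier_stieltjes \<mu> \<gamma> = 0" if \<gamma>: "\<gamma> \<in> dual_group" and D0: "\<And>k. fourier m (D k) \<gamma> = 0" for \<gamma>
  proof -
    have \<gamma>c: "continuous_on UNIV (\<lambda>x. cnj (\<gamma> x))" "norm (cnj (\<gamma> x)) \<le> 1" for x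
      using \<gamma> by (auto simp: dual_group_def intro: continuous_intros)
    have T: "((\<lambda>k. \<integral>x. cnj (\<gamma> x) * of_real (d c k x) \<partial>m) \<longlongrightarrow> (\<integral>x. cnj (\<gamma> x) \<partial>\<rho> c)) G" for c
      unfolding \<rho>_def by (rule integral_limit_complex[OF content m d pl \<gamma>c])
    have lim: "((\<lambda>k. ((\<integral>x. cnj (\<gamma> x) * of_real (d 0 k x) \<partial>m) - (\<integral>x. cnj (\<gamma> x) * of_real (d 1 k x) \<partial>m)) +
         \<i> * ((\<integral>x. cnj (\<gamma> x) * of_real (d 2 k x) \<partial>m) - (\<integral>x. cnj (\<gamma> x) * of_real (d 3 k x) \<partial>m))) \<longlongrightarrow> fourier_stieltjes \<mu> \<gamma>) G"
    proof -
      have "fourier_stieltjes \<mu> \<gamma> = ((\<integral>x. cnj (\<gamma> x) \<partial>\<rho> 0) - (\<integral>x. cnj (\<gamma> x) \<partial>\<rho> 1)) +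
         \<i> * ((\<integral>x. cnj (\<gamma> x) \<partial>\<rho> 2) - (\<integral>x. cnj (\<gamma> x) \<partial>\<rho> 3))"
        unfolding fourier_stieltjes_def \<mu>_def
        by (rule complex_measure_integral_of_four[OF fin s borel_measurable_continuous_onI[OF \<gamma>c(1)] \<gamma>c(2)])
      then show ?thesis using T by (auto intro!: tendsto_intros)
    qed
    have ic: "integrable m (\<lambda>x. cnj (\<gamma> x) * of_real (d c k x))" for c k
      using integrable_mult_character[OF m _ \<gamma>, of "\<lambda>x. of_real (d c k x)"] d(1)[of c k] by (simp add: mult.commute)
    have "((\<integral>x. cnj (\<gamma> x) * of_real (d 0 k x) \<partial>m) - (\<integral>x. cnj (\<gamma> x) * of_real (d 1 k x) \<partial>m)) +
         \<i> * ((\<integral>x. cnj (\<gamma> x) * of_real (d 2 k x) \<partial>m) - (\<integral>x. cnj (\<gamma> x) * of_real (d 3 k x) \<partial>m)) = fourier m (D k) \<gamma>" for k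
    proof -
      have eq: "D k x * cnj (\<gamma> x) = (cnj (\<gamma> x) * of_real (d 0 k x) - cnj (\<gamma> x) * of_real (d 1 k x)) +
         \<i> * (cnj (\<gamma> x) * of_real (d 2 k x) - cnj (\<gamma> x) * of_real (d 3 k x))" for x
        by (subst quarter_decomposition[of "D k x"]) (simp add: d_def algebra_simps)
      show ?thesis unfolding fourier_def eq using ic by simp
    qed
    then have "((\<lambda>k. 0) \<longlongrightarrow> fourier_stieltjes \<mu> \<gamma>) G" using lim D0 by simp
    from tendsto_unique[OF G(1) this tendsto_const] show ?thesis .
  qed
  ultimately show ?thesis by blast
qed

section \<open>Concentrating lifts\<close>

text \<open>If both children failed the inequality, adding the failures would contradict it at the
  parent. Strictness matters: it keeps v positive along the branch, which later allows division by
  the measure of the cell.\<close>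

lemma light_branch:
  fixes q v :: "bool list \<Rightarrow> ennreal"
  assumes q: "\<And>s. q s = q (s @ [False]) + q (s @ [True])" and v: "\<And>s. v s = v (s @ [False]) + v (s @ [True])"
    and root: "q [] < v []"
  shows "\<exists>\<sigma>. \<forall>n. (length (\<sigma> n) = n \<and> q (\<sigma> n) < v (\<sigma> n)) \<and> (\<exists>b. \<sigma> (Suc n) = \<sigma> n @ [b])"
proof (rule dependent_nat_choice)
  show "\<exists>s. length s = 0 \<and> q s < v s" using root by auto
  fix s n assume s: "length s = n \<and> q s < v s"
  have "\<exists>b. q (s @ [b]) < v (s @ [b])"
  proof (rule ccontr)
    assume "\<nexists>b. q (s @ [b]) < v (s @ [b])"
    then have le: "v (s @ [b]) \<le> q (s @ [b])" for b by (simp add: not_less)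
    have "v s \<le> q s" unfolding q[of s] v[of s] by (intro add_mono le)
    from leD[OF this] s show False by blast
  qed
  then obtain b where "q (s @ [b]) < v (s @ [b])" ..
  then show "\<exists>t. (length t = Suc n \<and> q t < v t) \<and> (\<exists>b. t = s @ [b])"
    using s by (intro exI[of _ "s @ [b]"]) auto
qed

text \<open>
  The bound on \<open>U n - K n\<close> holds along the whole branch because the modulus of the additive lifting
  dominates all \<open>D k\<close> at once.
\<close>
lemma concentrating_lifts:
  fixes m :: "'a::{topological_ab_group_add, t2_space} measure"
  assumes cpt: "compact (UNIV :: 'a set)" and inf: "infinite (UNIV :: 'a set)" and haar: "normalized_haar m"
    and X: "measure_closed_subspace m X A" and mA: "0 < measure m A"
    and onto: "\<forall>g\<in>L1_on m A. \<exists>f\<in>X. AE x in m. restriction_op A f x = g x"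
  shows "\<exists>(D :: nat \<Rightarrow> 'a \<Rightarrow> complex) J K U B. (\<forall>k. D k \<in> X \<and> L1_norm m (D k) \<le> B) \<and>
     (\<forall>n. J n \<in> sets borel \<and> J (Suc n) \<subseteq> J n) \<and> (\<lambda>n. measure m (J n)) \<longlonglongrightarrow> 0 \<and>
     (\<forall>n. compact (K n) \<and> open (U n) \<and> K n \<subseteq> J n \<and> J n \<subseteq> U n) \<and>
     (\<forall>n k. (\<integral>x. indicator (U n - K n) x * norm (D k x) \<partial>m) \<le> 1/16) \<and>
     (\<forall>n k. n \<le> k \<longrightarrow> (\<integral>x. indicator (J n) x * D k x \<partial>m) = 1)"
proof -
  interpret measure_closed_subspace m X A by (rule X)
  note mD = normalized_haarD[OF haar]
  interpret finite_measure m by (rule mD(3))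
  obtain M where M: "0 \<le> M" "\<And>I. I \<in> sets m \<Longrightarrow> I \<subseteq> A \<Longrightarrow> lifts (M * measure m I) (indicator I) \<noteq> {}"
    using uniform_lifting[OF onto] by blast
  obtain E :: "nat \<Rightarrow> 'a set" where E: "\<And>i. E i \<in> sets borel"
    "\<And>e. 0 < e \<Longrightarrow> \<exists>N. \<forall>s. N \<le> length s \<longrightarrow> measure m (cell E s) \<le> e"
    by (rule haar_shrinking_cells[OF cpt haar inf]) blast
  define I where "I s = A \<inter> cell E s" for s
  have I0: "I [] = A" by (simp add: I_def)
  have Im: "I s \<in> sets m" for s using A cell_borel[OF E(1), where s=s] mD(1) by (auto simp: I_def)
  have Ib: "I s \<in> sets borel" for s using Im[of s] mD(1) by simp
  have IA: "I s \<subseteq> A" for s by (auto simp: I_def)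
  have Isplit: "I s = I (s @ [False]) \<union> I (s @ [True])" "I (s @ [False]) \<inter> I (s @ [True]) = {}" for s
    using cell_split[of E s] by (auto simp: I_def)
  have IM: "lifts (M * measure m (I s)) (indicator (I s)) \<noteq> {}" for s by (rule M(2)[OF Im IA])
  obtain \<Phi> H where \<Phi>: "\<And>s. \<Phi> s \<in> lifts (M * measure m (I s)) (indicator (I s))"
    and Hm: "\<And>s. H s \<in> borel_measurable m"
    and Hadd: "\<And>s x. H s x = H (s @ [False]) x + H (s @ [True]) x"
    and H\<Phi>: "\<And>s x. ennreal (norm (\<Phi> s x)) \<le> H s x"
    and Hint: "\<And>s. (\<integral>\<^sup>+x. H s x \<partial>m) \<le> ennreal (M * measure m (I s))"
    using additive_lifting_with_modulus[of I M, OF Im IA Isplit M(1) IM]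
    unfolding tree_lifts_def[of I M, OF Im IA Isplit M(1) IM] by blast
  have \<Phi>i: "integrable m (\<Phi> s)" for s by (rule lifts_integrable[OF \<Phi>])
  \<comment> \<open>Half of the root value m(A)/16 of \<open>v\<close>, which makes the inequality
    at the root strict.\<close>
  define c0 where "c0 = measure m A / 32"
  have c0: "0 < c0" using mA by (simp add: c0_def)
  define node :: "nat \<Rightarrow> bool list" where "node = from_nat"
  \<comment> \<open>All nodes are squeezed before a branch is known. The errors are measured by the
    modulus at the root and sum to \<open>c0\<close>.\<close>
  define squeezed where "squeezed i K U \<longleftrightarrow> compact K \<and> open U \<and> K \<subseteq> I (node i) \<and> I (node i) \<subseteq> U \<and>
     (\<integral>\<^sup>+x. H [] x * indicator (U - K) x \<partial>m) \<le> ennreal (c0 * (1/2)^Suc i)" for i K U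
  have "\<exists>K U. squeezed i K U" for i
  proof -
    have "(\<integral>\<^sup>+x. H [] x \<partial>m) < \<infinity>" using Hint[of "[]"] by (rule le_less_trans) simp
    moreover have "0 < c0 * (1/2)^Suc i" using c0 by simp
    ultimately obtain \<delta> where \<delta>: "0 < \<delta>" "\<And>F. F \<in> sets m \<Longrightarrow> measure m F \<le> \<delta> \<Longrightarrow>
        (\<integral>\<^sup>+x. H [] x * indicator F x \<partial>m) \<le> ennreal (c0 * (1/2)^Suc i)"
      using nn_integral_absolutely_continuous[OF mD(3) Hm] by blast
    have \<delta>2: "0 < \<delta> / 2" using \<delta>(1) by simp
    obtain K where K: "compact K" "K \<subseteq> I (node i)" "measure m (I (node i) - K) \<le> \<delta>/2"
      using haar_inner_regular[OF cpt haar Ib \<delta>2] by blast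
    obtain U where U: "open U" "I (node i) \<subseteq> U" "measure m (U - I (node i)) \<le> \<delta>/2"
      using haar_outer_regular[OF haar Ib \<delta>2] by blast
    have b: "U \<in> sets m" "K \<in> sets m"
      unfolding mD(1) by (rule borel_open[OF U(1)], rule borel_closed[OF compact_imp_closed[OF K(1)]])
    have "U - K = (U - I (node i)) \<union> (I (node i) - K)" using U(2) K(2) by auto
    then have "measure m (U - K) \<le> measure m (U - I (node i)) + measure m (I (node i) - K)"
      using measure_Un_le[of "U - I (node i)" m "I (node i) - K"] b Im by auto
    then have "measure m (U - K) \<le> \<delta>" using U(3) K(3) by linarith
    then have "(\<integral>\<^sup>+x. H [] x * indicator (U - K) x \<partial>m) \<le> ennreal (c0 * (1/2)^Suc i)"
      using b by (intro \<delta>(2)) auto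
    then have "squeezed i K U" using K U by (simp add: squeezed_def)
    then show ?thesis by blast
  qed
  then obtain K U where "\<And>i. squeezed i (K i) (U i)" by metis
  then have KU: "\<And>i. compact (K i)" "\<And>i. open (U i)" "\<And>i. K i \<subseteq> I (node i)" "\<And>i. I (node i) \<subseteq> U i"
    "\<And>i. (\<integral>\<^sup>+x. H [] x * indicator (U i - K i) x \<partial>m) \<le> ennreal (c0 * (1/2)^Suc i)"
    unfolding squeezed_def by blast+
  have Fm: "U i - K i \<in> sets m" for i
    unfolding mD(1) by (rule sets.Diff[OF borel_open[OF KU(2)] borel_closed[OF compact_imp_closed[OF KU(1)]]])
  \<comment> \<open>\<open>W x\<close> counts the gaps U i - K i that contain x. It dominates each
    of their indicators, so one weight \<open>q\<close>, additive in s because H is, controls all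
    gaps together.\<close>
  define W where "W x = (\<Sum>i. indicator (U i - K i) x :: ennreal)" for x
  have Wm: "W \<in> borel_measurable m"
    unfolding W_def[abs_def] by (intro borel_measurable_suminf_order borel_measurable_indicator Fm)
  have W1: "indicator (U i - K i) x \<le> W x" for i x
  proof -
    have "(\<Sum>j\<in>{i}. indicator (U j - K j) x :: ennreal) \<le> W x"
      unfolding W_def by (rule sum_le_suminf) auto
    then show ?thesis by simp
  qed
  define q where "q s = (\<integral>\<^sup>+x. H s x * W x \<partial>m)" for s
  define v where "v s = ennreal (measure m (I s) / 16)" for s
  have q0: "q [] \<le> ennreal c0"
  proof -
    have "q [] = (\<integral>\<^sup>+x. (\<Sum>i. H [] x * indicator (U i - K i) x) \<partial>m)"
      unfolding q_def W_def by simp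
    also have "\<dots> = (\<Sum>i. \<integral>\<^sup>+x. H [] x * indicator (U i - K i) x \<partial>m)"
      by (intro nn_integral_suminf borel_measurable_times_ennreal borel_measurable_indicator Hm Fm)
    also have "\<dots> \<le> (\<Sum>i. ennreal (c0 * (1/2)^Suc i))" by (intro suminf_le KU(5)) auto
    also have "\<dots> = ennreal c0"
      using sums_mult[OF power_half_series, of c0] c0 by (intro suminf_ennreal_eq) auto
    finally show ?thesis .
  qed
  have "\<exists>\<sigma>. \<forall>n. (length (\<sigma> n) = n \<and> q (\<sigma> n) < v (\<sigma> n)) \<and> (\<exists>b. \<sigma> (Suc n) = \<sigma> n @ [b])"
  proof (rule light_branch)
    fix s
    show "q s = q (s @ [False]) + q (s @ [True])"
      unfolding q_def using Hm Wm
      by (subst nn_integral_add[symmetric]) (auto simp: Hadd[of s] distrib_right)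
    have "measure m (I s) = measure m (I (s @ [False])) + measure m (I (s @ [True]))"
      using finite_measure_Union[OF Im Im Isplit(2)[of s]] Isplit(1)[of s] by simp
    then show "v s = v (s @ [False]) + v (s @ [True])"
      by (simp add: v_def add_divide_distrib)
    show "q [] < v []"
    proof (rule le_less_trans[OF q0])
      show "ennreal c0 < v []" using mA by (simp add: v_def I0 c0_def ennreal_less_iff)
    qed
  qed
  then obtain \<sigma> where \<sigma>: "\<And>n. length (\<sigma> n) = n" "\<And>n. q (\<sigma> n) < v (\<sigma> n)" "\<And>n. \<exists>b. \<sigma> (Suc n) = \<sigma> n @ [b]"
    by blast
  have mpos: "0 < measure m (I (\<sigma> n))" for n
  proof (rule ccontr)
    assume "\<not> 0 < measure m (I (\<sigma> n))"
    then have "measure m (I (\<sigma> n)) = 0" using measure_nonneg[of m "I (\<sigma> n)"] by linarith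
    then show False using \<sigma>(2)[of n] by (simp add: v_def)
  qed
  have dec: "I (\<sigma> (Suc n)) \<subseteq> I (\<sigma> n)" for n
  proof -
    obtain b where "\<sigma> (Suc n) = \<sigma> n @ [b]" using \<sigma>(3) by blast
    then show ?thesis by (auto simp: I_def cell_snoc)
  qed
  have mono: "I (\<sigma> k) \<subseteq> I (\<sigma> n)" if "n \<le> k" for n k
    using lift_Suc_antimono_le[of "\<lambda>n. I (\<sigma> n)", OF dec that] .
  define D where "D n x = complex_of_real (1 / measure m (I (\<sigma> n))) * \<Phi> (\<sigma> n) x" for n x
  have nD: "norm (complex_of_real (1 / measure m (I (\<sigma> n)))) = 1 / measure m (I (\<sigma> n))" for n
    using mpos[of n] by (simp add: norm_divide)
  have Dl: "D n \<in> lifts M (\<lambda>x. complex_of_real (1 / measure m (I (\<sigma> n))) * indicator (I (\<sigma> n)) x)" for n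
  proof -
    have "D n \<in> lifts (1 / measure m (I (\<sigma> n)) * (M * measure m (I (\<sigma> n))))
        (\<lambda>x. complex_of_real (1 / measure m (I (\<sigma> n))) * indicator (I (\<sigma> n)) x)"
      using lifts_scale[OF \<Phi>, of "complex_of_real (1 / measure m (I (\<sigma> n)))" "\<sigma> n"]
      unfolding nD D_def[abs_def] .
    then show ?thesis using mpos[of n] by simp
  qed
  \<comment> \<open>The lift at \<sigma> n is dominated by H, so its mass in each gap is at most q <
    v = m(I (\<sigma> n))/16; the normalising factor turns this into 1/16 for every i and n.\<close>
  have small: "(\<integral>x. indicator (U i - K i) x * norm (D n x) \<partial>m) \<le> 1/16" for i n
  proof -
    have int: "integrable m (\<lambda>x. indicator (U i - K i) x * norm (\<Phi> (\<sigma> n) x))"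
      using integrable_mult_indicator[OF Fm integrable_norm[OF \<Phi>i], of i "\<sigma> n"] by simp
    have "ennreal (\<integral>x. indicator (U i - K i) x * norm (\<Phi> (\<sigma> n) x) \<partial>m)
        = (\<integral>\<^sup>+x. ennreal (indicator (U i - K i) x * norm (\<Phi> (\<sigma> n) x)) \<partial>m)"
      by (rule nn_integral_eq_integral[OF int, symmetric]) simp
    also have "\<dots> \<le> q (\<sigma> n)"
      unfolding q_def
    proof (rule nn_integral_mono)
      fix x
      have "ennreal (indicator (U i - K i) x * norm (\<Phi> (\<sigma> n) x)) = ennreal (norm (\<Phi> (\<sigma> n) x)) * indicator (U i - K i) x"
        by (simp add: indicator_def)
      also have "\<dots> \<le> H (\<sigma> n) x * W x" by (intro mult_mono H\<Phi> W1) auto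
      finally show "ennreal (indicator (U i - K i) x * norm (\<Phi> (\<sigma> n) x)) \<le> H (\<sigma> n) x * W x" .
    qed
    also have "\<dots> \<le> ennreal (measure m (I (\<sigma> n)) / 16)" using \<sigma>(2)[of n] by (simp add: v_def)
    finally have le: "(\<integral>x. indicator (U i - K i) x * norm (\<Phi> (\<sigma> n) x) \<partial>m) \<le> measure m (I (\<sigma> n)) / 16"
      using measure_nonneg[of m "I (\<sigma> n)"] by (subst (asm) ennreal_le_iff) auto
    have "(\<integral>x. indicator (U i - K i) x * norm (D n x) \<partial>m) =
       (\<integral>x. 1 / measure m (I (\<sigma> n)) * (indicator (U i - K i) x * norm (\<Phi> (\<sigma> n) x)) \<partial>m)"
      unfolding D_def norm_mult nD by (intro Bochner_Integration.integral_cong) (auto simp: ac_simps)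
    also have "\<dots> = 1 / measure m (I (\<sigma> n)) * (\<integral>x. indicator (U i - K i) x * norm (\<Phi> (\<sigma> n) x) \<partial>m)"
      by (rule integral_mult_right_zero)
    also have "\<dots> \<le> 1 / measure m (I (\<sigma> n)) * (measure m (I (\<sigma> n)) / 16)"
      using le mpos[of n] by (intro mult_left_mono) auto
    also have "\<dots> = 1/16" using mpos[of n] by simp
    finally show ?thesis .
  qed
  \<comment> \<open>On \<open>A\<close> the function D k is the normalised indicator of its own
    cell, which for k \<ge> n lies inside the cell of stage n.\<close>
  have one: "(\<integral>x. indicator (I (\<sigma> n)) x * D k x \<partial>m) = 1" if nk: "n \<le> k" for n k
  proof -
    let ?c = "complex_of_real (1 / measure m (I (\<sigma> k)))"
    have ae: "AE x in m. x \<in> A \<longrightarrow> D k x = ?c * indicator (I (\<sigma> k)) x" using Dl[of k] by (simp add: lifts_def)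
    have "(\<integral>x. indicator (I (\<sigma> n)) x * D k x \<partial>m) = (\<integral>x. ?c * indicator (I (\<sigma> k)) x \<partial>m)"
    proof (rule integral_cong_AE)
      show "(\<lambda>x. indicator (I (\<sigma> n)) x * D k x) \<in> borel_measurable m"
        using lifts_integrable[OF Dl[of k]] Im by (intro borel_measurable_times borel_measurable_indicator) auto
      show "(\<lambda>x. ?c * indicator (I (\<sigma> k)) x) \<in> borel_measurable m"
        using Im by (intro borel_measurable_times borel_measurable_const borel_measurable_indicator)
      show "AE x in m. indicator (I (\<sigma> n)) x * D k x = ?c * indicator (I (\<sigma> k)) x"
        using ae
      proof eventually_elim
        case (elim x)
        then show ?case using mono[OF nk] IA[of "\<sigma> n"] by (auto simp: indicator_def)
      qed
    qed
    also have "\<dots> = ?c * (\<integral>x. indicator (I (\<sigma> k)) x \<partial>m)" by (rule integral_mult_right_zero)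
    also have "(\<integral>x. indicator (I (\<sigma> k)) x \<partial>m) = complex_of_real (measure m (I (\<sigma> k)))"
    proof -
      have "(\<integral>x. indicator (I (\<sigma> k)) x \<partial>m) = (\<integral>x. complex_of_real (indicator (I (\<sigma> k)) x) \<partial>m)"
        by (intro Bochner_Integration.integral_cong) (auto simp: indicator_def)
      also have "\<dots> = complex_of_real (\<integral>x. indicator (I (\<sigma> k)) x \<partial>m)"
        by (rule integral_complex_of_real)
      also have "(\<integral>x. indicator (I (\<sigma> k)) x \<partial>m) = measure m (I (\<sigma> k))" by (simp add: mD(2))
      finally show ?thesis .
    qed
    finally show ?thesis using mpos[of k] by simp
  qed
  have lim0: "(\<lambda>n. measure m (I (\<sigma> n))) \<longlonglongrightarrow> 0"
  proof (rule LIMSEQ_I)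
    fix e :: real assume e: "0 < e"
    obtain N where N: "\<And>s. N \<le> length s \<Longrightarrow> measure m (cell E s) \<le> e/2" using E(2)[of "e/2"] e by auto
    have "norm (measure m (I (\<sigma> n)) - 0) < e" if "N \<le> n" for n
    proof -
      have "measure m (I (\<sigma> n)) \<le> measure m (cell E (\<sigma> n))"
        using cell_borel[OF E(1), where s="\<sigma> n"] mD(1) by (intro finite_measure_mono) (auto simp: I_def)
      also have "\<dots> \<le> e/2" using N \<sigma>(1) that by simp
      finally show ?thesis using e by simp
    qed
    then show "\<exists>N. \<forall>n\<ge>N. norm (measure m (I (\<sigma> n)) - 0) < e" by blast
  qed
  have nn: "node (to_nat (\<sigma> n)) = \<sigma> n" for n by (simp add: node_def)
  show ?thesis
  proof (intro exI conjI allI impI)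
    show "D k \<in> X" "L1_norm m (D k) \<le> M" for k using Dl[of k] by (auto simp: lifts_def)
    show "I (\<sigma> n) \<in> sets borel" "I (\<sigma> (Suc n)) \<subseteq> I (\<sigma> n)" for n by (rule Ib, rule dec)
    show "(\<lambda>n. measure m (I (\<sigma> n))) \<longlonglongrightarrow> 0" by (rule lim0)
    show "compact (K (to_nat (\<sigma> n)))" "open (U (to_nat (\<sigma> n)))" for n by (rule KU(1), rule KU(2))
    show "K (to_nat (\<sigma> n)) \<subseteq> I (\<sigma> n)" "I (\<sigma> n) \<subseteq> U (to_nat (\<sigma> n))" for n
      using KU(3)[of "to_nat (\<sigma> n)"] KU(4)[of "to_nat (\<sigma> n)"] by (simp_all add: nn)
    show "(\<integral>x. indicator (U (to_nat (\<sigma> n)) - K (to_nat (\<sigma> n))) x * norm (D k x) \<partial>m) \<le> 1/16" for n k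
      by (rule small)
    show "(\<integral>x. indicator (I (\<sigma> n)) x * D k x \<partial>m) = 1" if "n \<le> k" for n k by (rule one[OF that])
  qed
qed

section \<open>Contradiction with the Riesz property\<close>

theorem theorem7p7:
  fixes m :: "'a::{topological_ab_group_add, t2_space} measure"
    and \<Lambda> :: "('a \<Rightarrow> complex) set"
  assumes "compact (UNIV :: 'a set)"
    and "infinite (UNIV :: 'a set)"
    and "normalized_haar m"
    and "\<Lambda> \<subseteq> dual_group"
    and "nicely_placed m \<Lambda>"
    and "riesz_set m \<Lambda>"
  shows "small_subspace m (L1_spectrum m \<Lambda>)"
proof -
  note mD = normalized_haarD[OF assms(3)]
  interpret finite_measure m by (rule mD(3))
  have sub: "L1_subspace m (L1_spectrum m \<Lambda>)" by (rule L1_subspace_L1_spectrum[OF mD(1)])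
  have False if A: "A \<in> sets m" "emeasure m A > 0"
    and onto: "\<forall>g\<in>L1_on m A. \<exists>f\<in>L1_spectrum m \<Lambda>. AE x in m. restriction_op A f x = g x" for A
  proof -
    have mcs: "measure_closed_subspace m (L1_spectrum m \<Lambda>) A"
    proof
      fix f :: "nat \<Rightarrow> 'a \<Rightarrow> complex" and g r
      assume "\<And>n. f n \<in> L1_spectrum m \<Lambda>" "\<And>n. L1_norm m (f n) \<le> r"
        "g \<in> borel_measurable m" "AE x in m. (\<lambda>n. f n x) \<longlonglongrightarrow> g x"
      from nicely_placed_AE_closed[OF mD(1,3) assms(5) this]
      show "g \<in> L1_spectrum m \<Lambda> \<and> L1_norm m g \<le> r" by (rule conjI)
    qed (use sub A in auto)
    have mA: "0 < measure m A" using A(2) by (simp add: emeasure_eq_measure)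
    obtain D :: "nat \<Rightarrow> 'a \<Rightarrow> complex" and J K U B where
      D: "\<forall>k. D k \<in> L1_spectrum m \<Lambda> \<and> L1_norm m (D k) \<le> B"
      and J: "\<forall>n. J n \<in> sets borel \<and> J (Suc n) \<subseteq> J n" "(\<lambda>n. measure m (J n)) \<longlonglongrightarrow> 0"
      and KU: "\<forall>n. compact (K n) \<and> open (U n) \<and> K n \<subseteq> J n \<and> J n \<subseteq> U n"
      and small: "\<forall>n k. (\<integral>x. indicator (U n - K n) x * norm (D k x) \<partial>m) \<le> 1/16"
      and one: "\<forall>n k. n \<le> k \<longrightarrow> (\<integral>x. indicator (J n) x * D k x \<partial>m) = 1"
      using concentrating_lifts[OF assms(1-3) mcs mA onto] by (elim exE conjE) (rule that)
    have Di: "integrable m (D k)" for k using D by (simp add: L1_spectrum_def L1_space_def)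
    have "\<exists>\<mu>\<in>M_space. \<mu> (\<Inter>n. J n) \<noteq> 0 \<and>
     (\<forall>\<gamma>\<in>dual_group. (\<forall>k. fourier m (D k) \<gamma> = 0) \<longrightarrow> fourier_stieltjes \<mu> \<gamma> = 0)"
      by (rule weak_cluster_measure[where D=D and J=J and K=K and U=U and B=B, OF assms(1) mD(1) Di]) (use D J KU small one in blast)+
    then obtain \<mu> where \<mu>: "\<mu> \<in> M_space" "\<mu> (\<Inter>n. J n) \<noteq> 0"
      "\<forall>\<gamma>\<in>dual_group. (\<forall>k. fourier m (D k) \<gamma> = 0) \<longrightarrow> fourier_stieltjes \<mu> \<gamma> = 0" by blast
    have "\<mu> \<in> M_spectrum \<Lambda>"
      using \<mu>(1,3) D(1) by (auto simp: M_spectrum_def L1_spectrum_def)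
    moreover have "(\<Inter>n. J n) \<in> sets borel"
    proof -
      have [measurable]: "J n \<in> sets borel" for n using J(1) by blast
      show ?thesis by measurable
    qed
    moreover have "emeasure m (\<Inter>n. J n) = 0"
    proof -
      have "measure m (\<Inter>n. J n) \<le> measure m (J n)" for n
        using J(1) mD(1) by (intro finite_measure_mono) auto
      then have "measure m (\<Inter>n. J n) \<le> 0"
        by (intro tendsto_lowerbound[OF J(2) always_eventually sequentially_bot] allI)
      then show ?thesis by (simp add: emeasure_eq_measure measure_le_0_iff)
    qed
    ultimately have "\<mu> (\<Inter>n. J n) = 0" using assms(6) unfolding riesz_set_def by blast
    with \<mu>(2) show False by contradiction
  qed
  then show ?thesis using sub unfolding small_subspace_def by blast
qed

end
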